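(* Let $f(q)=\sum_{n=0}^\infty (1-q)(1-q^2)\cdots(1-q^n)$ and let $F(x)=e^{-1/(24x)}f(e^{-1/x})\in\mathbb{Q}[[1/x]]$. (a) The formal power series $F(x)$ has resurgent Borel transform. (b) The median summation $S^{\mathrm{med}}$ of $F$, defined on $\{x\in\mathbb{C}\mid \Re(x)>0\}$, extends (by radial limits) to the points $\frac{1}{2\pi i}\mathbb{Q}$ of its natural boundary $\Re(x)=0$, and for all $\alpha\in\mathbb{Q}$, $\alpha\neq 0$, we have $$S^{\mathrm{med}}\left(-\frac{1}{2\pi i\alpha}\right)=e^{\pi i\alpha/12}f(e^{2\pi i\alpha}).$$
   Context: The $n=0$ term of $f$ is $1$. Although $f(q)$ is not an analytic function of $q$ inside or outside the unit circle, it has a Taylor series at $q=1$ (so substituting $q=e^{-1/x}$ and expanding in powers of $1/x$ gives a formal power series), and it has a well-defined value at each complex root of unity, where the sum is finite. Write $F(x)=\sum_{n\ge0}c_n x^{-n}$ (so $c_0=1$). The Borel transform of $F$ is $G(p)=\sum_{n\ge 0}c_{n+1}\frac{p^n}{n!}$. If $F$ is Gevrey-1, i.e. $|c_n|\le C'C^n n!$ for some constants $C,C'>0$ and all $n$, then $G$ is analytic near $p=0$. One says that $F$ has resurgent Borel transform if $F$ is Gevrey-1, $G$ extends from a neighborhood of $0$ to a (possibly multivalued) analytic function on $\mathbb{C}\setminus\mathcal{N}$ for some discrete set $\mathcal{N}$, and the growth of $G$ at infinity is at most exponential, so that the (averaged) Laplace transform below is defined in a right half-plane. When $\mathcal{N}\subset(0,\infty)$,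 the median summation of $F$ is $$S^{\mathrm{med}}(x)=c_0+\frac12\left(\int_{\gamma_+}e^{-px}G(p)\,dp+\int_{\gamma_-}e^{-px}G(p)\,dp\right),$$ where $\gamma_+$ (resp. $\gamma_-$) is a path from $0$ to $\infty$ following the positive real axis and avoiding every point of $\mathcal{N}$ from above (resp. from below), with $G$ analytically continued along the path; equivalently a ray $\arg p=\theta$ (resp. $\arg p=-\theta$) with $\theta>0$ small depending on $x$. The radial limit at a point $x_0$ with $\Re(x_0)=0$ is the limit as $x=x_0+t$, $t\to0^+$; the value of $S^{\mathrm{med}}$ at a point of $\frac{1}{2\pi i}\mathbb{Q}$ denotes this limit. *)

theory Defs
  imports "HOL-Complex_Analysis.Complex_Analysis"
begin

section \<open>The series of Kontsevich and Zagier\<close>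

text \<open>
  The sum is taken in the topology of the ring that \<open>q\<close> lives in. It is used for \<open>q\<close> a complex
  root of unity, where it is finite, and for \<open>q = e\<^sup>-\<^sup>X\<close> a formal power series,
  where it converges \<open>X\<close>-adically; see the two summability lemmas below.
\<close>

definition KZ :: "'a :: {comm_ring_1, topological_space} \<Rightarrow> 'a" where
  "KZ q = (\<Sum>n. \<Prod>k=1..n. 1 - q ^ k)"

lemma summable_KZ_root_of_unity:
  fixes q :: complex
  assumes "q ^ m = 1" and "m > 0"
  shows "summable (\<lambda>n. \<Prod>k=1..n. 1 - q ^ k)"
proof (rule summable_finite)
  show "finite {..<m}"
    by simp
  fix n assume "n \<notin> {..<m}"
  with assms show "(\<Prod>k=1..n. 1 - q ^ k) = 0"
    by (intro prod_zero bexI[of _ m]) auto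
qed

lemma summable_KZ_fps_exp:
  "summable (\<lambda>n. \<Prod>k=1..n. 1 - fps_exp (-1 :: rat) ^ k)"
proof -
  define u where "u = (\<lambda>n. \<Prod>k=1..n. 1 - fps_exp (-1 :: rat) ^ k)"
  have u_nth: "fps_nth (u n) j = 0" if "j < n" for j n
    using that
  proof (induction n arbitrary: j)
    case (Suc n)
    have "fps_nth (u (Suc n)) j
        = (\<Sum>i=0..j. fps_nth (u n) i * fps_nth (1 - fps_exp (-1 :: rat) ^ Suc n) (j - i))"
      by (simp add: u_def fps_mult_nth)
    also have "\<dots> = 0"
    proof (intro sum.neutral ballI)
      fix i assume i: "i \<in> {0..j}"
      show "fps_nth (u n) i * fps_nth (1 - fps_exp (-1 :: rat) ^ Suc n) (j - i) = 0"
      proof (cases "i < n")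
        case True
        then show ?thesis using Suc.IH by simp
      next
        case False
        with i Suc.prems have "j - i = 0" by auto
        then show ?thesis by (simp add: fps_exp_power_mult del: power_Suc)
      qed
    qed
    finally show ?case .
  qed simp
  have "(\<lambda>n. \<Sum>i<n. u i) \<longlonglongrightarrow> Abs_fps (\<lambda>j. \<Sum>i\<le>j. fps_nth (u i) j)"
  proof (rule tendsto_fpsI)
    fix j
    have "fps_nth (\<Sum>i<n. u i) j = (\<Sum>i\<le>j. fps_nth (u i) j)" if "n \<ge> Suc j" for n
      unfolding fps_sum_nth using that by (intro sum.mono_neutral_right) (auto simp: u_nth)
    then show "eventually (\<lambda>n. fps_nth (\<Sum>i<n. u i) j
        = fps_nth (Abs_fps (\<lambda>j. \<Sum>i\<le>j. fps_nth (u i) j)) j) sequentially"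
      by (auto intro: eventually_sequentiallyI[of "Suc j"])
  qed
  then show ?thesis
    unfolding u_def[symmetric] summable_def sums_def by blast
qed

text \<open>
  A formal power series in \<open>1/x\<close> is an \<open>fps\<close> whose variable \<open>X\<close> stands for \<open>1/x\<close>; thus
  \<open>fps_exp a\<close> is \<open>e\<^sup>a\<^sup>/\<^sup>x\<close>.
\<close>

definition KZ_F_rat :: "rat fps" where
  "KZ_F_rat = fps_exp (- 1 / 24) * KZ (fps_exp (- 1))"

definition KZ_F :: "complex fps" where
  "KZ_F = Abs_fps (\<lambda>n. of_rat (fps_nth KZ_F_rat n))"


section \<open>Analytic continuation along paths\<close>

text \<open>
  The germ of \<open>h\<close> at the end of \<open>\<gamma>\<close> arises by analytic continuation along \<open>\<gamma>\<close> of the germ of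
  \<open>g\<close> at its start. Functions represent germs; their values far from \<open>\<gamma>\<close> are irrelevant.
\<close>

definition continuation_along ::
  "(complex \<Rightarrow> complex) \<Rightarrow> (real \<Rightarrow> complex) \<Rightarrow> (complex \<Rightarrow> complex) \<Rightarrow> bool"
where
  "continuation_along g \<gamma> h \<longleftrightarrow>
     path \<gamma> \<and>
     (\<exists>\<Phi> :: real \<Rightarrow> complex \<Rightarrow> complex.
        (\<forall>t\<in>{0..1}. \<Phi> t analytic_on {\<gamma> t} \<and>
           (\<forall>\<^sub>F s in at t within {0..1}. \<forall>\<^sub>F z in nhds (\<gamma> s). \<Phi> s z = \<Phi> t z)) \<and>
        (\<forall>\<^sub>F z in nhds (pathstart \<gamma>). \<Phi> 0 z = g z) \<and>
        (\<forall>\<^sub>F z in nhds (pathfinish \<gamma>). \<Phi> 1 z = h z))"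

definition continued_value ::
  "(complex \<Rightarrow> complex) \<Rightarrow> (real \<Rightarrow> complex) \<Rightarrow> complex"
where
  "continued_value g \<gamma> = (THE v. \<exists>h. continuation_along g \<gamma> h \<and> h (pathfinish \<gamma>) = v)"


section \<open>Resurgence\<close>

definition borel_transform :: "complex fps \<Rightarrow> complex fps" where
  "borel_transform F = Abs_fps (\<lambda>n. fps_nth F (n + 1) / fact n)"

definition gevrey1 :: "complex fps \<Rightarrow> bool" where
  "gevrey1 F \<longleftrightarrow>
     (\<exists>C C'. C > 0 \<and> C' > 0 \<and> (\<forall>n. norm (fps_nth F n) \<le> C' * C ^ n * fact n))"

text \<open>
  Paths issuing from \<open>0\<close> that avoid \<open>N\<close> from then on. The start is exempt, since the
  Borel transform is analytic at \<open>0\<close> even if another of its branches is singular there.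
\<close>

definition path_avoiding :: "complex set \<Rightarrow> (real \<Rightarrow> complex) \<Rightarrow> bool" where
  "path_avoiding N \<gamma> \<longleftrightarrow> path \<gamma> \<and> pathstart \<gamma> = 0 \<and> (\<forall>t\<in>{0<..1}. \<gamma> t \<notin> N)"

definition borel_branch ::
  "complex fps \<Rightarrow> complex set \<Rightarrow> complex set \<Rightarrow> (complex \<Rightarrow> complex) \<Rightarrow> bool"
where
  "borel_branch F N D h \<longleftrightarrow>
     h holomorphic_on D \<and>
     (\<exists>\<gamma>. path_avoiding N \<gamma> \<and> pathfinish \<gamma> \<in> D \<and>
          continuation_along (eval_fps (borel_transform F)) \<gamma> h)"

text \<open>
  A multivalued analytic extension of the Borel transform to the complement of \<open>N\<close> is
  continuability along every path that avoids \<open>N\<close>. Exponential growth cannot be demanded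
  uniformly in all the (infinitely many) branches at a point, nor near the singularities; it is
  demanded for each branch over a convex region (a ray's neighbourhood, a sector, a half-plane,
  \<dots>), at positive distance from \<open>N\<close>, with an exponential rate \<open>A\<close> independent of that distance.
\<close>

definition resurgent_outside :: "complex set \<Rightarrow> complex fps \<Rightarrow> bool" where
  "resurgent_outside N F \<longleftrightarrow>
     closed N \<and> discrete N \<and> gevrey1 F \<and>
     (\<forall>\<gamma>. path_avoiding N \<gamma> \<longrightarrow>
        (\<exists>h. continuation_along (eval_fps (borel_transform F)) \<gamma> h)) \<and>
     (\<forall>D h. open D \<and> convex D \<and> D \<inter> N = {} \<and> borel_branch F N D h \<longrightarrow>
        (\<exists>A. \<forall>\<epsilon>>0. \<exists>C. \<forall>p\<in>D. (\<forall>w\<in>N. \<epsilon> \<le> dist p w) \<longrightarrow>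
           norm (h p) \<le> C * exp (A * norm p)))"

definition has_resurgent_borel_transform :: "complex fps \<Rightarrow> bool" where
  "has_resurgent_borel_transform F \<longleftrightarrow> (\<exists>N. resurgent_outside N F)"


section \<open>Median summation\<close>

text \<open>
  The integrand of the Laplace integral along the ray of argument \<open>\<theta>\<close>, parametrised by
  \<open>p = r e\<^sup>i\<^sup>\<theta>\<close>, with the Borel transform continued along that ray.
\<close>

definition laplace_integrand :: "complex fps \<Rightarrow> complex \<Rightarrow> real \<Rightarrow> real \<Rightarrow> complex" where
  "laplace_integrand F x \<theta> r =
     exp (- (of_real r * cis \<theta>) * x) *
     continued_value (eval_fps (borel_transform F)) (linepath 0 (of_real r * cis \<theta>)) * cis \<theta>"

definition has_median_sum :: "complex fps \<Rightarrow> complex \<Rightarrow> complex \<Rightarrow> bool" where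
  "has_median_sum F x s \<longleftrightarrow>
     (\<forall>\<^sub>F \<theta> in at_right 0.
        set_integrable lborel {0<..} (laplace_integrand F x \<theta>) \<and>
        set_integrable lborel {0<..} (laplace_integrand F x (- \<theta>)) \<and>
        s = fps_nth F 0 +
            ((LINT r:{0<..}|lborel. laplace_integrand F x \<theta> r) +
             (LINT r:{0<..}|lborel. laplace_integrand F x (- \<theta>) r)) / 2)"

definition median_sum :: "complex fps \<Rightarrow> complex \<Rightarrow> complex" where
  "median_sum F x = (THE s. has_median_sum F x s)"


section \<open>Boundary behaviour in the right half-plane\<close>

definition has_radial_limit :: "(complex \<Rightarrow> complex) \<Rightarrow> complex \<Rightarrow> complex \<Rightarrow> bool" where
  "has_radial_limit S x\<^sub>0 l \<longleftrightarrow> ((\<lambda>t. S (x\<^sub>0 + of_real t)) \<longlongrightarrow> l) (at_right 0)"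

definition imaginary_axis_natural_boundary :: "(complex \<Rightarrow> complex) \<Rightarrow> bool" where
  "imaginary_axis_natural_boundary S \<longleftrightarrow>
     S holomorphic_on {x. Re x > 0} \<and>
     (\<forall>x\<^sub>0 r h. Re x\<^sub>0 = 0 \<and> r > 0 \<and> h holomorphic_on ball x\<^sub>0 r \<longrightarrow>
        \<not> (\<forall>x\<in>ball x\<^sub>0 r. Re x > 0 \<longrightarrow> h x = S x))"

end

theory Submission
  imports Defs
begin

text \<open>
  The median sum of \<open>F\<close> is shown to be a theta series: for \<open>Re x > 0\<close>,
  \<open>S x = - 1/2 * (\<Sum>n. n * chi n * exp (- n\<^sup>2 / (24 * x)))\<close>, where \<open>chi\<close> is the even quadratic
  character modulo 12 (\<open>median_sum_KZ_F\<close>). Everything about \<open>S\<close> follows from this formula.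

  \<^bold>\<open>The Borel transform.\<close> Following Zagier, deform \<open>f\<close> by a variable \<open>\<xi> = q\<^sup>y\<close>. The deformed
  series satisfies a first-order \<open>q\<close>-difference equation in \<open>\<xi>\<close>; its coefficients in powers of \<open>1/x\<close>
  are polynomials in \<open>y\<close>, and polynomial solutions are unique. This expresses the coefficients of \<open>F\<close> by
  those of \<open>(e\<^sup>v - e\<^sup>5\<^sup>v) / (1 + e\<^sup>6\<^sup>v)\<close> (\<open>qseries_0_nth\<close>), that is, of \<open>sin 2v / cos 3v\<close>. Its partial
  fractions (\<open>sin_cos_partial_fractions\<close>) turn the coefficients into power sums over the poles, and the
  Borel transform becomes the sum of \<open>(3 * sqrt 3 / 2) * chi m * sqrt a * (a - p)\<^sup>-\<^sup>5\<^sup>/\<^sup>2\<close> over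
  \<open>a = (pi * m)\<^sup>2 / 6\<close> (\<open>eval_fps_borel_transform_KZ_F\<close>). All its branches arise by choosing signs of
  square roots, so they can be continued along every path that avoids these points and satisfy a common
  bound (\<open>borel_continuation_along_path\<close>, \<open>borel_branch_growth\<close>).

  \<^bold>\<open>The median sum.\<close> Multiplication of a Laplace integral by \<open>x\<^sup>-\<^sup>3\<^sup>/\<^sup>2\<close> is convolution of the
  integrand with a square root, and this makes \<open>(a - p)\<^sup>-\<^sup>5\<^sup>/\<^sup>2\<close> rational
  (\<open>laplace_root_power_five\<close>). The sum over \<open>a\<close> is then again \<open>sin 2v / cos 3v\<close>, with \<open>p = 6 v\<^sup>2\<close>. In
  the upper half-plane this function is, up to a constant, the generating series of \<open>chi\<close> in powers of \<open>e\<^sup>i\<^sup>v\<close>, and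
  integration of every term over the two rays yields a Gaussian (\<open>theta_representation\<close>,
  \<open>median_representation\<close>).

  \<^bold>\<open>The radial limits.\<close> Near the boundary point that belongs to a rational \<open>\<alpha>\<close> the theta series is one
  with twisted weights \<open>chi n * exp (pi i \<alpha> n\<^sup>2 / 12)\<close> and a parameter that tends to infinity, and it has the
  same representation by Laplace integrals. Hence its limit is determined by the slope at \<open>v = 0\<close> of the
  generating function of these weights (\<open>theta_limit\<close>). That function satisfies the \<open>q\<close>-difference equation
  at \<open>q = e\<^sup>2\<^sup>\<pi>\<^sup>i\<^sup>\<alpha>\<close>, which at a root of unity has one solution only, a rational function whose slope
  contains the value of \<open>f\<close> (\<open>twisted_kernel_eq_qrational\<close>, \<open>twisted_kernel_near_0\<close>).

  \<^bold>\<open>The natural boundary.\<close> In the variable \<open>1/x\<close> the theta series is lacunary with unbounded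
  coefficients. Integrated against a smooth weight on an arbitrarily short arc, such a series reproduces
  each coefficient up to a bounded error, so it is unbounded near every arc
  (\<open>theta_unbounded_near_arc\<close>).
\<close>

section \<open>Uniqueness of analytic continuation\<close>

lemma analytic_at_obtain_ball:
  assumes "f analytic_on {w}" "g analytic_on {w}"
  obtains r where "r > 0" "f holomorphic_on ball w r" "g holomorphic_on ball w r"
proof -
  obtain r1 r2 where "r1 > 0" "f holomorphic_on ball w r1" "r2 > 0" "g holomorphic_on ball w r2"
    using assms unfolding analytic_on_def by auto
  thus ?thesis
    by (intro that[of "min r1 r2"]) (auto elim!: holomorphic_on_subset)
qed

lemma holomorphic_eq_from_germ:
  fixes f g :: "complex \<Rightarrow> complex"
  assumes "f holomorphic_on S" "g holomorphic_on S" "open S" "connected S" "w \<in> S"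
    and "\<forall>\<^sub>F z in nhds w. f z = g z" and "z \<in> S"
  shows "f z = g z"
proof -
  obtain T where T: "open T" "w \<in> T" "\<And>z. z \<in> T \<Longrightarrow> f z = g z"
    using assms(6) unfolding eventually_nhds by auto
  show ?thesis
    by (rule analytic_continuation_open[of "S \<inter> T" S f g])
       (use assms T in auto)
qed

text \<open>
  Connectedness of the parameter interval: the set of times at which two continuations of the same
  germ agree is both open and closed.
\<close>

lemma continuation_unique:
  assumes "continuation_along g \<gamma> h1" "continuation_along g \<gamma> h2"
  shows "\<forall>\<^sub>F z in nhds (pathfinish \<gamma>). h1 z = h2 z"
proof -
  obtain \<Phi> where \<Phi>: "\<And>t. t \<in> {0..1} \<Longrightarrow> \<Phi> t analytic_on {\<gamma> t}"
      "\<And>t. t \<in> {0..1} \<Longrightarrow> \<forall>\<^sub>F s in at t within {0..1}. \<forall>\<^sub>F z in nhds (\<gamma> s). \<Phi> s z = \<Phi> t z"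
      "\<forall>\<^sub>F z in nhds (pathstart \<gamma>). \<Phi> 0 z = g z" "\<forall>\<^sub>F z in nhds (pathfinish \<gamma>). \<Phi> 1 z = h1 z"
    and path: "path \<gamma>"
    using assms(1) unfolding continuation_along_def by blast
  obtain \<Psi> where \<Psi>: "\<And>t. t \<in> {0..1} \<Longrightarrow> \<Psi> t analytic_on {\<gamma> t}"
      "\<And>t. t \<in> {0..1} \<Longrightarrow> \<forall>\<^sub>F s in at t within {0..1}. \<forall>\<^sub>F z in nhds (\<gamma> s). \<Psi> s z = \<Psi> t z"
      "\<forall>\<^sub>F z in nhds (pathstart \<gamma>). \<Psi> 0 z = g z" "\<forall>\<^sub>F z in nhds (pathfinish \<gamma>). \<Psi> 1 z = h2 z"
    using assms(2) unfolding continuation_along_def by blast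
  define E where "E = (\<lambda>t. \<forall>\<^sub>F z in nhds (\<gamma> t). \<Phi> t z = \<Psi> t z)"
  \<comment> \<open>agreement of the germs is a locally constant property of the time\<close>
  have loc: "\<forall>\<^sub>F s in at t within {0..1}. E s \<longleftrightarrow> E t" if t: "t \<in> {0..1}" for t
  proof -
    obtain r where r: "r > 0" "\<Phi> t holomorphic_on ball (\<gamma> t) r" "\<Psi> t holomorphic_on ball (\<gamma> t) r"
      using analytic_at_obtain_ball \<Phi>(1)[OF t] \<Psi>(1)[OF t] by blast
    have "(\<gamma> \<longlongrightarrow> \<gamma> t) (at t within {0..1})"
      using path t unfolding path_def continuous_on_def by auto
    hence "\<forall>\<^sub>F s in at t within {0..1}. \<gamma> s \<in> ball (\<gamma> t) r"
      using r(1) by (simp add: tendsto_iff dist_commute)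
    with \<Phi>(2)[OF t] \<Psi>(2)[OF t] show ?thesis
    proof eventually_elim
      case (elim s)
      have same: "(\<forall>\<^sub>F z in nhds w. \<Phi> t z = \<Psi> t z) \<Longrightarrow> (\<forall>\<^sub>F z in nhds w'. \<Phi> t z = \<Psi> t z)"
        if "w \<in> ball (\<gamma> t) r" "w' \<in> ball (\<gamma> t) r" for w w'
      proof -
        assume *: "\<forall>\<^sub>F z in nhds w. \<Phi> t z = \<Psi> t z"
        have "\<forall>\<^sub>F z in nhds w'. z \<in> ball (\<gamma> t) r"
          using that by (intro eventually_nhds_in_open) auto
        thus ?thesis
        proof eventually_elim
          case (elim z)
          thus ?case
            using holomorphic_eq_from_germ[OF r(2,3) open_ball _ that(1) *] by simp
        qed
      qed
      have "E s \<longleftrightarrow> (\<forall>\<^sub>F z in nhds (\<gamma> s). \<Phi> t z = \<Psi> t z)"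
        unfolding E_def
      proof
        assume "\<forall>\<^sub>F z in nhds (\<gamma> s). \<Phi> s z = \<Psi> s z"
        with elim(1,2) show "\<forall>\<^sub>F z in nhds (\<gamma> s). \<Phi> t z = \<Psi> t z"
          by eventually_elim simp
      next
        assume "\<forall>\<^sub>F z in nhds (\<gamma> s). \<Phi> t z = \<Psi> t z"
        with elim(1,2) show "\<forall>\<^sub>F z in nhds (\<gamma> s). \<Phi> s z = \<Psi> s z"
          by eventually_elim simp
      qed
      also have "\<dots> \<longleftrightarrow> E t"
        unfolding E_def using same[of "\<gamma> s" "\<gamma> t"] same[of "\<gamma> t" "\<gamma> s"] elim(3) r(1) by auto
      finally show ?case .
    qed
  qed
  have "E 1"
  proof (rule connected_induction_simple[of "{0..1::real}" 0 1 E])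
    show "E 0"
      unfolding E_def using \<Phi>(3) \<Psi>(3) unfolding pathstart_def by eventually_elim simp
    fix t :: real assume t: "t \<in> {0..1}"
    obtain T where T: "open T" "t \<in> T" "\<And>s. s \<in> T \<Longrightarrow> s \<noteq> t \<Longrightarrow> s \<in> {0..1} \<Longrightarrow> E s \<longleftrightarrow> E t"
      using loc[OF t] unfolding eventually_at_topological by blast
    show "\<exists>T. openin (top_of_set {0..1}) T \<and> t \<in> T \<and> (\<forall>x\<in>T. \<forall>y\<in>T. E x \<longrightarrow> E y)"
    proof (intro exI conjI ballI impI)
      show "openin (top_of_set {0..1}) ({0..1} \<inter> T)"
        using T by auto
      fix x y assume "x \<in> {0..1} \<inter> T" "y \<in> {0..1} \<inter> T" "E x"
      thus "E y" using T(3)[of x] T(3)[of y] by auto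
    qed (use T t in auto)
  qed auto
  thus ?thesis
    unfolding E_def using \<Phi>(4) \<Psi>(4) unfolding pathfinish_def by eventually_elim simp
qed

lemma continuation_along_holomorphic:
  assumes "path \<gamma>" "path_image \<gamma> \<subseteq> S" "open S" "h holomorphic_on S"
    and "\<forall>\<^sub>F z in nhds (pathstart \<gamma>). h z = g z"
  shows "continuation_along g \<gamma> h"
  unfolding continuation_along_def
proof (intro conjI exI[of _ "\<lambda>_. h"] ballI)
  fix t :: real assume "t \<in> {0..1}"
  hence "\<gamma> t \<in> S" using assms(2) by (auto simp: path_image_def)
  thus "h analytic_on {\<gamma> t}"
    using assms(3,4) analytic_on_open analytic_on_subset by blast
qed (use assms in auto)

lemma continued_value_eq:
  assumes "continuation_along g \<gamma> h"
  shows "continued_value g \<gamma> = h (pathfinish \<gamma>)"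
  unfolding continued_value_def
proof (rule the_equality)
  show "\<exists>h'. continuation_along g \<gamma> h' \<and> h' (pathfinish \<gamma>) = h (pathfinish \<gamma>)"
    using assms by blast
next
  fix v assume "\<exists>h'. continuation_along g \<gamma> h' \<and> h' (pathfinish \<gamma>) = v"
  thus "v = h (pathfinish \<gamma>)"
    using continuation_unique[OF assms] eventually_nhds_x_imp_x by fastforce
qed

text \<open>
  Locally uniform domination by a summable sequence suffices; the bound may depend on the centre,
  as it does for theta series near the boundary of the half-plane.
\<close>

lemma holomorphic_suminf:
  fixes f :: "nat \<Rightarrow> complex \<Rightarrow> complex"
  assumes "open S" "\<And>n. f n holomorphic_on S"
    and "\<And>x. x \<in> S \<Longrightarrow> \<exists>d M. 0 < d \<and> summable M \<and> (\<forall>n. \<forall>y\<in>ball x d \<inter> S. norm (f n y) \<le> M n)"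
  shows "(\<lambda>x. \<Sum>n. f n x) holomorphic_on S"
proof -
  have "\<exists>g g'. \<forall>x\<in>S. ((\<lambda>n. f n x) sums g x) \<and> ((\<lambda>n. deriv (f n) x) sums g' x) \<and>
          (g has_field_derivative g' x) (at x)"
  proof (rule series_and_derivative_comparison_local[OF assms(1)])
    show "(f n has_field_derivative deriv (f n) x) (at x)" if "x \<in> S" for n x
      using assms(1,2) that holomorphic_derivI by blast
    show "\<exists>d h. 0 < d \<and> summable h \<and> (\<forall>\<^sub>F n in sequentially. \<forall>y\<in>ball x d \<inter> S. norm (f n y) \<le> h n)"
      if "x \<in> S" for x
      using assms(3)[OF that] by (auto intro!: always_eventually)
  qed
  then obtain g g' where g: "\<And>x. x \<in> S \<Longrightarrow> (\<lambda>n. f n x) sums g x"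
      "\<And>x. x \<in> S \<Longrightarrow> (g has_field_derivative g' x) (at x)" by blast
  have "g holomorphic_on S"
    using g(2) by (auto simp: holomorphic_on_def field_differentiable_def intro: has_field_derivative_at_within)
  also have "?this \<longleftrightarrow> ?thesis"
    by (intro holomorphic_cong) (auto simp: sums_unique[OF g(1)])
  finally show ?thesis .
qed

section \<open>Branches of the Borel transform\<close>

text \<open>
  The even quadratic character modulo 12, which is Kronecker's symbol \<open>(12/n)\<close>.
\<close>

definition chi :: "nat \<Rightarrow> complex" where
  "chi n = (if n mod 12 \<in> {1, 11} then 1 else if n mod 12 \<in> {5, 7} then -1 else 0)"

lemma chi_0 [simp]: "chi 0 = 0" and chi_1 [simp]: "chi (Suc 0) = 1"
  by (simp_all add: chi_def)

lemma norm_chi_le: "norm (chi n) \<le> 1"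
  by (simp add: chi_def)

text \<open>
  The singularities of all branches of the Borel transform are among these numbers, for \<open>m > 0\<close>.
\<close>

definition sing :: "nat \<Rightarrow> real" where "sing m = (pi * real m)\<^sup>2 / 6"

lemma sing_pos: "m > 0 \<Longrightarrow> sing m > 0"
  by (simp add: sing_def)

lemma sing_ge: "sing m \<ge> real m ^ 2"
proof -
  have "pi^2 \<ge> 3^2" using pi_gt3 by (intro power_mono) auto
  hence "pi^2 * real m ^ 2 \<ge> 9 * real m ^ 2" by (intro mult_right_mono) auto
  moreover have "0 \<le> real m ^ 2" by simp
  ultimately have "6 * real m ^ 2 \<le> pi^2 * real m ^ 2" by linarith
  thus ?thesis by (simp add: sing_def power_mult_distrib mult.commute)
qed

definition sings :: "complex set" where "sings = (\<lambda>m. complex_of_real (sing m)) ` {1..}"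

lemma sing_in_sings: "m > 0 \<Longrightarrow> of_real (sing m) \<in> sings"
  unfolding sings_def by (intro imageI) auto

lemma sing_diff: 
  assumes "m < n" shows "sing n - sing m \<ge> 1"
proof -
  have "real m + 1 \<le> real n" using assms by linarith
  hence "(real m + 1)^2 \<le> real n ^ 2" by (intro power_mono) auto
  hence *: "real n ^ 2 - real m ^ 2 \<ge> 1" by (simp add: power2_eq_square algebra_simps)
  have "pi^2 \<ge> 3^2" using pi_gt3 by (intro power_mono) auto
  hence "pi^2 / 6 * (real n ^ 2 - real m ^ 2) \<ge> 1 * 1" using * by (intro mult_mono) auto
  thus ?thesis by (simp add: sing_def power_mult_distrib algebra_simps diff_divide_distrib)
qed

lemma uniform_discrete_sings: "uniform_discrete sings"
  unfolding uniform_discrete_def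
proof (intro exI[of _ 1] conjI ballI impI)
  fix x y assume "x \<in> sings" "y \<in> sings" "dist x y < 1"
  then obtain m n where mn: "x = of_real (sing m)" "y = of_real (sing n)" by (auto simp: sings_def)
  hence "\<bar>sing m - sing n\<bar> < 1" 
    using \<open>dist x y < 1\<close> by (metis dist_norm norm_of_real of_real_diff)
  hence "m = n" using sing_diff[of m n] sing_diff[of n m] by (cases m n rule: linorder_cases) auto
  thus "x = y" using mn by simp
qed auto

lemma closed_sings: "closed sings" and discrete_sings: "discrete sings"
  using uniform_discrete_sings uniform_discrete_imp_closed uniform_discrete_imp_discrete by auto

lemma summable_inverse_sing: "summable (\<lambda>m. 1 / sing m)"
proof (rule summable_comparison_test)
  show "\<exists>N. \<forall>n\<ge>N. norm (1 / sing n) \<le> inverse (real n ^ 2)"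
    using sing_ge by (intro exI[of _ 1] allI impI) (auto simp: field_simps sing_pos abs_of_pos)
  show "summable (\<lambda>n. inverse (real n ^ 2))"
    by (rule inverse_power_summable) auto
qed

lemma summable_inverse_sing_power:
  assumes "k > 0" shows "summable (\<lambda>m. 1 / sing m ^ k)"
proof (rule summable_comparison_test[OF _ summable_inverse_sing], intro exI[of _ 1] allI impI)
  fix n :: nat assume n: "n \<ge> 1"
  have "1 \<le> real n ^ 2" using n by simp
  hence "sing n \<ge> 1" using sing_ge[of n] by linarith
  hence "sing n ^ 1 \<le> sing n ^ k" using assms by (intro power_increasing) auto
  thus "norm (1 / sing n ^ k) \<le> 1 / sing n"
    using \<open>sing n \<ge> 1\<close> by (simp add: field_simps abs_of_pos)
qed

text \<open>
  Every branch of the Borel transform is of this form: \<open>\<sigma> m p\<close> is a choice of the square root of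
  \<open>sing m - p\<close>, so that the summand is \<open>(sing m - p)\<^sup>-\<^sup>5\<^sup>/\<^sup>2\<close> up to a constant. Different branches
  differ in infinitely many independent signs. The term at \<open>m = 0\<close> vanishes because \<open>chi 0 = 0\<close>.
\<close>

definition branch_sum :: "(nat \<Rightarrow> complex \<Rightarrow> complex) \<Rightarrow> complex \<Rightarrow> complex" where
  "branch_sum \<sigma> p =
     (\<Sum>m. 3 * sqrt 3 / 2 * chi m * sqrt (sing m) / \<sigma> m p ^ 5)"

text \<open>
  If \<open>sing m\<close> is large compared with \<open>p\<close> the difference is comparable to \<open>sing m\<close>; otherwise
  \<open>sing m\<close> is at most of the order of \<open>p\<close> and the distance to the singularities takes over. One
  bound covers both cases, at the cost of the factor \<open>1 + norm p\<close>, which is what makes the growth of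
  all branches polynomial away from the singularities.
\<close>

lemma norm_sing_minus_ge:
  assumes "\<forall>w\<in>sings. \<epsilon> \<le> dist p w" "0 < \<epsilon>" "\<epsilon> \<le> 1" "m > 0"
  shows "norm (of_real (sing m) - p) \<ge> \<epsilon> * sing m / (2 * (1 + norm p))"
proof (cases "sing m \<ge> 2 * norm p")
  case True
  have "\<epsilon> * sing m / (2 * (1 + norm p)) \<le> 1 * sing m / (2 * 1)"
    using assms by (intro frac_le mult_mono) (auto simp: sing_def)
  also have "\<dots> \<le> sing m - norm p" using True by simp
  also have "\<dots> \<le> norm (of_real (sing m) - p)"
    using norm_triangle_ineq2[of "of_real (sing m)" p] sing_pos[OF assms(4)] by simp
  finally show ?thesis .
next
  case False
  have "\<epsilon> * sing m / (2 * (1 + norm p)) \<le> \<epsilon>"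
  proof -
    have "sing m \<le> 2 * (1 + norm p)" using False by simp
    moreover have "1 + norm p > 0" by (simp add: add_pos_nonneg)
    ultimately show ?thesis using assms by (simp add: pos_divide_le_eq)
  qed
  also have "\<dots> \<le> dist p (of_real (sing m))"
    using assms by (auto simp: sings_def)
  finally show ?thesis by (simp add: dist_norm norm_minus_commute)
qed

definition branch_bound :: "real \<Rightarrow> real \<Rightarrow> nat \<Rightarrow> real" where
  "branch_bound \<epsilon> R m = 3 * (2 * (1 + R) / \<epsilon>) ^ 3 * (1 / sing m ^ 2)"

lemma summable_branch_bound: "summable (branch_bound \<epsilon> R)"
  unfolding branch_bound_def by (intro summable_mult summable_inverse_sing_power) auto

text \<open>
  The modulus of a square root does not depend on its sign, so one bound serves all branches.
\<close>

lemma branch_term_le: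
  assumes "\<forall>w\<in>sings. \<epsilon> \<le> dist p w" "0 < \<epsilon>" "\<epsilon> \<le> 1" "norm p \<le> R"
    and "m > 0 \<Longrightarrow> s ^ 2 = of_real (sing m) - p"
  shows "norm (3 * sqrt 3 / 2 * chi m * sqrt (sing m) / s ^ 5) \<le> branch_bound \<epsilon> R m"
proof (cases "m = 0")
  case True
  thus ?thesis by (simp add: branch_bound_def sing_def)
next
  case False
  hence a: "sing m > 0" using sing_pos by simp
  define c where "c = \<epsilon> / (2 * (1 + R))"
  have R: "R \<ge> 0" using assms(4) norm_ge_zero order_trans by blast
  have c: "c > 0" "c \<le> 1" using assms R by (auto simp: c_def field_simps)
  have "c * sing m \<le> \<epsilon> * sing m / (2 * (1 + norm p))"
    unfolding c_def using assms a by (simp add: frac_le add_pos_nonneg)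
  also have "\<dots> \<le> norm (of_real (sing m) - p)"
    using norm_sing_minus_ge[of \<epsilon> p m] assms False by auto
  also have "\<dots> = norm s ^ 2" using assms(5) False by (simp flip: norm_power)
  finally have s2: "c * sing m \<le> norm s ^ 2" .
  hence "sqrt (c * sing m) \<le> norm s" by (intro real_le_lsqrt) auto
  hence "sqrt (c * sing m) ^ 5 \<le> norm s ^ 5" using c a by (intro power_mono) auto
  have "c ^ 3 * (sing m ^ 2 * sqrt (sing m)) \<le> (c ^ 2 * sqrt c) * (sing m ^ 2 * sqrt (sing m))"
  proof (intro mult_right_mono)
    have "c * c \<le> c * 1" using c by (intro mult_left_mono) auto
    hence "c \<le> sqrt c" using c by (intro real_le_rsqrt) (auto simp: power2_eq_square)
    hence "c^2 * c \<le> c^2 * sqrt c" using c by (intro mult_left_mono) auto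
    thus "c ^ 3 \<le> c^2 * sqrt c" by (simp add: power3_eq_cube power2_eq_square)
  qed (use a in auto)
  also have "\<dots> = sqrt (c * sing m) ^ 5"
  proof -
    have s5: "sqrt x ^ 5 = x ^ 2 * sqrt x" if "x \<ge> 0" for x
    proof -
      have "sqrt x ^ (2 * 2 + 1) = (sqrt x ^ 2) ^ 2 * sqrt x" unfolding power_add power_mult by simp
      hence "sqrt x ^ 5 = (sqrt x ^ 2) ^ 2 * sqrt x" by simp
      moreover have "sqrt x ^ 2 = x" using that by simp
      ultimately show ?thesis by (simp only:)
    qed
    show ?thesis using c a by (simp add: s5 real_sqrt_mult power_mult_distrib)
  qed
  also have "\<dots> \<le> norm s ^ 5" by fact
  finally have low: "c ^ 3 * (sing m ^ 2 * sqrt (sing m)) \<le> norm s ^ 5" .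
  have "norm (3 * sqrt 3 / 2 * chi m * sqrt (sing m) / s ^ 5)
      = 3 * sqrt 3 / 2 * norm (chi m) * sqrt (sing m) / norm s ^ 5"
    using a by (simp add: norm_mult norm_divide norm_power abs_of_pos)
  also have "\<dots> \<le> 3 * 1 * sqrt (sing m) / (c ^ 3 * (sing m ^ 2 * sqrt (sing m)))"
  proof (intro frac_le mult_mono low mult_pos_pos)
    have "sqrt 3 \<le> sqrt 4" by (intro real_sqrt_le_mono) auto
    thus "3 * sqrt 3 / 2 \<le> 3" by simp
  qed (use a c norm_chi_le in auto)
  also have "\<dots> = branch_bound \<epsilon> R m"
    using a c R assms by (simp add: branch_bound_def c_def field_simps)
  finally show ?thesis .
qed

lemma obtain_ball_avoiding_sings:
  assumes "open U" "U \<inter> sings = {}" "p \<in> U"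
  obtains r where "r > 0" "r \<le> 1" "ball p r \<subseteq> U" "\<And>q w. q \<in> ball p r \<Longrightarrow> w \<in> sings \<Longrightarrow> r \<le> dist q w"
proof -
  obtain e where e: "e > 0" "ball p e \<subseteq> U" using assms openE by blast
  define r where "r = min (e/2) 1"
  show ?thesis
  proof (rule that[of r])
    fix q w assume q: "q \<in> ball p r" "w \<in> sings"
    hence "dist p w \<ge> e" using e assms by (meson disjoint_iff mem_ball not_le subsetD)
    moreover have "dist p w \<le> dist p q + dist q w" by (rule dist_triangle)
    moreover have "dist p q < e/2" "r \<le> e/2" using q by (auto simp: r_def)
    ultimately show "r \<le> dist q w" by linarith
  qed (use e in \<open>auto simp: r_def\<close>)
qed

lemma branch_sum_holomorphic:
  assumes "open U" "U \<inter> sings = {}" "\<And>m. m > 0 \<Longrightarrow> \<sigma> m holomorphic_on U"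
    and "\<And>m p. m > 0 \<Longrightarrow> p \<in> U \<Longrightarrow> \<sigma> m p ^ 2 = of_real (sing m) - p"
  shows "branch_sum \<sigma> holomorphic_on U"
  unfolding branch_sum_def
proof (rule holomorphic_suminf[OF assms(1)])
  fix m
  show "(\<lambda>p. 3 * sqrt 3 / 2 * chi m * sqrt (sing m) / \<sigma> m p ^ 5) holomorphic_on U"
  proof (cases "m = 0")
    case False
    have "\<sigma> m p \<noteq> 0" if "p \<in> U" for p
    proof
      assume "\<sigma> m p = 0"
      hence "p = of_real (sing m)" using assms(4)[of m p] False that by simp
      thus False using that assms(2) False by (auto simp: sings_def)
    qed
    thus ?thesis using assms(3) False by (intro holomorphic_intros) auto
  qed auto
next
  fix p assume p: "p \<in> U"
  obtain r where r: "r > 0" "r \<le> 1" "ball p r \<subseteq> U" "\<And>q w. q \<in> ball p r \<Longrightarrow> w \<in> sings \<Longrightarrow> r \<le> dist q w"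
    using obtain_ball_avoiding_sings[OF assms(1,2) p] by blast
  have "norm (3 * sqrt 3 / 2 * chi m * sqrt (sing m) / \<sigma> m q ^ 5) \<le> branch_bound r (norm p + 1) m"
    if "q \<in> ball p r \<inter> U" for q m
  proof (rule branch_term_le)
    show "norm q \<le> norm p + 1"
      using that r norm_triangle_ineq2[of q p] by (auto simp: dist_norm norm_minus_commute)
  qed (use that r assms(4) in auto)
  thus "\<exists>d M. 0 < d \<and> summable M \<and>
      (\<forall>n. \<forall>y\<in>ball p d \<inter> U. norm (3 * sqrt 3 / 2 * chi n * sqrt (sing n) / \<sigma> n y ^ 5) \<le> M n)"
    using r(1) summable_branch_bound by blast
qed

lemma branch_sum_summable:
  assumes "p \<notin> sings" "\<And>m. m > 0 \<Longrightarrow> \<sigma> m p ^ 2 = of_real (sing m) - p"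
  shows "summable (\<lambda>m. 3 * sqrt 3 / 2 * chi m * sqrt (sing m) / \<sigma> m p ^ 5)"
proof -
  obtain r where r: "r > 0" "r \<le> 1" "\<And>q w. q \<in> ball p r \<Longrightarrow> w \<in> sings \<Longrightarrow> r \<le> dist q w"
    using obtain_ball_avoiding_sings[of "-sings" p] assms(1) closed_sings
    by (metis ComplI Compl_disjoint2 open_Compl)
  show ?thesis
    by (rule summable_comparison_test'[OF summable_branch_bound[of r "norm p"], of 0])
       (rule branch_term_le, use r assms in auto)
qed

lemma norm_branch_sum_le:
  assumes "\<forall>w\<in>sings. \<epsilon> \<le> dist p w" "0 < \<epsilon>" "\<epsilon> \<le> 1"
    and "\<And>m. m > 0 \<Longrightarrow> \<sigma> m p ^ 2 = of_real (sing m) - p"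
  shows "norm (branch_sum \<sigma> p) \<le> suminf (branch_bound \<epsilon> (norm p))"
  unfolding branch_sum_def
proof -
  let ?f = "\<lambda>m. 3 * sqrt 3 / 2 * chi m * sqrt (sing m) / \<sigma> m p ^ 5"
  have le: "norm (?f m) \<le> branch_bound \<epsilon> (norm p) m" for m
    by (rule branch_term_le) (use assms in auto)
  have *: "summable (\<lambda>m. norm (?f m))"
    by (rule summable_comparison_test'[OF summable_branch_bound[of \<epsilon> "norm p"], of 0]) (use le in auto)
  have "norm (suminf ?f) \<le> (\<Sum>m. norm (?f m))" by (rule summable_norm[OF *])
  also have "\<dots> \<le> suminf (branch_bound \<epsilon> (norm p))"
    by (rule suminf_le[OF le * summable_branch_bound])
  finally show "norm (suminf ?f) \<le> suminf (branch_bound \<epsilon> (norm p))" .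
qed

text \<open>
  Two continuous square roots of the same nonvanishing function differ by a continuous, hence
  constant, sign.
\<close>

lemma eq_of_square_eq:
  fixes f g :: "'a :: topological_space \<Rightarrow> complex"
  assumes "connected S" "continuous_on S f" "continuous_on S g"
    and "\<And>x. x \<in> S \<Longrightarrow> f x ^ 2 = g x ^ 2" "\<And>x. x \<in> S \<Longrightarrow> g x \<noteq> 0"
    and "x0 \<in> S" "f x0 = g x0" "x \<in> S"
  shows "f x = g x"
proof -
  have "continuous_on S (\<lambda>x. f x / g x)" using assms by (intro continuous_intros) auto
  moreover have "(\<lambda>x. f x / g x) ` S \<subseteq> {1, -1}"
  proof (rule image_subsetI)
    fix x assume "x \<in> S"
    thus "f x / g x \<in> {1, -1}" using assms(4,5)[of x] by (auto simp: power2_eq_iff)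
  qed
  ultimately have "(\<lambda>x. f x / g x) constant_on S"
    using assms(1) by (intro continuous_finite_range_constant) (auto intro: finite_subset)
  hence "f x / g x = f x0 / g x0" using assms(6,8) unfolding constant_on_def by metis
  thus ?thesis using assms(5)[OF assms(8)] assms(5)[OF assms(6)] assms(7) by auto
qed

lemma csqrt_of_real_mult:
  assumes "c > 0"
  shows "csqrt (of_real c * z) = of_real (sqrt c) * csqrt z"
proof (rule csqrt_unique)
  show "(of_real (sqrt c) * csqrt z)\<^sup>2 = of_real c * z"
  proof -
    have "of_real (sqrt c) ^ 2 = (of_real c :: complex)"
      using assms by (metis of_real_power real_sqrt_pow2 less_imp_le)
    thus ?thesis by (simp add: power_mult_distrib)
  qed
  have *: "0 < Re (of_real (sqrt c) * w) \<or> Re (of_real (sqrt c) * w) = 0 \<and> 0 \<le> Im (of_real (sqrt c) * w)"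
    if "0 < Re w \<or> Re w = 0 \<and> 0 \<le> Im w" for w
    using that assms by auto
  show "0 < Re (of_real (sqrt c) * csqrt z) \<or>
        Re (of_real (sqrt c) * csqrt z) = 0 \<and> 0 \<le> Im (of_real (sqrt c) * csqrt z)"
    by (rule * [OF csqrt_principal])
qed

lemma continuous_on_square_root_path:
  assumes "path_avoiding sings \<gamma>" "m > 0"
  shows "\<exists>s. continuous_on {0..1} s \<and> (\<forall>t\<in>{0..1}. s t ^ 2 = of_real (sing m) - \<gamma> t) \<and>
             s 0 = of_real (sqrt (sing m))"
proof -
  have \<gamma>: "continuous_on {0..1} \<gamma>" "\<gamma> 0 = 0"
    using assms by (auto simp: path_avoiding_def path_def pathstart_def)
  have nz: "of_real (sing m) - \<gamma> t \<noteq> 0" if "t \<in> {0..1}" for t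
  proof (cases "t = 0")
    case True
    thus ?thesis using \<gamma> sing_pos[OF assms(2)] by auto
  next
    case False
    hence "\<gamma> t \<notin> sings" using assms that by (auto simp: path_avoiding_def)
    thus ?thesis using sing_in_sings[OF assms(2)] by auto
  qed
  obtain g where g: "continuous_on {0..1} g" "\<And>t. t \<in> {0..1} \<Longrightarrow> of_real (sing m) - \<gamma> t = g t ^ 2"
  proof (rule continuous_sqrt_on_contractible[of "{0..1}" "\<lambda>t. of_real (sing m) - \<gamma> t"])
    show "continuous_on {0..1} (\<lambda>t. of_real (sing m) - \<gamma> t)" by (intro continuous_intros \<gamma>)
    show "contractible {0..1::real}" by (intro convex_imp_contractible) auto
  qed (use nz in blast)+
  have "g 0 ^ 2 = of_real (sqrt (sing m)) ^ 2"
    using g(2)[of 0] \<gamma>(2) sing_pos[OF assms(2)] by (simp flip: of_real_power)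
  hence "g 0 = of_real (sqrt (sing m)) \<or> - g 0 = of_real (sqrt (sing m))"
    by (auto simp: power2_eq_iff)
  thus ?thesis
  proof
    assume "g 0 = of_real (sqrt (sing m))"
    thus ?thesis using g by (intro exI[of _ g]) auto
  next
    assume "- g 0 = of_real (sqrt (sing m))"
    thus ?thesis using g by (intro exI[of _ "\<lambda>t. - g t"]) (auto intro: continuous_intros)
  qed
qed

text \<open>
  The square root of \<open>sing m - z\<close> near \<open>w\<close> whose value at \<open>w\<close> is the prescribed root \<open>c m\<close>.
  The quotient under \<open>csqrt\<close> stays in the right half-plane for all \<open>m\<close> at once as long as \<open>z\<close> is in a
  disc around \<open>w\<close> without singularities.
\<close>

definition local_root :: "(nat \<Rightarrow> complex) \<Rightarrow> complex \<Rightarrow> nat \<Rightarrow> complex \<Rightarrow> complex" where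
  "local_root c w m z = c m * csqrt ((of_real (sing m) - z) / (of_real (sing m) - w))"

lemma local_root_properties:
  assumes "ball w r \<inter> sings = {}" "m > 0" "c m ^ 2 = of_real (sing m) - w" "r > 0"
  shows "local_root c w m holomorphic_on ball w r"
    and "\<And>z. z \<in> ball w r \<Longrightarrow> local_root c w m z ^ 2 = of_real (sing m) - z"
    and "local_root c w m w = c m"
    and "\<And>z. z \<in> ball w r \<Longrightarrow> local_root c w m z \<noteq> 0"
proof -
  have nz: "of_real (sing m) - z \<noteq> 0" if "z \<in> ball w r" for z
    using assms(1,2) that by (auto simp: sings_def)
  have w: "w \<in> ball w r" using assms by simp
  have far: "norm (of_real (sing m) - w) \<ge> r"
  proof -
    have "of_real (sing m) \<notin> ball w r" using assms(1,2) by (auto simp: sings_def)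
    thus ?thesis by (simp add: dist_norm norm_minus_commute)
  qed
  have pos: "Re ((of_real (sing m) - z) / (of_real (sing m) - w)) > 0" if z: "z \<in> ball w r" for z
  proof -
    have *: "(of_real (sing m) - z) / (of_real (sing m) - w) = 1 - (z - w) / (of_real (sing m) - w)"
      using nz[OF w] by (simp add: divide_simps)
    have "norm ((z - w) / (of_real (sing m) - w)) < 1"
    proof -
      have "norm (z - w) < norm (of_real (sing m) - w)"
        using z far by (simp add: dist_norm norm_minus_commute)
      thus ?thesis using nz[OF w] by (simp add: norm_divide)
    qed
    hence "Re ((z - w) / (of_real (sing m) - w)) < 1"
      using complex_Re_le_cmod le_less_trans by blast
    thus ?thesis unfolding * by simp
  qed
  have "(\<lambda>z. c m * csqrt ((of_real (sing m) - z) / (of_real (sing m) - w))) holomorphic_on ball w r"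
  proof (intro holomorphic_intros)
    fix z assume "z \<in> ball w r"
    thus "(of_real (sing m) - z) / (of_real (sing m) - w) \<notin> \<real>\<^sub>\<le>\<^sub>0"
      using pos[of z] by (auto simp: complex_nonpos_Reals_iff)
  qed (use nz[OF w] in auto)
  thus "local_root c w m holomorphic_on ball w r"
    unfolding local_root_def .
  show sq: "local_root c w m z ^ 2 = of_real (sing m) - z" if "z \<in> ball w r" for z
    using nz[OF w] assms(3) by (simp add: local_root_def power_mult_distrib)
  show "local_root c w m w = c m" using nz[OF w] by (simp add: local_root_def)
  show "local_root c w m z \<noteq> 0" if "z \<in> ball w r" for z
    using sq[OF that] nz[OF that] by auto
qed

definition principal_root :: "nat \<Rightarrow> complex \<Rightarrow> complex" where
  "principal_root m p = csqrt (of_real (sing m) - p)"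

lemma principal_root_sq: "principal_root m p ^ 2 = of_real (sing m) - p"
  by (simp add: principal_root_def)

lemma branch_sum_cong:
  assumes "\<And>m. m > 0 \<Longrightarrow> \<sigma> m p = \<tau> m p"
  shows "branch_sum \<sigma> p = branch_sum \<tau> p"
  unfolding branch_sum_def
proof (intro suminf_cong)
  fix m show "3 * sqrt 3 / 2 * chi m * sqrt (sing m) / \<sigma> m p ^ 5 = 3 * sqrt 3 / 2 * chi m * sqrt (sing m) / \<tau> m p ^ 5"
    using assms[of m] by (cases "m = 0") auto
qed

lemma path_avoiding_not_in_sings:
  assumes "path_avoiding sings \<gamma>" "t \<in> {0..1}"
  shows "\<gamma> t \<notin> sings"
proof (cases "t = 0")
  case True
  hence "\<gamma> t = 0" using assms by (auto simp: path_avoiding_def pathstart_def)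
  moreover have "0 \<notin> sings"
  proof
    assume "0 \<in> sings"
    then obtain m where "m \<ge> 1" "sing m = 0" by (auto simp: sings_def)
    thus False using sing_pos[of m] by simp
  qed
  ultimately show ?thesis by simp
qed (use assms in \<open>auto simp: path_avoiding_def\<close>)

text \<open>
  Each square root is continued continuously along the path by itself; at time \<open>t\<close> these values
  determine local roots and hence a germ of the sum. Near each time the germs fit together, because
  square roots that agree at one point of a connected set agree on all of it.
\<close>

lemma borel_continuation_along_path:
  assumes \<gamma>: "path_avoiding sings \<gamma>"
  obtains c where "\<And>m. m > 0 \<Longrightarrow> c m ^ 2 = of_real (sing m) - \<gamma> 1"
    and "continuation_along (branch_sum principal_root) \<gamma> (branch_sum (local_root c (\<gamma> 1)))"
proof -
  have "\<forall>m\<in>{1..}. \<exists>s. continuous_on {0..1} s \<and> (\<forall>t\<in>{0..1}. s t ^ 2 = of_real (sing m) - \<gamma> t) \<and>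
             s 0 = of_real (sqrt (sing m))"
    using continuous_on_square_root_path[OF \<gamma>] by auto
  from bchoice[OF this] obtain s where s: "\<forall>m\<in>{1..}. continuous_on {0..1} (s m) \<and>
      (\<forall>t\<in>{0..1}. s m t ^ 2 = of_real (sing m) - \<gamma> t) \<and> s m 0 = of_real (sqrt (sing m))"
    by (rule exE)
  have s: "continuous_on {0..1} (s m)" "t \<in> {0..1} \<Longrightarrow> s m t ^ 2 = of_real (sing m) - \<gamma> t"
      "s m 0 = of_real (sqrt (sing m))" if "m > 0" for m t
    using s that by auto
  have path: "path \<gamma>" using \<gamma> by (simp add: path_avoiding_def)
  define \<Phi> where "\<Phi> = (\<lambda>t. branch_sum (local_root (\<lambda>m. s m t) (\<gamma> t)))"
  have rad: "\<exists>r>0. ball (\<gamma> t) r \<inter> sings = {}" if "t \<in> {0..1}" for t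
  proof -
    have "open (- sings)" "\<gamma> t \<in> - sings"
      using path_avoiding_not_in_sings[OF \<gamma> that] closed_sings by auto
    then obtain r where "r > 0" "ball (\<gamma> t) r \<subseteq> - sings" by (rule openE)
    thus ?thesis by auto
  qed
  have "continuation_along (branch_sum principal_root) \<gamma> (\<Phi> 1)"
    unfolding continuation_along_def
  proof (intro conjI exI[of _ \<Phi>] ballI path)
    fix t :: real assume t: "t \<in> {0..1}"
    obtain r where r: "r > 0" "ball (\<gamma> t) r \<inter> sings = {}" using rad[OF t] by blast
    have "\<Phi> t holomorphic_on ball (\<gamma> t) r"
      unfolding \<Phi>_def
    proof (rule branch_sum_holomorphic[OF open_ball r(2)])
      fix m :: nat assume m: "m > 0"
      note L = local_root_properties[OF r(2) m _ r(1), where c = "\<lambda>m. s m t", OF s(2)[OF m t]]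
      show "local_root (\<lambda>m. s m t) (\<gamma> t) m holomorphic_on ball (\<gamma> t) r" by (rule L)
      show "local_root (\<lambda>m. s m t) (\<gamma> t) m p ^ 2 = of_real (sing m) - p" if "p \<in> ball (\<gamma> t) r" for p
        by (rule L(2)[OF that])
    qed
    thus "\<Phi> t analytic_on {\<gamma> t}" using r(1) unfolding analytic_on_def by auto
    have "(\<gamma> \<longlongrightarrow> \<gamma> t) (at t within {0..1})"
      using path t unfolding path_def continuous_on_def by auto
    hence "\<forall>\<^sub>F u in at t within {0..1}. \<gamma> u \<in> ball (\<gamma> t) r"
      using r(1) by (simp add: tendsto_iff dist_commute)
    then obtain \<eta> where \<eta>: "\<eta> > 0" "\<And>u. u \<in> {0..1} \<Longrightarrow> u \<noteq> t \<Longrightarrow> dist u t < \<eta> \<Longrightarrow> \<gamma> u \<in> ball (\<gamma> t) r"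
      unfolding eventually_at by blast
    define I where "I = ball t \<eta> \<inter> {0..1}"
    have tI: "t \<in> I" using t \<eta> by (simp add: I_def)
    have \<gamma>I: "\<gamma> u \<in> ball (\<gamma> t) r" if "u \<in> I" for u
      using \<eta>(2)[of u] that r(1) by (cases "u = t") (auto simp: I_def dist_commute)
    have conI: "connected I" unfolding I_def by (intro convex_connected convex_Int) auto
    \<comment> \<open>the root carried along the path agrees with the local root at time \<open>t\<close> for nearby times\<close>
    have on_path: "s m u = local_root (\<lambda>m. s m t) (\<gamma> t) m (\<gamma> u)" if "m > 0" "u \<in> I" for m u
    proof (rule eq_of_square_eq[of I "s m" "\<lambda>u. local_root (\<lambda>m. s m t) (\<gamma> t) m (\<gamma> u)" t u])
      note L = local_root_properties[OF r(2) that(1) _ r(1), where c = "\<lambda>m. s m t", OF s(2)[OF that(1) t]]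
      show "continuous_on I (s m)" using s(1)[OF that(1)] continuous_on_subset by (force simp: I_def)
      show "continuous_on I (\<lambda>u. local_root (\<lambda>m. s m t) (\<gamma> t) m (\<gamma> u))"
      proof (rule continuous_on_compose2[OF holomorphic_on_imp_continuous_on[OF L(1)]])
        show "continuous_on I \<gamma>" using path continuous_on_subset by (force simp: path_def I_def)
      qed (use \<gamma>I in auto)
      show "s m u ^ 2 = local_root (\<lambda>m. s m t) (\<gamma> t) m (\<gamma> u) ^ 2" if "u \<in> I" for u
        using L(2)[OF \<gamma>I[OF that]] s(2)[OF \<open>m > 0\<close>, of u] that by (simp add: I_def)
      show "local_root (\<lambda>m. s m t) (\<gamma> t) m (\<gamma> u) \<noteq> 0" if "u \<in> I" for u
        using L(4)[OF \<gamma>I[OF that]] .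
      show "s m t = local_root (\<lambda>m. s m t) (\<gamma> t) m (\<gamma> t)" using L(3) by simp
    qed (use conI tI that in auto)
    have "\<forall>\<^sub>F z in nhds (\<gamma> u). \<Phi> u z = \<Phi> t z" if u: "u \<in> I" for u
    proof -
      have u01: "u \<in> {0..1}" using u by (simp add: I_def)
      obtain r' where r': "r' > 0" "ball (\<gamma> u) r' \<inter> sings = {}" using rad[OF u01] by blast
      define V where "V = ball (\<gamma> u) r' \<inter> ball (\<gamma> t) r"
      have uV: "\<gamma> u \<in> V" using r' \<gamma>I[OF u] by (simp add: V_def)
      have "\<forall>\<^sub>F z in nhds (\<gamma> u). z \<in> V"
        using uV unfolding V_def by (intro eventually_nhds_in_open) auto
      thus ?thesis
      proof eventually_elim
        case (elim z)
        show ?case unfolding \<Phi>_def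
        proof (rule branch_sum_cong)
          fix m :: nat assume m: "m > 0"
          note L = local_root_properties[OF r(2) m _ r(1), where c = "\<lambda>m. s m t", OF s(2)[OF m t]]
          note L' = local_root_properties[OF r'(2) m _ r'(1), where c = "\<lambda>m. s m u", OF s(2)[OF m u01]]
          show "local_root (\<lambda>m. s m u) (\<gamma> u) m z = local_root (\<lambda>m. s m t) (\<gamma> t) m z"
          proof (rule eq_of_square_eq[of V "local_root (\<lambda>m. s m u) (\<gamma> u) m"
              "local_root (\<lambda>m. s m t) (\<gamma> t) m" "\<gamma> u"])
            show "connected V" unfolding V_def by (intro convex_connected convex_Int) auto
            show "continuous_on V (local_root (\<lambda>m. s m u) (\<gamma> u) m)"
              "continuous_on V (local_root (\<lambda>m. s m t) (\<gamma> t) m)"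
              unfolding V_def
              by (rule holomorphic_on_imp_continuous_on holomorphic_on_subset[OF L'(1)] holomorphic_on_subset[OF L(1)] Int_lower1 Int_lower2)+
            show "local_root (\<lambda>m. s m u) (\<gamma> u) m (\<gamma> u) = local_root (\<lambda>m. s m t) (\<gamma> t) m (\<gamma> u)"
              using L'(3) on_path[OF m u] by simp
            show "local_root (\<lambda>m. s m u) (\<gamma> u) m x ^ 2 = local_root (\<lambda>m. s m t) (\<gamma> t) m x ^ 2" if "x \<in> V" for x
              using L(2)[of x] L'(2)[of x] that by (simp add: V_def)
            show "local_root (\<lambda>m. s m t) (\<gamma> t) m x \<noteq> 0" if "x \<in> V" for x
              using L(4)[of x] that by (simp add: V_def)
          qed (use elim uV in auto)
        qed
      qed
    qed
    hence "\<forall>\<^sub>F u in at t within {0..1}. u \<in> I \<longrightarrow> (\<forall>\<^sub>F z in nhds (\<gamma> u). \<Phi> u z = \<Phi> t z)" by simp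
    moreover have "\<forall>\<^sub>F u in at t within {0..1}. u \<in> I"
      unfolding eventually_at using \<eta>(1) by (intro exI[of _ \<eta>]) (auto simp: I_def dist_commute)
    ultimately show "\<forall>\<^sub>F u in at t within {0..1}. \<forall>\<^sub>F z in nhds (\<gamma> u). \<Phi> u z = \<Phi> t z"
      by eventually_elim simp
  next
    have \<gamma>0: "\<gamma> 0 = 0" using \<gamma> by (simp add: path_avoiding_def pathstart_def)
    have "branch_sum (local_root (\<lambda>m. s m 0) (\<gamma> 0)) z = branch_sum principal_root z" for z
    proof (rule branch_sum_cong)
      fix m :: nat assume m: "m > 0"
      have "csqrt (of_real (sing m) - z) = csqrt (of_real (sing m) * ((of_real (sing m) - z) / of_real (sing m)))"
        using sing_pos[OF m] by simp
      also have "\<dots> = of_real (sqrt (sing m)) * csqrt ((of_real (sing m) - z) / of_real (sing m))"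
        by (rule csqrt_of_real_mult[OF sing_pos[OF m]])
      finally show "local_root (\<lambda>m. s m 0) (\<gamma> 0) m z = principal_root m z"
        using s(3)[OF m] by (simp add: local_root_def principal_root_def \<gamma>0)
    qed
    thus "\<forall>\<^sub>F z in nhds (pathstart \<gamma>). \<Phi> 0 z = branch_sum principal_root z"
      by (simp add: \<Phi>_def)
  qed auto
  thus ?thesis using that[of "\<lambda>m. s m 1"] s(2) by (simp add: \<Phi>_def)
qed

text \<open>
  On a convex set without singularities all square roots are single-valued, so a branch equals a sum
  of the same shape on the whole set and inherits the polynomial bound, with \<open>A = 3\<close> for every set.
\<close>

lemma borel_branch_growth:
  assumes \<gamma>: "path_avoiding sings \<gamma>" and D: "open D" "convex D" "D \<inter> sings = {}"
    and h: "h holomorphic_on D" "pathfinish \<gamma> \<in> D"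
    and cont: "continuation_along (branch_sum principal_root) \<gamma> h"
  shows "\<exists>A. \<forall>\<epsilon>>0. \<exists>C. \<forall>p\<in>D. (\<forall>w\<in>sings. \<epsilon> \<le> dist p w) \<longrightarrow> norm (h p) \<le> C * exp (A * norm p)"
proof -
  define w where "w = \<gamma> 1"
  obtain c where c: "\<And>m. m > 0 \<Longrightarrow> c m ^ 2 = of_real (sing m) - w"
    and cont': "continuation_along (branch_sum principal_root) \<gamma> (branch_sum (local_root c w))"
    using borel_continuation_along_path[OF \<gamma>] unfolding w_def by blast
  have near: "\<forall>\<^sub>F z in nhds w. h z = branch_sum (local_root c w) z"
    using continuation_unique[OF cont cont'] by (simp add: w_def pathfinish_def)
  have wD: "w \<in> D" using h(2) by (simp add: w_def pathfinish_def)
  obtain r where r: "r > 0" "ball w r \<subseteq> D" using D(1) wD openE by blast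
  hence rs: "ball w r \<inter> sings = {}" using D(3) by auto
  \<comment> \<open>a convex set is contractible, so all square roots exist on it; choose the signs at \<open>w\<close>\<close>
  have "\<forall>m\<in>{1..}. \<exists>\<tau>. \<tau> holomorphic_on D \<and> (\<forall>p\<in>D. \<tau> p ^ 2 = of_real (sing m) - p) \<and> \<tau> w = c m"
  proof
    fix m :: nat assume "m \<in> {1..}"
    hence m: "m > 0" by simp
    obtain g where g: "g holomorphic_on D" "\<And>z. z \<in> D \<Longrightarrow> of_real (sing m) - z = g z ^ 2"
    proof (rule contractible_imp_holomorphic_sqrt[of "\<lambda>z. of_real (sing m) - z" D])
      show "(\<lambda>z. of_real (sing m) - z) holomorphic_on D" by (intro holomorphic_intros)
      show "contractible D" using D(2) by (rule convex_imp_contractible)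
      show "of_real (sing m) - z \<noteq> 0" if "z \<in> D" for z
        using that D(3) m by (auto simp: sings_def)
    qed blast
    have "g w ^ 2 = c m ^ 2" using g(2)[OF wD] c[OF m] by simp
    hence "g w = c m \<or> - g w = c m" by (auto simp: power2_eq_iff)
    thus "\<exists>\<tau>. \<tau> holomorphic_on D \<and> (\<forall>p\<in>D. \<tau> p ^ 2 = of_real (sing m) - p) \<and> \<tau> w = c m"
    proof
      assume "g w = c m"
      thus ?thesis using g by (intro exI[of _ g]) auto
    next
      assume "- g w = c m"
      thus ?thesis using g by (intro exI[of _ "\<lambda>z. - g z"]) (auto intro: holomorphic_intros)
    qed
  qed
  from bchoice[OF this] obtain \<tau> where \<tau>: "\<forall>m\<in>{1..}. \<tau> m holomorphic_on D \<and>
      (\<forall>p\<in>D. \<tau> m p ^ 2 = of_real (sing m) - p) \<and> \<tau> m w = c m"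
    by (rule exE)
  have \<tau>: "\<tau> m holomorphic_on D" "p \<in> D \<Longrightarrow> \<tau> m p ^ 2 = of_real (sing m) - p" "\<tau> m w = c m"
    if "m > 0" for m p
    using \<tau> that by auto
  have hol: "branch_sum \<tau> holomorphic_on D"
    using D \<tau> by (intro branch_sum_holomorphic) auto
  have "branch_sum (local_root c w) z = branch_sum \<tau> z" if z: "z \<in> ball w r" for z
  proof (rule branch_sum_cong)
    fix m :: nat assume m: "m > 0"
    note L = local_root_properties[OF rs m _ r(1), where c = c, OF c[OF m]]
    show "local_root c w m z = \<tau> m z"
    proof (rule eq_of_square_eq[of "ball w r" "local_root c w m" "\<tau> m" w])
      show "continuous_on (ball w r) (local_root c w m)" "continuous_on (ball w r) (\<tau> m)"
        by (rule holomorphic_on_imp_continuous_on L(1) holomorphic_on_subset[OF \<tau>(1)[OF m]] r(2))+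
      show "\<tau> m x \<noteq> 0" if "x \<in> ball w r" for x
        using L(2)[OF that] \<tau>(2)[OF m, of x] L(4)[OF that] r(2) that by auto
      show "local_root c w m x ^ 2 = \<tau> m x ^ 2" if "x \<in> ball w r" for x
        using L(2)[OF that] \<tau>(2)[OF m, of x] r(2) that by auto
    qed (use z r(1) L(3) \<tau>(3)[OF m] in auto)
  qed
  moreover have "\<forall>\<^sub>F z in nhds w. z \<in> ball w r" using r by (intro eventually_nhds_in_open) auto
  ultimately have "\<forall>\<^sub>F z in nhds w. h z = branch_sum \<tau> z"
    using near by (auto elim: eventually_elim2)
  hence eq: "h z = branch_sum \<tau> z" if "z \<in> D" for z
    using holomorphic_eq_from_germ[OF h(1) hol D(1) _ wD _ that] convex_connected[OF D(2)] by blast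
  define M where "M = (\<Sum>m. 1 / sing m ^ 2)"
  show ?thesis
  proof (intro exI allI impI ballI)
    fix \<epsilon> :: real and p assume \<epsilon>: "\<epsilon> > 0" and p: "p \<in> D" "\<forall>w\<in>sings. \<epsilon> \<le> dist p w"
    define e where "e = min \<epsilon> 1"
    have "norm (h p) \<le> suminf (branch_bound e (norm p))"
      unfolding eq[OF p(1)] using \<epsilon> p \<tau>(2) by (intro norm_branch_sum_le) (auto simp: e_def intro: min.coboundedI1)
    also have "\<dots> = 3 * (2 * (1 + norm p) / e) ^ 3 * M"
      unfolding branch_bound_def M_def by (rule suminf_mult) (intro summable_inverse_sing_power, simp)
    also have "\<dots> = 3 * (2 / e) ^ 3 * M * (1 + norm p) ^ 3"
    proof -
      have "2 * (1 + norm p) / e = (2 / e) * (1 + norm p)" by simp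
      hence "(2 * (1 + norm p) / e) ^ 3 = (2 / e) ^ 3 * (1 + norm p) ^ 3"
        by (simp only: power_mult_distrib)
      thus ?thesis by (simp only: mult_ac)
    qed
    also have "\<dots> \<le> 3 * (2 / e) ^ 3 * M * exp (norm p) ^ 3"
    proof (intro mult_left_mono power_mono mult_nonneg_nonneg)
      show "M \<ge> 0" unfolding M_def by (intro suminf_nonneg summable_inverse_sing_power) auto
    qed (use \<epsilon> exp_ge_add_one_self[of "norm p"] in \<open>auto simp: e_def\<close>)
    also have "exp (norm p) ^ 3 = exp (3 * norm p)" by (simp flip: exp_of_nat_mult)
    finally show "norm (h p) \<le> 3 * (2 / min \<epsilon> 1) ^ 3 * M * exp (3 * norm p)"
      by (simp add: e_def)
  qed
qed

lemma continuation_along_cong_start: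
  assumes "continuation_along g \<gamma> h" "\<forall>\<^sub>F z in nhds (pathstart \<gamma>). g z = g' z"
  shows "continuation_along g' \<gamma> h"
proof -
  obtain \<Phi> where \<Phi>: "(\<forall>t\<in>{0..1}. \<Phi> t analytic_on {\<gamma> t} \<and>
           (\<forall>\<^sub>F s in at t within {0..1}. \<forall>\<^sub>F z in nhds (\<gamma> s). \<Phi> s z = \<Phi> t z))"
        "(\<forall>\<^sub>F z in nhds (pathstart \<gamma>). \<Phi> 0 z = g z)"
        "(\<forall>\<^sub>F z in nhds (pathfinish \<gamma>). \<Phi> 1 z = h z)" "path \<gamma>"
    using assms(1) unfolding continuation_along_def by blast
  have "\<forall>\<^sub>F z in nhds (pathstart \<gamma>). \<Phi> 0 z = g' z"
    using \<Phi>(2) assms(2) by eventually_elim simp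
  thus ?thesis unfolding continuation_along_def using \<Phi> by blast
qed

text \<open>
  Once the Borel transform is known to agree near \<open>0\<close> with the sum over principal roots, everything
  about its continuation is a statement about sums over square roots.
\<close>

lemma resurgent_outside_sings:
  assumes germ: "\<forall>\<^sub>F z in nhds 0. eval_fps (borel_transform F) z = branch_sum principal_root z"
    and "gevrey1 F"
  shows "resurgent_outside sings F"
  unfolding resurgent_outside_def
proof (intro conjI allI impI closed_sings discrete_sings assms(2))
  fix \<gamma> assume \<gamma>: "path_avoiding sings \<gamma>"
  hence start: "pathstart \<gamma> = 0" by (simp add: path_avoiding_def)
  obtain c where "continuation_along (branch_sum principal_root) \<gamma> (branch_sum (local_root c (\<gamma> 1)))"
    using borel_continuation_along_path[OF \<gamma>] by blast
  moreover have "\<forall>\<^sub>F z in nhds (pathstart \<gamma>). branch_sum principal_root z = eval_fps (borel_transform F) z"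
    unfolding start using germ by eventually_elim simp
  ultimately show "\<exists>h. continuation_along (eval_fps (borel_transform F)) \<gamma> h"
    using continuation_along_cong_start by blast
next
  fix D h assume *: "open D \<and> convex D \<and> D \<inter> sings = {} \<and> borel_branch F sings D h"
  then obtain \<gamma> where \<gamma>: "path_avoiding sings \<gamma>" "pathfinish \<gamma> \<in> D"
     "continuation_along (eval_fps (borel_transform F)) \<gamma> h" "h holomorphic_on D"
    unfolding borel_branch_def by blast
  have "pathstart \<gamma> = 0" using \<gamma> by (simp add: path_avoiding_def)
  hence "continuation_along (branch_sum principal_root) \<gamma> h"
    by (intro continuation_along_cong_start[OF \<gamma>(3)]) (use germ in simp)
  thus "\<exists>A. \<forall>\<epsilon>>0. \<exists>C. \<forall>p\<in>D. (\<forall>w\<in>sings. \<epsilon> \<le> dist p w) \<longrightarrow> norm (h p) \<le> C * exp (A * norm p)"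
    using borel_branch_growth[of \<gamma> D h] \<gamma> * by blast
qed

section \<open>Partial fractions of \<open>sin 2v / cos 3v\<close>\<close>

text \<open>
  The logarithmic derivative of Euler's reflection formula.
\<close>

lemma Digamma_reflection:
  assumes "sin (of_real pi * z) \<noteq> 0"
  shows "Digamma (1 - z) - Digamma z = of_real pi * cot (of_real pi * (z :: complex))"
proof -
  have z: "z \<notin> \<int>" 
  proof
    assume "z \<in> \<int>"
    then obtain n :: int where "z = of_int n" by (rule Ints_cases)
    hence "of_real pi * z = of_real (of_int n * pi)" by simp
    hence "sin (of_real pi * z) = of_real (sin (of_int n * pi))" by (simp only: sin_of_real)
    thus False using assms by (simp add: sin_zero_iff_int2)
  qed
  have z': "1 - z \<notin> \<int>" 
  proof
    assume "1 - z \<in> \<int>"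
    hence "1 - (1 - z) \<in> \<int>" by (intro Ints_diff) auto
    thus False using z by simp
  qed
  have nonpos: "z \<notin> \<int>\<^sub>\<le>\<^sub>0" "1 - z \<notin> \<int>\<^sub>\<le>\<^sub>0" using z z' nonpos_Ints_Int by auto
  have "((\<lambda>z. Gamma z * Gamma (1 - z)) has_field_derivative
          Gamma z * Gamma (1 - z) * (Digamma z - Digamma (1 - z))) (at z)"
    using nonpos by (auto intro!: derivative_eq_intros simp: algebra_simps)
  moreover have "((\<lambda>z. of_real pi / sin (of_real pi * z)) has_field_derivative
          - (of_real pi * (of_real pi * cos (of_real pi * z))) / sin (of_real pi * z) ^ 2) (at z)"
    using assms by (auto intro!: derivative_eq_intros simp: power2_eq_square)
  hence "((\<lambda>z. Gamma z * Gamma (1 - z)) has_field_derivative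
          - (of_real pi * (of_real pi * cos (of_real pi * z))) / sin (of_real pi * z) ^ 2) (at z)"
    by (simp add: Gamma_reflection_complex)
  ultimately have "Gamma z * Gamma (1 - z) * (Digamma z - Digamma (1 - z)) =
        - (of_real pi * (of_real pi * cos (of_real pi * z))) / sin (of_real pi * z) ^ 2"
    by (rule DERIV_unique)
  hence "of_real pi / sin (of_real pi * z) * (Digamma z - Digamma (1 - z)) =
         of_real pi / sin (of_real pi * z) * - (of_real pi * cot (of_real pi * z))"
    unfolding Gamma_reflection_complex by (simp add: cot_def power2_eq_square)
  hence "Digamma z - Digamma (1 - z) = - (of_real pi * cot (of_real pi * z))"
    by (subst (asm) mult_cancel_left) (use assms in auto)
  thus ?thesis by (simp add: algebra_simps)
qed

text \<open>
  Subtracting two digamma series removes the terms that make each of them converge, and the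
  reflection formula identifies the difference.
\<close>

lemma cot_sums:
  assumes "sin (of_real pi * z) \<noteq> 0"
  shows "(\<lambda>k. 1 / (z + of_nat k) - 1 / (1 - z + of_nat k)) sums (of_real pi * cot (of_real pi * (z :: complex)))"
proof -
  have nz: "z \<noteq> 0" "1 - z \<noteq> 0" using assms by auto
  have "(\<lambda>k. inverse (of_nat (Suc k)) - inverse (w + of_nat k)) sums (Digamma w + euler_mascheroni)"
    if "w \<noteq> 0" for w :: complex
    unfolding Digamma_def using summable_sums[OF summable_Digamma[OF that]] by simp
  from sums_diff[OF this[OF nz(2)] this[OF nz(1)]]
  show ?thesis using Digamma_reflection[OF assms] by (simp add: inverse_eq_divide)
qed

lemma cot_diff:
  fixes a b :: complex
  assumes "sin a \<noteq> 0" "sin b \<noteq> 0"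
  shows "cot a - cot b = sin (b - a) / (sin a * sin b)"
  unfolding cot_def sin_diff diff_frac_eq[OF assms] by (simp add: mult_ac)

lemma cos_pi_sixth: "cos (of_real pi / 6 :: complex) = of_real (sqrt 3 / 2)"
  using cos_30 by (metis cos_of_real of_real_divide of_real_numeral)

lemma cos_five_pi_sixth: "cos (5 * of_real pi / 6 :: complex) = - of_real (sqrt 3 / 2)"
proof -
  have "cos (of_real (pi - pi / 6) :: complex) = - of_real (sqrt 3 / 2)"
    unfolding cos_of_real cos_pi_minus cos_30 by simp
  also have "of_real (pi - pi / 6) = (5 * of_real pi / 6 :: complex)" by simp
  finally show ?thesis .
qed

text \<open>
  The four poles of the left-hand side per period correspond to the residues 1, 5, 7 and 11 modulo 12
  on which \<open>chi\<close> is nonzero.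
\<close>

lemma cot_combination:
  fixes y :: complex
  assumes "cos (6 * y) \<noteq> 0"
  shows "cot (pi / 12 - y) - cot (pi / 12 + y) - (cot (5 * pi / 12 - y) - cot (5 * pi / 12 + y))
           = 4 * sqrt 3 * sin (4 * y) / cos (6 * y)"
    and "sin (pi / 12 - y) \<noteq> 0" "sin (pi / 12 + y) \<noteq> 0" "sin (5 * pi / 12 - y) \<noteq> 0" "sin (5 * pi / 12 + y) \<noteq> 0"
proof -
  define h :: complex where "h = of_real (sqrt 3 / 2)"
  define c where "c = cos (2 * y)"
  have h2: "h ^ 2 = 3 / 4" by (simp add: h_def power_divide flip: of_real_power)
  have c6: "cos (6 * y) = 4 * c * (c - h) * (c + h)"
  proof -
    have "cos (6 * y) = cos (3 * (2 * y))" by simp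
    also have "\<dots> = 4 * c ^ 3 - 3 * c" unfolding cos_treble_cos c_def ..
    also have "\<dots> = 4 * c * (c^2 - h^2)" unfolding h2 by (simp add: algebra_simps power3_eq_cube power2_eq_square)
    finally show ?thesis by (simp add: algebra_simps power2_eq_square)
  qed
  have p1: "sin (pi / 12 - y) * sin (pi / 12 + y) = (c - h) / 2"
  proof -
    have "(pi / 12 - y) - (pi / 12 + y) = - (2 * y)" by simp
    moreover have "(pi / 12 - y) + (pi / 12 + y) = of_real pi / 6" by simp
    ultimately show ?thesis unfolding sin_times_sin by (simp add: cos_pi_sixth h_def c_def)
  qed
  have p2: "sin (5 * pi / 12 - y) * sin (5 * pi / 12 + y) = (c + h) / 2"
  proof -
    have "(5 * pi / 12 - y) - (5 * pi / 12 + y) = - (2 * y)" by simp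
    moreover have "(5 * pi / 12 - y) + (5 * pi / 12 + y) = 5 * of_real pi / 6" by simp
    ultimately show ?thesis unfolding sin_times_sin by (simp add: cos_five_pi_sixth h_def c_def)
  qed
  have nz: "c \<noteq> 0" "c - h \<noteq> 0" "c + h \<noteq> 0" using assms c6 by auto
  show s: "sin (pi / 12 - y) \<noteq> 0" "sin (pi / 12 + y) \<noteq> 0" "sin (5 * pi / 12 - y) \<noteq> 0" "sin (5 * pi / 12 + y) \<noteq> 0"
    using p1 p2 nz by auto
  have e: "(pi / 12 + y) - (pi / 12 - y) = 2 * y" "(5 * pi / 12 + y) - (5 * pi / 12 - y) = 2 * y" by simp_all
  have "cot (pi / 12 - y) - cot (pi / 12 + y) - (cot (5 * pi / 12 - y) - cot (5 * pi / 12 + y))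
      = sin (2 * y) / ((c - h) / 2) - sin (2 * y) / ((c + h) / 2)"
    unfolding cot_diff[OF s(1,2)] cot_diff[OF s(3,4)] p1 p2 e ..
  also have "\<dots> = 4 * h * sin (2 * y) / ((c - h) * (c + h))"
    using nz by (simp add: divide_simps) (simp add: algebra_simps)
  also have "\<dots> = 8 * h * (2 * sin (2 * y) * c) / (4 * c * (c - h) * (c + h))"
    using nz by (simp add: divide_simps)
  also have "2 * sin (2 * y) * c = sin (4 * y)"
    using sin_double[of "2 * y"] by (simp add: c_def)
  finally show "cot (pi / 12 - y) - cot (pi / 12 + y) - (cot (5 * pi / 12 - y) - cot (5 * pi / 12 + y))
           = 4 * sqrt 3 * sin (4 * y) / cos (6 * y)"
    unfolding c6 by (simp add: h_def)
qed

lemma summable_chi_div_sing_minus: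
  assumes "p \<notin> sings"
  shows "summable (\<lambda>m. norm (chi m / (of_real (sing m) - p)))"
proof -
  obtain r where r: "r > 0" "r \<le> 1" "\<And>q w. q \<in> ball p r \<Longrightarrow> w \<in> sings \<Longrightarrow> r \<le> dist q w"
  proof (rule obtain_ball_avoiding_sings[of "-sings" p])
    show "open (- sings)" using closed_sings by auto
  qed (use assms in auto)
  have "norm (norm (chi m / (of_real (sing m) - p))) \<le> 2 * (1 + norm p) / r * (1 / sing m)" for m
  proof (cases "m = 0")
    case False
    hence m: "m > 0" by simp
    have "r * sing m / (2 * (1 + norm p)) \<le> norm (of_real (sing m) - p)"
      using r m by (intro norm_sing_minus_ge) auto
    moreover have "r * sing m / (2 * (1 + norm p)) > 0" 
      using r sing_pos[OF m] by (simp add: add_pos_nonneg)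
    ultimately have "norm (chi m) / norm (of_real (sing m) - p) \<le> 1 / (r * sing m / (2 * (1 + norm p)))"
      using norm_chi_le[of m] by (intro frac_le) auto
    thus ?thesis using r by (simp add: norm_divide)
  qed (auto simp: sing_def)
  thus ?thesis
    by (intro summable_comparison_test'[OF summable_mult[OF summable_inverse_sing, of "2 * (1 + norm p) / r"], of 0])
qed

text \<open>
  Sums against \<open>chi\<close> are evaluated period by period, which pairs the terms in the way the cotangent
  series does.
\<close>

lemma sum_chi_group:
  "(\<Sum>m\<in>{k * 12..<k * 12 + 12}. chi m * f m) =
     f (k * 12 + 1) - f (k * 12 + 5) - f (k * 12 + 7) + f (k * 12 + 11)"
proof -
  have "(\<Sum>m\<in>{k * 12..<k * 12 + 12}. chi m * f m) = (\<Sum>j<12. chi (k * 12 + j) * f (k * 12 + j))"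
    by (rule sum.reindex_bij_witness[of _ "\<lambda>j. k * 12 + j" "\<lambda>m. m - k * 12"]) auto
  also have "\<dots> = (\<Sum>j<12. chi j * f (k * 12 + j))"
    by (intro sum.cong) (auto simp: chi_def)
  also have "\<dots> = f (k * 12 + 1) - f (k * 12 + 5) - f (k * 12 + 7) + f (k * 12 + 11)"
    by (simp add: lessThan_nat_numeral) (simp add: chi_def algebra_simps)
  finally show ?thesis .
qed

lemma cos_three_nonzero:
  fixes v :: complex
  assumes "6 * v ^ 2 \<notin> sings"
  shows "cos (3 * v) \<noteq> 0"
proof
  assume "cos (3 * v) = 0"
  then obtain n :: int where n: "3 * v = of_real (of_int n * pi) + of_real pi / 2"
    unfolding cos_eq_0 by auto
  define m where "m = nat \<bar>2 * n + 1\<bar>"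
  have "6 * v = of_real (of_int (2 * n + 1) * pi)"
    using arg_cong[OF n, of "\<lambda>x. 2 * x"] by (simp add: algebra_simps)
  hence "(6 * v) ^ 2 = of_real ((of_int (2 * n + 1) * pi) ^ 2)" by (simp only: of_real_power)
  moreover have "(of_int (2 * n + 1) * pi) ^ 2 = (pi * real m) ^ 2"
    by (simp add: m_def power_mult_distrib)
  ultimately have "(6 * v) ^ 2 = of_real ((pi * real m) ^ 2)" by (simp only:)
  hence "6 * v ^ 2 = of_real (sing m)" by (simp add: sing_def power_mult_distrib)
  moreover have "m > 0"
  proof -
    have "2 * n + 1 \<noteq> 0" by presburger
    thus ?thesis unfolding m_def by simp
  qed
  ultimately show False using sing_in_sings assms by metis
qed

text \<open>
  The poles \<open>v = \<plusminus> pi * m / 6\<close> of \<open>sin 2v / cos 3v\<close> have residues proportional to \<open>chi m\<close>; in the variable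
  \<open>p = 6 v\<^sup>2\<close> they are the numbers \<open>sing m\<close>. This expansion is used twice: its Taylor series gives
  the coefficients of \<open>KZ_F\<close>, and on rays it evaluates the Laplace integral.
\<close>

lemma sin_cos_partial_fractions:
  fixes v :: complex
  assumes "6 * v ^ 2 \<notin> sings"
  shows "(\<lambda>m. 6 * v * (chi m / (of_real (sing m) - 6 * v ^ 2))) sums (sqrt 3 * sin (2 * v) / cos (3 * v))"
proof -
  define z where "z = 6 * v / of_real pi"
  define y where "y = v / 2"
  have "cos (6 * y) \<noteq> 0" using cos_three_nonzero[OF assms] by (simp add: y_def)
  note cc = cot_combination[OF this]
  have y: "of_real pi * ((1 - z) / 12) = pi / 12 - y" "of_real pi * ((1 + z) / 12) = pi / 12 + y"
    "of_real pi * ((5 - z) / 12) = 5 * pi / 12 - y" "of_real pi * ((5 + z) / 12) = 5 * pi / 12 + y"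
    by (simp_all add: z_def y_def field_simps)
  define g where "g = (\<lambda>w (k::nat). 1 / (w + of_nat k) - 1 / (1 - w + of_nat k) :: complex)"
  have "(\<lambda>k. (g ((1 - z) / 12) k - g ((1 + z) / 12) k) - (g ((5 - z) / 12) k - g ((5 + z) / 12) k)) sums
     ((of_real pi * cot (pi / 12 - y) - of_real pi * cot (pi / 12 + y)) -
      (of_real pi * cot (5 * pi / 12 - y) - of_real pi * cot (5 * pi / 12 + y)))"
    unfolding g_def
    using sums_diff[OF sums_diff[OF cot_sums[OF cc(2)[folded y(1)]] cot_sums[OF cc(3)[folded y(2)]]]
        sums_diff[OF cot_sums[OF cc(4)[folded y(3)]] cot_sums[OF cc(5)[folded y(4)]]]]
    by (simp only: y)
  also have "((of_real pi * cot (pi / 12 - y) - of_real pi * cot (pi / 12 + y)) -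
      (of_real pi * cot (5 * pi / 12 - y) - of_real pi * cot (5 * pi / 12 + y))) = 
     of_real pi * (4 * sqrt 3 * sin (4 * y) / cos (6 * y))"
    unfolding cc(1)[symmetric] by (simp add: algebra_simps)
  finally have S: "(\<lambda>k. (g ((1 - z) / 12) k - g ((1 + z) / 12) k) - (g ((5 - z) / 12) k - g ((5 + z) / 12) k)) sums
     (of_real pi * (4 * sqrt 3 * sin (2 * v) / cos (3 * v)))" by (simp add: y_def)
  define f where "f = (\<lambda>m::nat. 1 / (of_nat m - z) - 1 / (of_nat m + z))"
  define T where "T = (\<lambda>m. 6 * v * (chi m / (of_real (sing m) - 6 * v ^ 2)))"
  have Tf: "T m = 3 / of_real pi * (chi m * f m)" for m
  proof (cases "m > 0")
    case True
    have "of_real (sing m) - 6 * v ^ 2 = of_real pi ^ 2 / 6 * ((of_nat m - z) * (of_nat m + z))"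
      by (simp add: sing_def z_def field_simps power2_eq_square)
    moreover have "of_real (sing m) - 6 * v ^ 2 \<noteq> 0" using assms sing_in_sings[OF True] by auto
    ultimately have nz: "of_nat m - z \<noteq> 0" "of_nat m + z \<noteq> 0" by auto
    have "f m = 2 * z / ((of_nat m - z) * (of_nat m + z))"
      using nz by (simp add: f_def divide_simps)
    also have "\<dots> = 2 * z * (of_real pi ^ 2 / 6) / (of_real pi ^ 2 / 6 * ((of_nat m - z) * (of_nat m + z)))"
      using nz by simp
    also have "\<dots> = 2 * z * (of_real pi ^ 2 / 6) / (of_real (sing m) - 6 * v ^ 2)"
      by (simp only: \<open>of_real (sing m) - 6 * v ^ 2 = _\<close>)
    also have "2 * z * (of_real pi ^ 2 / 6) = 2 * of_real pi * v"
      by (simp add: z_def power2_eq_square)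
    finally show ?thesis by (simp add: T_def)
  qed (simp add: T_def)
  have "summable T" unfolding T_def
    by (intro summable_mult summable_norm_cancel[OF summable_chi_div_sing_minus] assms)
  hence "(\<lambda>k. sum T {k * 12..<k * 12 + 12}) sums (\<Sum>m. T m)"
    by (intro sums_group summable_sums) auto
  also have "(\<lambda>k. sum T {k * 12..<k * 12 + 12}) = (\<lambda>k. 1 / (4 * of_real pi) *
      ((g ((1 - z) / 12) k - g ((1 + z) / 12) k) - (g ((5 - z) / 12) k - g ((5 + z) / 12) k)))"
  proof
    fix k
    have i: "(1 - z) / 12 + of_nat k = (of_nat (k * 12 + 1) - z) / 12"
      "1 - (1 - z) / 12 + of_nat k = (of_nat (k * 12 + 11) + z) / 12"
      "(1 + z) / 12 + of_nat k = (of_nat (k * 12 + 1) + z) / 12"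
      "1 - (1 + z) / 12 + of_nat k = (of_nat (k * 12 + 11) - z) / 12"
      "(5 - z) / 12 + of_nat k = (of_nat (k * 12 + 5) - z) / 12"
      "1 - (5 - z) / 12 + of_nat k = (of_nat (k * 12 + 7) + z) / 12"
      "(5 + z) / 12 + of_nat k = (of_nat (k * 12 + 5) + z) / 12"
      "1 - (5 + z) / 12 + of_nat k = (of_nat (k * 12 + 7) - z) / 12"
      by (simp_all add: field_simps)
    have inv: "1 / (x / 12) = 12 * (1 / x)" for x :: complex by simp
    have comb: "12 * a - 12 * b - (12 * c - 12 * d) = 12 * ((a - c) + (d - b))" for a b c d :: complex
      by simp
    have s: "sum T {k * 12..<k * 12 + 12} = 3 / of_real pi *
       (f (k * 12 + 1) - f (k * 12 + 5) - f (k * 12 + 7) + f (k * 12 + 11))"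
      unfolding Tf sum_chi_group[symmetric] by (simp add: sum_distrib_left)
    have gA: "g ((1 - z) / 12) k - g ((1 + z) / 12) k = 12 * (f (k * 12 + 1) + f (k * 12 + 11))"
      unfolding g_def i inv comb f_def ..
    have gB: "g ((5 - z) / 12) k - g ((5 + z) / 12) k = 12 * (f (k * 12 + 5) + f (k * 12 + 7))"
      unfolding g_def i inv comb f_def ..
    show "sum T {k * 12..<k * 12 + 12} = 1 / (4 * of_real pi) *
      ((g ((1 - z) / 12) k - g ((1 + z) / 12) k) - (g ((5 - z) / 12) k - g ((5 + z) / 12) k))"
    proof -
      have "3 / P * (a - b - c + d) = 1 / (4 * P) * (12 * (a + d) - 12 * (b + c))" for a b c d P :: complex
        by (cases "P = 0") (simp_all add: divide_simps)
      thus ?thesis unfolding s gA gB by this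
    qed
  qed
  finally have "(\<lambda>k. 1 / (4 * of_real pi) *
      ((g ((1 - z) / 12) k - g ((1 + z) / 12) k) - (g ((5 - z) / 12) k - g ((5 + z) / 12) k))) sums (\<Sum>m. T m)" .
  moreover have "(\<lambda>k. 1 / (4 * of_real pi) *
      ((g ((1 - z) / 12) k - g ((1 + z) / 12) k) - (g ((5 - z) / 12) k - g ((5 + z) / 12) k))) sums
      (1 / (4 * of_real pi) * (of_real pi * (4 * sqrt 3 * sin (2 * v) / cos (3 * v))))"
    by (intro sums_mult S)
  ultimately have "(\<Sum>m. T m) = 1 / (4 * of_real pi) * (of_real pi * (4 * sqrt 3 * sin (2 * v) / cos (3 * v)))"
    by (rule sums_unique2)
  also have "\<dots> = sqrt 3 * sin (2 * v) / cos (3 * v)" by simp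
  finally show ?thesis using summable_sums[OF \<open>summable T\<close>] by (simp add: T_def)
qed

section \<open>Taylor coefficients at \<open>q = 1\<close>\<close>

text \<open>
  Families of power series whose coefficients are polynomials in a parameter. Functional equations in
  the parameter then become identities between polynomials, for which there is no question of
  convergence.
\<close>

definition poly_family :: "(complex \<Rightarrow> complex fps) \<Rightarrow> bool" where
  "poly_family F \<longleftrightarrow> (\<forall>j. \<exists>p. \<forall>y. fps_nth (F y) j = poly p y)"

lemma poly_family_const: "poly_family (\<lambda>_. c)"
  unfolding poly_family_def by (auto intro: exI[of _ "[:_:]"])

lemma poly_family_add: "poly_family F \<Longrightarrow> poly_family G \<Longrightarrow> poly_family (\<lambda>y. F y + G y)"
  unfolding poly_family_def by (metis fps_add_nth poly_add)

lemma poly_family_diff: "poly_family F \<Longrightarrow> poly_family G \<Longrightarrow> poly_family (\<lambda>y. F y - G y)"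
  unfolding poly_family_def by (metis fps_sub_nth poly_diff)

lemma poly_family_mult:
  assumes "poly_family F" "poly_family G"
  shows "poly_family (\<lambda>y. F y * G y)"
proof -
  obtain p q where pq: "\<And>j y. fps_nth (F y) j = poly (p j) y" "\<And>j y. fps_nth (G y) j = poly (q j) y"
    using assms unfolding poly_family_def by metis
  have "fps_nth (F y * G y) j = poly (\<Sum>i=0..j. p i * q (j - i)) y" for j y
    by (simp add: fps_mult_nth poly_sum pq)
  thus ?thesis unfolding poly_family_def by blast
qed

lemma poly_family_exp: "poly_family (\<lambda>y. fps_exp (poly r y))"
proof -
  have "fps_nth (fps_exp (poly r y)) j = poly (smult (1 / fact j) (r ^ j)) y" for j y
    by (simp add: poly_power)
  thus ?thesis unfolding poly_family_def by blast
qed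

lemma poly_family_prod:
  assumes "\<And>k. k \<in> A \<Longrightarrow> poly_family (F k)"
  shows "poly_family (\<lambda>y. \<Prod>k\<in>A. F k y)"
  using assms by (induction A rule: infinite_finite_induct) (auto intro: poly_family_const poly_family_mult)

lemma poly_family_sum:
  assumes "\<And>k. k \<in> A \<Longrightarrow> poly_family (F k)"
  shows "poly_family (\<lambda>y. \<Sum>k\<in>A. F k y)"
  using assms by (induction A rule: infinite_finite_induct) (auto intro: poly_family_const poly_family_add)

text \<open>
  A polynomial of period 2 is constant.
\<close>

lemma poly_antiperiodic_imp_0:
  fixes p :: "complex poly"
  assumes "\<And>y. poly p y + poly p (y + 1) = 0"
  shows "p = 0"
proof (rule ccontr)
  assume nz: "p \<noteq> 0"
  have 2: "poly p (y + 2) = poly p y" for y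
    using assms[of y] assms[of "y + 1"] by (simp add: add_eq_0_iff2 add.assoc)
  have per: "poly p (of_nat (2 * n)) = poly p 0" for n
  proof (induction n)
    case (Suc n)
    thus ?case using 2[of "of_nat (2 * n)"] by (simp add: add_ac)
  qed simp
  have "range (\<lambda>n::nat. of_nat (2 * n)) \<subseteq> {y. poly (p - [:poly p 0:]) y = 0}"
    using per by auto
  moreover have "infinite (range (\<lambda>n::nat. of_nat (2 * n) :: complex))"
    by (rule range_inj_infinite) (auto simp: inj_def)
  ultimately have "p - [:poly p 0:] = 0"
    using poly_roots_finite infinite_super by blast
  hence "p = [:poly p 0:]" by simp
  then obtain c where c: "p = [:c:]" by blast
  have "c + c = 0" using assms[of 0] unfolding c by simp
  thus False using nz c by simp
qed

abbreviation E :: "complex \<Rightarrow> complex fps" where "E \<equiv> fps_exp"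

text \<open>
  With \<open>q = e\<^sup>-\<^sup>X\<close> and \<open>\<xi> = q\<^sup>y\<close> this is \<open>(1 - \<xi>q) \<dots> (1 - \<xi>q\<^sup>n)\<close>. Deforming the
  series of Kontsevich and Zagier by \<open>\<xi>\<close> is what makes a functional equation available.
\<close>

definition qprod :: "nat \<Rightarrow> complex \<Rightarrow> complex fps" where
  "qprod n y = (\<Prod>k=1..n. 1 - E (- (y + of_nat k)))"

definition zagier_sum :: "nat \<Rightarrow> complex \<Rightarrow> complex fps" where
  "zagier_sum M y = (\<Sum>n<M. (1 - E (- y)) * qprod n y * E (- of_nat n * y))"

lemma E_mult: "E a * E b = E (a + b)"
  by (simp add: fps_exp_add_mult)

lemma qprod_Suc: "qprod (Suc n) y = qprod n y * (1 - E (- (y + of_nat (Suc n))))"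
  by (simp add: qprod_def)

lemma qprod_Suc': "qprod (Suc n) y = (1 - E (- (y + 1))) * qprod n (y + 1)"
proof -
  have "qprod (Suc n) y = (\<Prod>k=Suc 0..Suc n. 1 - E (- (y + of_nat k)))" by (simp add: qprod_def)
  also have "\<dots> = (1 - E (- (y + 1))) * (\<Prod>k=Suc 1..Suc n. 1 - E (- (y + of_nat k)))"
    by (subst prod.atLeast_Suc_atMost) auto
  also have "(\<Prod>k=Suc 1..Suc n. 1 - E (- (y + of_nat k))) = (\<Prod>k=1..n. 1 - E (- (y + of_nat (Suc k))))"
    by (rule prod.shift_bounds_cl_Suc_ivl)
  finally show ?thesis by (simp add: qprod_def add_ac)
qed

lemma qprod_nth_eq_0:
  "j < n \<Longrightarrow> fps_nth (qprod n y * G) j = 0"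
proof (induction n arbitrary: j G)
  case (Suc n)
  have "fps_nth ((qprod n y * G) * (1 - E (- (y + of_nat (Suc n))))) j = 0"
    unfolding fps_mult_nth[of "qprod n y * G"]
  proof (intro sum.neutral ballI)
    fix i assume i: "i \<in> {0..j}"
    show "fps_nth (qprod n y * G) i * fps_nth (1 - E (- (y + of_nat (Suc n)))) (j - i) = 0"
    proof (cases "i < n")
      case True
      thus ?thesis using Suc.IH by simp
    next
      case False
      hence "j - i = 0" using i Suc.prems by auto
      thus ?thesis by simp
    qed
  qed
  thus ?case by (simp only: qprod_Suc mult_ac)
qed simp

text \<open>
  Zagier's \<open>q\<close>-difference equation in \<open>\<xi>\<close>, for partial sums. The shift \<open>y \<mapsto> y + 1\<close> multiplies \<open>\<xi>\<close> by
  \<open>q\<close>. Two telescoping steps (one lowering the product, one shifting it) produce an error term that is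
  \<open>X\<close>-adically small.
\<close>

lemma zagier_functional_equation:
  "zagier_sum (Suc (Suc M)) y = 1 - E (- (1 + 2 * y)) - E (- (2 + 3 * y)) * zagier_sum M (y + 1)
      - qprod (Suc M) y * E (- of_nat (Suc (Suc M)) * y)"
proof -
  have A: "zagier_sum (Suc N) y = 1 - E (- (1 + 2 * y)) * (\<Sum>n<N. qprod n y * E (- of_nat n * (y + 1)))
             - qprod N y * E (- of_nat (Suc N) * y)" for N
  proof (induction N)
    case 0
    show ?case by (simp add: zagier_sum_def qprod_def)
  next
    case (Suc N)
    have "zagier_sum (Suc (Suc N)) y = zagier_sum (Suc N) y + (1 - E (- y)) * qprod (Suc N) y * E (- of_nat (Suc N) * y)"
      unfolding zagier_sum_def by (rule sum.lessThan_Suc)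
    also have "\<dots> = 1 - E (- (1 + 2 * y)) * (\<Sum>n<N. qprod n y * E (- of_nat n * (y + 1)))
        + (qprod (Suc N) y - qprod N y) * E (- of_nat (Suc N) * y)
        - qprod (Suc N) y * (E (- y) * E (- of_nat (Suc N) * y))"
      unfolding Suc.IH by (simp add: algebra_simps)
    also have "qprod (Suc N) y - qprod N y = - (qprod N y * E (- (y + of_nat (Suc N))))"
      by (simp add: qprod_Suc algebra_simps)
    also have "- (qprod N y * E (- (y + of_nat (Suc N)))) * E (- of_nat (Suc N) * y)
        = - (E (- (1 + 2 * y)) * (qprod N y * E (- of_nat N * (y + 1))))"
    proof -
      have "E (- (y + of_nat (Suc N))) * E (- of_nat (Suc N) * y) = E (- (1 + 2 * y)) * E (- of_nat N * (y + 1))"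
        unfolding E_mult by (rule arg_cong[of _ _ E]) (simp add: algebra_simps)
      thus ?thesis by (simp add: algebra_simps)
    qed
    also have "E (- y) * E (- of_nat (Suc N) * y) = E (- of_nat (Suc (Suc N)) * y)"
      unfolding E_mult by (rule arg_cong[of _ _ E]) (simp add: algebra_simps)
    finally have *: "zagier_sum (Suc (Suc N)) y = 1 - E (- (1 + 2 * y)) * (\<Sum>n<N. qprod n y * E (- of_nat n * (y + 1)))
        + - (E (- (1 + 2 * y)) * (qprod N y * E (- of_nat N * (y + 1)))) 
        - qprod (Suc N) y * E (- of_nat (Suc (Suc N)) * y)" .
    have "1 - X * S + - (X * T) - R = 1 - X * (S + T) - R" for X S T R :: "complex fps"
      by (simp add: algebra_simps)
    thus ?case unfolding * sum.lessThan_Suc .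
  qed
  have B: "(\<Sum>n<Suc M. qprod n y * E (- of_nat n * (y + 1))) = 1 + E (- (y + 1)) * zagier_sum M (y + 1)"
  proof -
    have "(\<Sum>n<Suc M. qprod n y * E (- of_nat n * (y + 1))) =
       1 + (\<Sum>n<M. qprod (Suc n) y * E (- of_nat (Suc n) * (y + 1)))"
      unfolding sum.lessThan_Suc_shift by (simp add: qprod_def)
    also have "(\<Sum>n<M. qprod (Suc n) y * E (- of_nat (Suc n) * (y + 1))) = E (- (y + 1)) * zagier_sum M (y + 1)"
      unfolding zagier_sum_def sum_distrib_left
    proof (intro sum.cong refl)
      fix n
      have "E (- of_nat (Suc n) * (y + 1)) = E (- (y + 1)) * E (- of_nat n * (y + 1))"
        unfolding E_mult by (rule arg_cong[of _ _ E]) (simp add: algebra_simps)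
      thus "qprod (Suc n) y * E (- of_nat (Suc n) * (y + 1)) =
            E (- (y + 1)) * ((1 - E (- (y + 1))) * qprod n (y + 1) * E (- of_nat n * (y + 1)))"
        by (simp only: qprod_Suc' mult_ac)
    qed
    finally show ?thesis .
  qed
  have "E (- (1 + 2 * y)) * E (- (y + 1)) = E (- (2 + 3 * y))"
    unfolding E_mult by (rule arg_cong[of _ _ E]) (simp add: algebra_simps)
  thus ?thesis unfolding A B by (simp add: ring_distribs mult.assoc[symmetric])
qed

definition qsum :: "nat \<Rightarrow> complex \<Rightarrow> complex fps" where
  "qsum M y = (\<Sum>n<M. qprod n y * E (- of_nat n * y))"

text \<open>
  The \<open>X\<close>-adic limit of the partial sums, taken coefficientwise: by \<open>qsum_nth\<close> the \<open>j\<close>-th coefficient is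
  stationary from the partial sum of length \<open>j + 1\<close> on.
\<close>

definition qseries :: "complex \<Rightarrow> complex fps" where
  "qseries y = Abs_fps (\<lambda>j. fps_nth (qsum (Suc j) y) j)"

lemma zagier_sum_eq: "zagier_sum M y = (1 - E (- y)) * qsum M y"
  by (simp add: zagier_sum_def qsum_def sum_distrib_left mult.assoc)

lemma qsum_nth: "j < M \<Longrightarrow> fps_nth (qsum M y) j = fps_nth (qseries y) j"
proof (induction M)
  case (Suc M)
  show ?case
  proof (cases "j = M")
    case False
    hence "j < M" using Suc.prems by simp
    thus ?thesis using Suc.IH by (simp add: qsum_def qprod_nth_eq_0)
  qed (simp add: qseries_def)
qed simp

lemma fps_mult_nth_cong:
  assumes "\<And>i. i \<le> j \<Longrightarrow> fps_nth F i = fps_nth G i"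
  shows "fps_nth (H * F) j = fps_nth (H * G) j"
  unfolding fps_mult_nth by (intro sum.cong) (auto simp: assms)

lemma zagier_sum_nth:
  "j < M \<Longrightarrow> fps_nth (H * zagier_sum M y) j = fps_nth (H * ((1 - E (- y)) * qseries y)) j"
  unfolding zagier_sum_eq mult.assoc[symmetric] by (rule fps_mult_nth_cong) (auto intro: qsum_nth)

lemma qseries_functional_equation:
  "(1 - E (- y)) * qseries y =
     1 - E (- (1 + 2 * y)) - E (- (2 + 3 * y)) * ((1 - E (- (y + 1))) * qseries (y + 1))"
proof (rule fps_ext)
  fix j
  have "fps_nth ((1 - E (- y)) * qseries y) j = fps_nth (zagier_sum (Suc (Suc (Suc j))) y) j"
    using zagier_sum_nth[of j "Suc (Suc (Suc j))" 1 y] by simp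
  also have "\<dots> = fps_nth (1 - E (- (1 + 2 * y)) - E (- (2 + 3 * y)) * ((1 - E (- (y + 1))) * qseries (y + 1))) j"
    unfolding zagier_functional_equation using zagier_sum_nth[of j "Suc j" "E (- (2 + 3 * y))" "y + 1"]
    by (simp only: fps_sub_nth qprod_nth_eq_0[of j "Suc (Suc j)"] less_Suc_eq simp_thms diff_zero)
  finally show "fps_nth ((1 - E (- y)) * qseries y) j = \<dots>" .
qed

text \<open>
  Completing the square in the exponents of the functional equation turns the factors into values of
  one Gaussian.
\<close>

definition centred_series :: "complex \<Rightarrow> complex fps" where
  "centred_series y = E (- ((6 * y + 1)\<^sup>2 / 24)) * ((1 - E (- y)) * qseries y)"

lemma centred_series_functional_equation:
  "centred_series y + centred_series (y + 1) = E (- ((6 * y + 1)\<^sup>2 / 24)) - E (- ((6 * y + 5)\<^sup>2 / 24))"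
proof -
  have e: "E (- ((6 * y + 1)\<^sup>2 / 24)) * E (- (1 + 2 * y)) = E (- ((6 * y + 5)\<^sup>2 / 24))"
    "E (- ((6 * y + 1)\<^sup>2 / 24)) * E (- (2 + 3 * y)) = E (- ((6 * (y + 1) + 1)\<^sup>2 / 24))"
    unfolding E_mult by (rule arg_cong[of _ _ E]; simp add: field_simps power2_eq_square)+
  have alg: "a * (1 - b - c * d) + (a * c) * d = a - a * b" for a b c d :: "complex fps"
    by (simp add: algebra_simps)
  show ?thesis
    unfolding centred_series_def qseries_functional_equation[of y]
    unfolding e(2)[symmetric] e(1)[symmetric] by (rule alg)
qed

lemma poly_family_qseries: "poly_family qseries"
proof -
  have lin: "poly_family (\<lambda>y. E (a + b * y))" for a b
    using poly_family_exp[of "[:a, b:]"] by (simp add: mult.commute)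
  have "poly_family (qsum M)" for M
    unfolding qsum_def
  proof (intro poly_family_sum poly_family_mult)
    fix n
    have "poly_family (\<lambda>y. E (- (y + of_nat k)))" for k
    proof -
      have "- (y + of_nat k) = - of_nat k + (- 1) * y" for y :: complex by simp
      thus ?thesis using lin[of "- of_nat k" "-1"] by (simp only:)
    qed
    thus "poly_family (qprod n)" unfolding qprod_def
      by (intro poly_family_prod poly_family_diff poly_family_const)
    show "poly_family (\<lambda>y. E (- of_nat n * y))" using lin[of 0 "- of_nat n"] by simp
  qed
  thus ?thesis unfolding poly_family_def qseries_def by (metis fps_nth_Abs_fps)
qed

text \<open>
  The power series \<open>(e\<^sup>a\<^sup>y\<^sup>X - 1) / y\<close>, which still has polynomial coefficients at \<open>y = 0\<close>.
\<close>

definition exp_quotient :: "complex \<Rightarrow> complex \<Rightarrow> complex fps" where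
  "exp_quotient a y = Abs_fps (\<lambda>k. if k = 0 then 0 else a ^ k * y ^ (k - 1) / fact k)"

lemma exp_eq_exp_quotient: "E (a * y) = 1 + fps_const y * exp_quotient a y"
proof (rule fps_ext)
  fix k show "fps_nth (E (a * y)) k = fps_nth (1 + fps_const y * exp_quotient a y) k"
    by (cases k) (auto simp: exp_quotient_def power_mult_distrib simp del: fact_Suc of_nat_Suc)
qed

lemma exp_quotient_0: "exp_quotient a 0 = fps_const a * fps_X"
proof (rule fps_ext)
  fix k show "fps_nth (exp_quotient a 0) k = fps_nth (fps_const a * fps_X) k"
    by (cases "k = 0"; cases "k = 1") (auto simp: exp_quotient_def)
qed

lemma poly_family_exp_quotient: "poly_family (exp_quotient a)"
proof -
  have "fps_nth (exp_quotient a y) k = poly (if k = 0 then 0 else monom (a ^ k / fact k) (k - 1)) y" for k y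
    by (simp add: exp_quotient_def poly_monom)
  thus ?thesis unfolding poly_family_def by blast
qed

text \<open>
  Both the deformed series (suitably normalised) and \<open>E (6 * y) * A\<close> solve, coefficient by coefficient,
  the same equation \<open>g y + g (y + 1) = (6y + 1)\<^sup>2\<^sup>j - (6y + 5)\<^sup>2\<^sup>j\<close> in polynomials, up to the same
  constant. Its solution is unique, and comparing the derivatives at \<open>y = 0\<close> gives the coefficients of
  the undeformed series.
\<close>

lemma qseries_0_nth:
  assumes A: "A * (1 + E 6) = E 1 - E 5"
  shows "fps_nth (E (- (1 / 24)) * qseries 0) n =
     (- 1 / 24) ^ Suc n / fact (Suc n) * fact (2 * n + 2) * 6 * fps_nth A (2 * n + 1)"
proof -
  define j where "j = Suc n"
  define c :: complex where "c = (- 1 / 24) ^ j / fact j * fact (2 * j)"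
  define G where "G = (\<lambda>y. E (- ((6 * y + 1)\<^sup>2 / 24)))"
  have G: "poly_family G"
  proof -
    have "G y = E (poly [:- 1 / 24, - 1 / 2, - 3 / 2:] y)" for y
      unfolding G_def by (rule arg_cong[of _ _ E]) (simp add: field_simps power2_eq_square)
    thus ?thesis using poly_family_exp[of "[:- 1 / 24, - 1 / 2, - 3 / 2:]"] by presburger
  qed
  have eq1: "centred_series y = fps_const y * ((- 1) * exp_quotient (- 1) y * (G y * qseries y))" for y
    using exp_eq_exp_quotient[of "-1" y] by (simp add: centred_series_def G_def mult_ac)
  have "poly_family (\<lambda>y. (- 1) * exp_quotient (- 1) y * (G y * qseries y))"
    by (intro poly_family_mult poly_family_const poly_family_exp_quotient G poly_family_qseries)
  then obtain u where u: "\<And>y. fps_nth ((- 1) * exp_quotient (- 1) y * (G y * qseries y)) j = poly u y"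
    unfolding poly_family_def by meson
  have "poly_family (\<lambda>y. exp_quotient 6 y * A)"
    by (intro poly_family_mult poly_family_const poly_family_exp_quotient)
  then obtain w where w: "\<And>y. fps_nth (exp_quotient 6 y * A) (2 * j) = poly w y"
    unfolding poly_family_def by meson
  have eq2: "fps_nth (E (6 * y) * A) (2 * j) = fps_nth A (2 * j) + y * poly w y" for y
    unfolding exp_eq_exp_quotient w[symmetric] by (simp add: ring_distribs mult.assoc)
  \<comment> \<open>the difference of the two solutions, as a polynomial in \<open>y\<close>; the factor \<open>y\<close> is divided out below\<close>
  define p where "p = pCons 0 u - smult c (pCons (fps_nth A (2 * j)) w)"
  have p: "poly p y = fps_nth (centred_series y) j - c * fps_nth (E (6 * y) * A) (2 * j)" for y
    unfolding eq1 eq2 by (simp add: p_def algebra_simps flip: u) 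
  have "p = 0"
  proof (rule poly_antiperiodic_imp_0)
    fix y
    have "E (6 * y) * A + E (6 * (y + 1)) * A = E (6 * y) * (A * (1 + E 6))"
      using E_mult[of "6 * y" 6] by (simp add: algebra_simps)
    also have "\<dots> = E (6 * y + 1) - E (6 * y + 5)"
      unfolding A by (simp add: E_mult ring_distribs)
    finally have *: "E (6 * y) * A + E (6 * (y + 1)) * A = E (6 * y + 1) - E (6 * y + 5)" .
    have "fps_nth (E (6 * y) * A) (2 * j) + fps_nth (E (6 * (y + 1)) * A) (2 * j)
        = ((6 * y + 1) ^ (2 * j) - (6 * y + 5) ^ (2 * j)) / fact (2 * j)"
      unfolding fps_add_nth[symmetric] * fps_sub_nth fps_exp_nth diff_divide_distrib by simp
    hence "c * fps_nth (E (6 * y) * A) (2 * j) + c * fps_nth (E (6 * (y + 1)) * A) (2 * j)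
        = (- 1 / 24) ^ j / fact j * ((6 * y + 1) ^ (2 * j) - (6 * y + 5) ^ (2 * j))"
      unfolding distrib_left[symmetric] by (simp add: c_def)
    moreover have "fps_nth (centred_series y) j + fps_nth (centred_series (y + 1)) j
        = (- 1 / 24) ^ j / fact j * ((6 * y + 1) ^ (2 * j) - (6 * y + 5) ^ (2 * j))"
    proof -
      have g: "fps_nth (E (- (x\<^sup>2 / 24))) j = (- 1 / 24) ^ j / fact j * x ^ (2 * j)" for x
      proof -
        have "- (x\<^sup>2 / 24) = (- 1 / 24) * x\<^sup>2" by simp
        thus ?thesis by (simp only: fps_exp_nth power_mult_distrib power_mult) simp
      qed
      show ?thesis unfolding fps_add_nth[symmetric] centred_series_functional_equation fps_sub_nth g
        by (simp add: right_diff_distrib)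
    qed
    ultimately show "poly p y + poly p (y + 1) = 0"
      unfolding p add_diff_add[symmetric] by (simp only: diff_self)
  qed
  hence "pCons 0 u = pCons (c * fps_nth A (2 * j)) (smult c w)" by (simp add: p_def)
  hence "u = smult c w" by simp
  hence "poly u 0 = c * poly w 0" by simp
  moreover have "poly u 0 = fps_nth (E (- (1 / 24)) * qseries 0) n"
    unfolding u[symmetric] exp_quotient_0 by (simp add: G_def j_def mult.assoc)
  moreover have "poly w 0 = 6 * fps_nth A (2 * n + 1)"
    unfolding w[symmetric] exp_quotient_0 by (simp add: j_def mult.assoc)
  ultimately show ?thesis by (simp add: c_def j_def)
qed

definition of_rat_fps :: "rat fps \<Rightarrow> complex fps" where
  "of_rat_fps F = Abs_fps (\<lambda>n. of_rat (fps_nth F n))"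

lemma of_rat_fps_mult: "of_rat_fps (F * G) = of_rat_fps F * of_rat_fps G"
  by (rule fps_ext) (simp add: of_rat_fps_def fps_mult_nth of_rat_sum of_rat_mult)

lemma of_rat_fps_1: "of_rat_fps 1 = 1"
  by (rule fps_ext) (simp add: of_rat_fps_def)

lemma of_rat_fps_diff: "of_rat_fps (F - G) = of_rat_fps F - of_rat_fps G"
  by (rule fps_ext) (simp add: of_rat_fps_def of_rat_diff)

lemma of_rat_fps_exp: "of_rat_fps (fps_exp a) = E (of_rat a)"
proof -
  have "of_rat (fact n) = (fact n :: complex)" for n by (metis of_nat_fact of_rat_of_nat_eq)
  thus ?thesis by (intro fps_ext) (simp add: of_rat_fps_def of_rat_divide of_rat_power)
qed

lemma of_rat_fps_qprod: "of_rat_fps (\<Prod>k=1..n. 1 - fps_exp (- 1) ^ k) = qprod n 0"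
proof (induction n)
  case (Suc n)
  have "of_rat (of_nat (Suc n) * - 1) = (- (0 + of_nat (Suc n)) :: complex)"
    by (simp add: of_rat_minus of_rat_mult del: of_nat_Suc)
  hence "of_rat_fps (1 - fps_exp (- 1) ^ Suc n) = 1 - E (- (0 + of_nat (Suc n)))"
    unfolding of_rat_fps_diff of_rat_fps_1 fps_exp_power_mult of_rat_fps_exp by (simp only:)
  thus ?case using Suc.IH by (simp add: qprod_Suc of_rat_fps_mult del: power_Suc of_nat_Suc)
qed (simp add: of_rat_fps_1 qprod_def)

text \<open>
  The sum that defines the series over the rationals is an \<open>X\<close>-adic limit, and each coefficient depends
  on finitely many terms only; hence it can be computed over the complex numbers.
\<close>

lemma of_rat_fps_KZ: "of_rat_fps (KZ (fps_exp (- 1))) = qseries 0"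
proof -
  define u where "u = (\<lambda>n. \<Prod>k=1..n. 1 - fps_exp (-1 :: rat) ^ k)"
  have u_nth: "fps_nth (u n) j = 0" if "j < n" for j n
  proof -
    have "of_rat (fps_nth (u n) j) = fps_nth (of_rat_fps (u n)) j" by (simp add: of_rat_fps_def)
    also have "\<dots> = (0 :: complex)"
      unfolding u_def of_rat_fps_qprod using qprod_nth_eq_0[OF that, of 0 1] by simp
    finally show ?thesis by simp
  qed
  have "(\<lambda>n. \<Sum>i<n. u i) \<longlonglongrightarrow> Abs_fps (\<lambda>j. \<Sum>i<Suc j. fps_nth (u i) j)"
  proof (rule tendsto_fpsI)
    fix j
    have "fps_nth (\<Sum>i<n. u i) j = (\<Sum>i<Suc j. fps_nth (u i) j)" if "n \<ge> Suc j" for n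
      unfolding fps_sum_nth using that by (intro sum.mono_neutral_right) (auto simp: u_nth)
    thus "eventually (\<lambda>n. fps_nth (\<Sum>i<n. u i) j
        = fps_nth (Abs_fps (\<lambda>j. \<Sum>i<Suc j. fps_nth (u i) j)) j) sequentially"
      by (auto intro: eventually_sequentiallyI[of "Suc j"])
  qed
  hence "KZ (fps_exp (- 1)) = Abs_fps (\<lambda>j. \<Sum>i<Suc j. fps_nth (u i) j)"
    unfolding KZ_def u_def[symmetric] by (intro sums_unique[symmetric]) (simp only: sums_def)
  hence "fps_nth (of_rat_fps (KZ (fps_exp (- 1)))) j = (\<Sum>i<Suc j. fps_nth (of_rat_fps (u i)) j)" for j
    by (simp add: of_rat_fps_def of_rat_sum of_rat_add)
  thus ?thesis
    unfolding u_def of_rat_fps_qprod by (intro fps_ext) (simp add: qseries_def qsum_def fps_sum_nth)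
qed

lemma KZ_F_nth_via_quotient:
  assumes "A * (1 + E 6) = E 1 - E 5"
  shows "fps_nth KZ_F n = (- 1 / 24) ^ Suc n / fact (Suc n) * fact (2 * n + 2) * 6 * fps_nth A (2 * n + 1)"
proof -
  have "KZ_F = of_rat_fps KZ_F_rat" by (simp add: KZ_F_def of_rat_fps_def)
  also have "\<dots> = E (- (1 / 24)) * qseries 0"
    unfolding KZ_F_rat_def of_rat_fps_mult of_rat_fps_KZ of_rat_fps_exp by (simp add: of_rat_divide of_rat_minus)
  finally show ?thesis using qseries_0_nth[OF assms] by simp
qed

section \<open>The Borel transform near the origin\<close>

text \<open>
  Absolute convergence permits the interchange of the two summations.
\<close>

lemma double_series_sums:
  fixes w f u :: "nat \<Rightarrow> complex"
  assumes "summable (\<lambda>m. norm (w m))" "\<And>m. norm (u m) \<le> r" "summable (\<lambda>n. norm (f n) * r ^ n)"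
  shows "(\<lambda>n. f n * (\<Sum>m. w m * u m ^ n)) sums (\<Sum>m. w m * (\<Sum>n. f n * u m ^ n))"
proof -
  define t where "t = (\<lambda>n. norm (f n) * r ^ n)"
  define W where "W = (\<Sum>m. norm (w m))"
  have r: "r \<ge> 0" using assms(2)[of 0] norm_ge_zero order_trans by blast
  have t: "norm (f n * u m ^ n) \<le> t n" for n m
    unfolding t_def norm_mult norm_power using assms(2) by (intro mult_left_mono power_mono) auto
  have sumt: "summable t" using assms(3) by (simp add: t_def)
  have sumu: "summable (\<lambda>n. f n * u m ^ n)" for m
    by (rule summable_comparison_test'[OF sumt, of 0]) (use t in auto)
  have sumw: "summable (\<lambda>m. w m * u m ^ n)" for n
  proof (rule summable_comparison_test'[OF summable_mult2[OF assms(1), of "r ^ n"], of 0])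
    fix m show "norm (w m * u m ^ n) \<le> norm (w m) * r ^ n"
      unfolding norm_mult norm_power using assms(2) by (intro mult_left_mono power_mono) auto
  qed
  have sumwf: "summable (\<lambda>m. w m * (\<Sum>n. f n * u m ^ n))"
  proof (rule summable_comparison_test'[OF summable_mult2[OF assms(1), of "suminf t"], of 0])
    fix m
    have "norm (\<Sum>n. f n * u m ^ n) \<le> suminf t"
      by (rule norm_suminf_le) (use t sumt in auto)
    thus "norm (w m * (\<Sum>n. f n * u m ^ n)) \<le> norm (w m) * suminf t"
      unfolding norm_mult by (intro mult_left_mono) auto
  qed
  have part: "(\<Sum>n<N. f n * (\<Sum>m. w m * u m ^ n)) = (\<Sum>m. w m * (\<Sum>n<N. f n * u m ^ n))" for N
  proof -
    have "(\<Sum>n<N. f n * (\<Sum>m. w m * u m ^ n)) = (\<Sum>n<N. \<Sum>m. f n * (w m * u m ^ n))"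
      by (intro sum.cong refl suminf_mult[symmetric] sumw)
    also have "\<dots> = (\<Sum>m. \<Sum>n<N. f n * (w m * u m ^ n))"
      by (rule suminf_sum[symmetric]) (intro summable_mult sumw)
    also have "\<dots> = (\<Sum>m. w m * (\<Sum>n<N. f n * u m ^ n))"
      unfolding sum_distrib_left by (intro suminf_cong sum.cong refl mult.left_commute)
    finally show ?thesis .
  qed
  have tail: "norm ((\<Sum>m. w m * (\<Sum>n. f n * u m ^ n)) - (\<Sum>n<N. f n * (\<Sum>m. w m * u m ^ n)))
          \<le> W * (suminf t - (\<Sum>n<N. t n))" for N
  proof -
    have sumfin: "summable (\<lambda>m. w m * (\<Sum>n<N. f n * u m ^ n))"
    proof -
      have "w m * (\<Sum>n<N. f n * u m ^ n) = (\<Sum>n<N. f n * (w m * u m ^ n))" for m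
        unfolding sum_distrib_left by (intro sum.cong refl mult.left_commute)
      thus ?thesis by (simp only:) (intro summable_sum summable_mult sumw)
    qed
    have "(\<Sum>m. w m * (\<Sum>n. f n * u m ^ n)) - (\<Sum>n<N. f n * (\<Sum>m. w m * u m ^ n))
        = (\<Sum>m. w m * ((\<Sum>n. f n * u m ^ n) - (\<Sum>n<N. f n * u m ^ n)))"
      unfolding part by (subst suminf_diff[OF sumwf sumfin]) (simp add: right_diff_distrib)
    also have "norm \<dots> \<le> (\<Sum>m. norm (w m) * (suminf t - (\<Sum>n<N. t n)))"
    proof (rule norm_suminf_le)
      fix m
      have "(\<Sum>n. f n * u m ^ n) - (\<Sum>n<N. f n * u m ^ n) = (\<Sum>n. f (n + N) * u m ^ (n + N))"
        by (subst suminf_split_initial_segment[OF sumu, of _ N]) simp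
      also have "norm \<dots> \<le> (\<Sum>n. t (n + N))"
        by (rule norm_suminf_le) (use t sumt in \<open>auto simp: summable_iff_shift\<close>)
      also have "\<dots> = suminf t - (\<Sum>n<N. t n)"
        by (rule suminf_minus_initial_segment[OF sumt])
      finally show "norm (w m * ((\<Sum>n. f n * u m ^ n) - (\<Sum>n<N. f n * u m ^ n))) \<le> norm (w m) * (suminf t - (\<Sum>n<N. t n))"
        unfolding norm_mult by (intro mult_left_mono) auto
    qed (intro summable_mult2 assms(1))
    also have "\<dots> = W * (suminf t - (\<Sum>n<N. t n))"
      unfolding W_def by (rule suminf_mult2[OF assms(1), symmetric])
    finally show ?thesis .
  qed
  have "(\<lambda>N. W * (suminf t - (\<Sum>n<N. t n))) \<longlonglongrightarrow> W * (suminf t - suminf t)"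
    by (intro tendsto_intros summable_LIMSEQ sumt)
  hence null: "(\<lambda>N. W * (suminf t - (\<Sum>n<N. t n))) \<longlonglongrightarrow> 0" by simp
  have "(\<lambda>N. (\<Sum>m. w m * (\<Sum>n. f n * u m ^ n)) - (\<Sum>n<N. f n * (\<Sum>m. w m * u m ^ n))) \<longlonglongrightarrow> 0"
    by (rule Lim_null_comparison[OF _ null]) (use tail in \<open>auto intro: always_eventually\<close>)
  from tendsto_diff[OF tendsto_const[of "\<Sum>m. w m * (\<Sum>n. f n * u m ^ n)"] this]
  show ?thesis unfolding sums_def by simp
qed

lemma sing_nonneg: "sing m \<ge> 0"
  by (simp add: sing_def)

definition moment :: "nat \<Rightarrow> complex" where
  "moment k = (\<Sum>m. chi m / of_real (sing m) ^ k)"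

lemma summable_moment:
  assumes "k > 0" shows "summable (\<lambda>m. norm (chi m / of_real (sing m) ^ k))"
proof (rule summable_comparison_test'[OF summable_inverse_sing_power[OF assms], of 0])
  fix m
  have "norm (chi m) / sing m ^ k \<le> 1 / sing m ^ k"
    using norm_chi_le sing_nonneg by (intro divide_right_mono) auto
  thus "norm (norm (chi m / of_real (sing m) ^ k)) \<le> 1 / sing m ^ k"
    using sing_nonneg[of m] by (simp add: norm_divide norm_power)
qed

lemma norm_div_sing_le:
  fixes z :: complex
  assumes "norm z \<le> r * sing 1"
  shows "norm (z / of_real (sing m)) \<le> r"
proof (cases "m = 0")
  case True
  have "0 \<le> r * sing 1" using assms norm_ge_zero order_trans by blast
  hence "r \<ge> 0" using sing_pos[of 1] by (simp add: zero_le_mult_iff)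
  thus ?thesis using True by (simp add: sing_def)
next
  case False
  have r: "0 \<le> r * sing 1" using assms norm_ge_zero order_trans by blast
  hence "r \<ge> 0" using sing_pos[of 1] by (simp add: zero_le_mult_iff)
  have "sing 1 \<le> sing m" using False unfolding sing_def
    by (intro divide_right_mono power_mono mult_left_mono) auto
  hence "r * sing 1 \<le> r * sing m" using \<open>r \<ge> 0\<close> by (intro mult_left_mono)
  hence "norm z \<le> r * sing m" using assms by linarith
  thus ?thesis using sing_pos[of m] False by (simp add: norm_divide pos_divide_le_eq)
qed

lemma moment_series:
  fixes z :: complex and f :: "nat \<Rightarrow> complex"
  assumes "k > 0" "norm z \<le> r * sing 1" "summable (\<lambda>n. norm (f n) * r ^ n)"
  shows "(\<lambda>n. f n * moment (n + k) * z ^ n) sums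
     (\<Sum>m. chi m / of_real (sing m) ^ k * (\<Sum>n. f n * (z / of_real (sing m)) ^ n))"
proof -
  have "(\<lambda>n. f n * (\<Sum>m. chi m / of_real (sing m) ^ k * (z / of_real (sing m)) ^ n)) sums
     (\<Sum>m. chi m / of_real (sing m) ^ k * (\<Sum>n. f n * (z / of_real (sing m)) ^ n))"
    using norm_div_sing_le[OF assms(2)] summable_moment[OF assms(1)] assms(3) by (intro double_series_sums) auto
  also have "(\<lambda>n. f n * (\<Sum>m. chi m / of_real (sing m) ^ k * (z / of_real (sing m)) ^ n)) =
             (\<lambda>n. f n * moment (n + k) * z ^ n)"
  proof
    fix n
    have "(\<Sum>m. chi m / of_real (sing m) ^ k * (z / of_real (sing m)) ^ n) =
          (\<Sum>m. chi m / of_real (sing m) ^ (n + k) * z ^ n)"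
      by (simp add: power_divide power_add mult_ac)
    also have "\<dots> = moment (n + k) * z ^ n"
      unfolding moment_def using summable_norm_cancel[OF summable_moment[of "n + k"]] assms(1)
      by (intro suminf_mult2[symmetric]) auto
    finally show "f n * (\<Sum>m. chi m / of_real (sing m) ^ k * (z / of_real (sing m)) ^ n) = f n * moment (n + k) * z ^ n"
      by simp
  qed
  finally show ?thesis .
qed

lemma sing_1_gt_1: "sing 1 > 1"
proof -
  have "pi\<^sup>2 > 3\<^sup>2" using pi_gt3 by (intro power_strict_mono) auto
  thus ?thesis by (simp add: sing_def)
qed

lemma not_in_sings: fixes z :: complex shows "norm z < sing 1 \<Longrightarrow> z \<notin> sings"
proof
  assume "norm z < sing 1" "z \<in> sings"
  then obtain m where m: "m \<ge> 1" "z = of_real (sing m)" by (auto simp: sings_def)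
  have "sing 1 \<le> sing m" using m(1) unfolding sing_def
    by (intro divide_right_mono power_mono mult_left_mono) auto
  thus False using \<open>norm z < sing 1\<close> m sing_pos[of m] by simp
qed

text \<open>
  Expand every partial fraction into a geometric series in \<open>p / sing m\<close>.
\<close>

lemma moment_geometric_sums:
  fixes v :: complex
  assumes "norm (6 * v ^ 2) < sing 1"
  shows "(\<lambda>n. 6 ^ Suc n * moment (Suc n) * v ^ (2 * n + 1)) sums (sqrt 3 * sin (2 * v) / cos (3 * v))"
proof -
  define p where "p = 6 * v ^ 2"
  define r where "r = norm p / sing 1"
  have r: "r < 1" "r \<ge> 0" using assms sing_1_gt_1 by (auto simp: r_def p_def)
  have pr: "norm p \<le> r * sing 1" using sing_1_gt_1 by (simp add: r_def)
  have "(\<lambda>n. 1 * moment (n + 1) * p ^ n) sums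
     (\<Sum>m. chi m / of_real (sing m) ^ 1 * (\<Sum>n. 1 * (p / of_real (sing m)) ^ n))"
    by (rule moment_series[OF _ pr]) (use r in auto)
  also have "(\<lambda>m. chi m / of_real (sing m) ^ 1 * (\<Sum>n. 1 * (p / of_real (sing m)) ^ n)) =
       (\<lambda>m. chi m / (of_real (sing m) - p))"
  proof
    fix m
    show "chi m / of_real (sing m) ^ 1 * (\<Sum>n. 1 * (p / of_real (sing m)) ^ n) = chi m / (of_real (sing m) - p)"
    proof (cases "m = 0")
      case False
      have "norm (p / of_real (sing m)) < 1" using norm_div_sing_le[OF pr, of m] r by simp
      hence "(\<Sum>n. 1 * (p / of_real (sing m)) ^ n) = 1 / (1 - p / of_real (sing m))"
        by (simp add: suminf_geometric)
      thus ?thesis using sing_pos[of m] False by (simp add: right_diff_distrib)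
    qed auto
  qed
  finally have "(\<lambda>n. 6 * v * (1 * moment (n + 1) * p ^ n)) sums (6 * v * (\<Sum>m. chi m / (of_real (sing m) - p)))"
    by (rule sums_mult)
  also have "6 * v * (\<Sum>m. chi m / (of_real (sing m) - p)) = (\<Sum>m. 6 * v * (chi m / (of_real (sing m) - p)))"
    using not_in_sings[OF assms] unfolding p_def
    by (intro suminf_mult[symmetric] summable_norm_cancel[OF summable_chi_div_sing_minus])
  also have "\<dots> = sqrt 3 * sin (2 * v) / cos (3 * v)"
    unfolding p_def by (rule sums_unique[OF sin_cos_partial_fractions[OF not_in_sings[OF assms]], symmetric])
  also have "(\<lambda>n. 6 * v * (1 * moment (n + 1) * p ^ n)) = (\<lambda>n. 6 ^ Suc n * moment (Suc n) * v ^ (2 * n + 1))"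
  proof
    fix n
    have "v ^ (2 * n + 1) = v * (v ^ 2) ^ n" by (simp add: power_mult)
    moreover have "6 * v * (1 * moment (n + 1) * p ^ n) = 6 ^ Suc n * moment (Suc n) * (v * (v ^ 2) ^ n)"
      by (simp add: p_def power_mult_distrib)
    ultimately show "6 * v * (1 * moment (n + 1) * p ^ n) = 6 ^ Suc n * moment (Suc n) * v ^ (2 * n + 1)"
      by (simp only:)
  qed
  finally show ?thesis .
qed

text \<open>
  The Taylor series at \<open>0\<close> of \<open>(e\<^sup>v - e\<^sup>5\<^sup>v) / (1 + e\<^sup>6\<^sup>v)\<close>, which is \<open>sin 2v / cos 3v\<close> at an
  imaginary argument, up to a constant.
\<close>

definition euler_fps :: "complex fps" where
  "euler_fps = Abs_fps (\<lambda>k. if odd k then (- 6) ^ Suc (k div 2) * moment (Suc (k div 2)) / sqrt 3 else 0)"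

lemma euler_fps_sums:
  fixes v :: complex
  assumes "norm (6 * v ^ 2) < sing 1"
  shows "(\<lambda>k. fps_nth euler_fps k * v ^ k) sums ((exp v - exp (5 * v)) / (1 + exp (6 * v)))"
proof -
  have n: "norm (6 * (\<i> * v) ^ 2) < sing 1" using assms by (simp add: power_mult_distrib norm_mult norm_power)
  have "(\<lambda>n. \<i> / sqrt 3 * (6 ^ Suc n * moment (Suc n) * (\<i> * v) ^ (2 * n + 1))) sums
        (\<i> / sqrt 3 * (sqrt 3 * sin (2 * (\<i> * v)) / cos (3 * (\<i> * v))))"
    by (rule sums_mult[OF moment_geometric_sums[OF n]])
  also have "(\<lambda>n. \<i> / sqrt 3 * (6 ^ Suc n * moment (Suc n) * (\<i> * v) ^ (2 * n + 1))) =
     (\<lambda>n. fps_nth euler_fps (2 * n + 1) * v ^ (2 * n + 1))"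
  proof
    fix n
    have "\<i> * (\<i> * v) ^ (2 * n + 1) = (\<i> * \<i> ^ (2 * n + 1)) * v ^ (2 * n + 1)"
      by (simp only: power_mult_distrib mult.assoc)
    also have "\<i> * \<i> ^ (2 * n + 1) = \<i> ^ (2 * Suc n)" by simp
    also have "\<i> ^ (2 * Suc n) = (- 1) ^ Suc n" unfolding power_mult by simp
    finally have *: "\<i> * (\<i> * v) ^ (2 * n + 1) = (- 1) ^ Suc n * v ^ (2 * n + 1)" .
    have "\<i> / sqrt 3 * (c * M * y) = c * M / sqrt 3 * (\<i> * y)" for c M y by simp
    hence "\<i> / sqrt 3 * (6 ^ Suc n * moment (Suc n) * (\<i> * v) ^ (2 * n + 1)) =
        6 ^ Suc n * moment (Suc n) / sqrt 3 * ((- 1) ^ Suc n * v ^ (2 * n + 1))" by (simp only: *)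
    also have "\<dots> = ((- 1) ^ Suc n * 6 ^ Suc n) * moment (Suc n) / sqrt 3 * v ^ (2 * n + 1)"
      by (simp only: times_divide_eq_right times_divide_eq_left mult_ac)
    also have "(- 1) ^ Suc n * 6 ^ Suc n = (- 6 :: complex) ^ Suc n" unfolding power_mult_distrib[symmetric] by simp
    finally show "\<i> / sqrt 3 * (6 ^ Suc n * moment (Suc n) * (\<i> * v) ^ (2 * n + 1)) =
        fps_nth euler_fps (2 * n + 1) * v ^ (2 * n + 1)"
      by (simp add: euler_fps_def del: power_Suc)
  qed
  also have "\<i> / sqrt 3 * (sqrt 3 * sin (2 * (\<i> * v)) / cos (3 * (\<i> * v))) = (exp v - exp (5 * v)) / (1 + exp (6 * v))"
  proof -
    define a where "a = exp v"
    have a: "a \<noteq> 0" "exp (2 * v) = a ^ 2" "exp (3 * v) = a ^ 3" "exp (5 * v) = a ^ 5" "exp (6 * v) = a ^ 6"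
    proof -
      have *: "exp (of_nat n * v) = a ^ n" for n by (simp add: a_def exp_of_nat_mult)
      show "a \<noteq> 0" by (simp add: a_def)
      show "exp (2 * v) = a ^ 2" "exp (3 * v) = a ^ 3" "exp (5 * v) = a ^ 5" "exp (6 * v) = a ^ 6"
        using *[of 2] *[of 3] *[of 5] *[of 6] by simp_all
    qed
    have s: "sin (2 * (\<i> * v)) = (1 / a ^ 2 - a ^ 2) / (2 * \<i>)"
    proof -
      have i: "\<i> * (2 * (\<i> * v)) = - (2 * v)" by (simp add: complex_eq_iff)
      show ?thesis unfolding sin_exp_eq i using a(2) by (simp add: exp_minus inverse_eq_divide)
    qed
    have c: "cos (3 * (\<i> * v)) = (1 / a ^ 3 + a ^ 3) / 2"
    proof -
      have i: "\<i> * (3 * (\<i> * v)) = - (3 * v)" by (simp add: complex_eq_iff)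
      show ?thesis unfolding cos_exp_eq i using a(3) by (simp add: exp_minus inverse_eq_divide)
    qed
    have "\<i> / sqrt 3 * (sqrt 3 * sin (2 * (\<i> * v)) / cos (3 * (\<i> * v))) = (1 / a ^ 2 - a ^ 2) / (1 / a ^ 3 + a ^ 3)"
    proof -
      have *: "\<i> / S * (S * (x / (2 * \<i>)) / (y / 2)) = x / y" if "S \<noteq> 0" for S x y :: complex
        using that by simp
      show ?thesis unfolding s c by (rule *) simp
    qed
    also have "\<dots> = (a ^ 3 * (1 / a ^ 2 - a ^ 2)) / (a ^ 3 * (1 / a ^ 3 + a ^ 3))" using a(1) by simp
    also have "a ^ 3 * (1 / a ^ 2 - a ^ 2) = a - a ^ 5"
    proof -
      have "a ^ 3 * (1 / a ^ 2) = a" using a(1) by (simp add: power3_eq_cube power2_eq_square)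
      thus ?thesis using power_add[of a 3 2] by (simp add: right_diff_distrib)
    qed
    also have "a ^ 3 * (1 / a ^ 3 + a ^ 3) = 1 + a ^ 6" 
    proof -
      have "a ^ 3 * (1 / a ^ 3) = 1" using a(1) by simp
      thus ?thesis using power_add[of a 3 3] by (simp add: distrib_left)
    qed
    finally show ?thesis unfolding a(4,5) a_def[symmetric] .
  qed
  finally have "(\<lambda>n. fps_nth euler_fps (2 * n + 1) * v ^ (2 * n + 1)) sums ((exp v - exp (5 * v)) / (1 + exp (6 * v)))" .
  also have "?this \<longleftrightarrow> ?thesis"
  proof (rule sums_mono_reindex)
    show "strict_mono (\<lambda>n::nat. 2 * n + 1)" by (auto simp: strict_mono_def)
    fix k :: nat assume k: "k \<notin> range (\<lambda>n. 2 * n + 1)"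
    have "even k"
    proof (rule ccontr)
      assume "odd k"
      then obtain b where "k = 2 * b + 1" by (rule oddE)
      thus False using k by blast
    qed
    thus "fps_nth euler_fps k * v ^ k = 0" by (simp add: euler_fps_def)
  qed
  finally show ?thesis .
qed

lemma has_fps_expansion_of_sums:
  fixes f :: "complex \<Rightarrow> complex"
  assumes "d > 0" "\<And>v. norm v < d \<Longrightarrow> (\<lambda>k. fps_nth F k * v ^ k) sums f v"
  shows "f has_fps_expansion F"
  unfolding has_fps_expansion_def
proof
  define z :: complex where "z = of_real (d / 2)"
  have z: "norm z = d / 2" using assms(1) by (simp add: z_def)
  have "summable (\<lambda>n. fps_nth F n * z ^ n)"
    using sums_summable[OF assms(2)[of z]] z assms(1) by simp
  from conv_radius_geI[OF this] have "conv_radius (fps_nth F) \<ge> ereal (d / 2)" by (simp only: z)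
  moreover have "ereal (d / 2) > 0" using assms(1) by simp
  ultimately show "fps_conv_radius F > 0"
    unfolding fps_conv_radius_def by (rule less_le_trans[rotated])
  have "\<forall>\<^sub>F z in nhds 0. z \<in> ball (0 :: complex) d"
    using assms(1) by (intro eventually_nhds_in_open) auto
  thus "\<forall>\<^sub>F z in nhds 0. eval_fps F z = f z"
  proof eventually_elim
    case (elim z)
    thus ?case unfolding eval_fps_def using sums_unique[OF assms(2)[of z]] by simp
  qed
qed

lemma euler_fps_equation: "euler_fps * (1 + E 6) = E 1 - E 5"
proof -
  define d where "d = (1 / 6 :: real)"
  have "(\<lambda>v. (exp v - exp (5 * v)) / (1 + exp (6 * v))) has_fps_expansion euler_fps"
  proof (rule has_fps_expansion_of_sums[of d])
    fix v :: complex assume v: "norm v < d"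
    have "norm v * norm v \<le> 1 / 6 * (1 / 6)" using v by (intro mult_mono) (auto simp: d_def)
    hence "norm (6 * v ^ 2) < sing 1" using sing_1_gt_1 by (simp add: norm_mult norm_power power2_eq_square)
    thus "(\<lambda>k. fps_nth euler_fps k * v ^ k) sums ((exp v - exp (5 * v)) / (1 + exp (6 * v)))"
      by (rule euler_fps_sums)
  qed (simp add: d_def)
  hence "(\<lambda>v. (exp v - exp (5 * v)) / (1 + exp (6 * v)) * (1 + exp (6 * v))) has_fps_expansion euler_fps * (1 + E 6)"
    by (intro fps_expansion_intros)
  moreover have "(\<lambda>v. exp v - exp (5 * v)) has_fps_expansion (E 1 - E 5)"
    by (intro fps_expansion_intros)
  moreover have "\<forall>\<^sub>F v in nhds 0. (exp v - exp (5 * v)) / (1 + exp (6 * v)) * (1 + exp (6 * v)) = exp v - exp (5 * v :: complex)"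
  proof -
    have "((\<lambda>v. 1 + exp (6 * v) :: complex) \<longlongrightarrow> 1 + exp (6 * 0)) (nhds 0)" by (intro tendsto_intros filterlim_ident)
    hence "\<forall>\<^sub>F v in nhds 0. 1 + exp (6 * v) \<noteq> (0 :: complex)" by (rule tendsto_imp_eventually_ne) simp
    thus ?thesis by eventually_elim simp
  qed
  hence "(\<lambda>v. (exp v - exp (5 * v)) / (1 + exp (6 * v)) * (1 + exp (6 * v))) has_fps_expansion euler_fps * (1 + E 6)
      \<longleftrightarrow> (\<lambda>v. exp v - exp (5 * v)) has_fps_expansion euler_fps * (1 + E 6)"
    by (intro has_fps_expansion_cong) auto
  ultimately show ?thesis using fps_expansion_unique_complex by blast
qed

lemma KZ_F_nth_moment:
  "fps_nth KZ_F n = 2 * sqrt 3 * fact (2 * n + 2) / (4 ^ Suc n * fact (Suc n)) * moment (Suc n)"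
proof -
  have "fps_nth KZ_F n = (- 1 / 24) ^ Suc n / fact (Suc n) * fact (2 * n + 2) * 6 * ((- 6) ^ Suc n * moment (Suc n) / sqrt 3)"
    using KZ_F_nth_via_quotient[OF euler_fps_equation] by (simp add: euler_fps_def del: fact_Suc)
  also have "\<dots> = ((- 1 / 24) ^ Suc n * (- 6) ^ Suc n) * fact (2 * n + 2) / fact (Suc n) * moment (Suc n) * (6 / sqrt 3)"
    by (simp del: fact_Suc power_Suc)
  also have "(- 1 / 24) ^ Suc n * (- 6) ^ Suc n = (1 / 4 ^ Suc n :: complex)"
    unfolding power_mult_distrib[symmetric] by (simp add: power_divide del: power_Suc)
  also have "6 / sqrt 3 = 2 * sqrt 3" by (simp add: field_simps)
  finally show ?thesis by (simp del: fact_Suc power_Suc)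
qed

lemma fact_double_le: "fact (2 * k) \<le> 4 ^ k * fact k * (fact k :: real)"
proof -
  have "fact k * fact (2 * k - k) * (2 * k choose k) = (fact (2 * k) :: nat)"
    by (rule binomial_fact_lemma) simp
  hence "fact (2 * k) = fact k * fact k * (2 * k choose k)" by simp
  also have "\<dots> \<le> fact k * fact k * 2 ^ (2 * k)" by (intro mult_left_mono binomial_le_pow2) simp
  also have "(2 :: nat) ^ (2 * k) = 4 ^ k" by (simp add: power_mult)
  finally have "fact (2 * k) \<le> fact k * fact k * (4 ^ k :: nat)" .
  hence "real (fact (2 * k)) \<le> real (fact k * fact k * 4 ^ k)" by (rule of_nat_mono)
  thus ?thesis by (simp add: mult_ac)
qed

text \<open>
  The moments are bounded, so the growth is that of \<open>(2n + 2)! / (4\<^sup>n n!)\<close>, which is of the order of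
  \<open>n!\<close> up to geometric factors.
\<close>

lemma gevrey1_KZ_F: "gevrey1 KZ_F"
proof -
  define M where "M = (\<Sum>m. 1 / sing m)"
  have M: "M \<ge> 0" unfolding M_def by (intro suminf_nonneg summable_inverse_sing) (simp add: sing_nonneg)
  have mom: "norm (moment (Suc n)) \<le> M" for n
    unfolding moment_def M_def
  proof (rule norm_suminf_le)
    fix m
    show "norm (chi m / of_real (sing m) ^ Suc n) \<le> 1 / sing m"
    proof (cases "m = 0")
      case False
      have "1 \<le> real m ^ 2" using False by simp
      hence s: "sing m \<ge> 1" using sing_ge[of m] by linarith
      hence "sing m ^ 1 \<le> sing m ^ Suc n" by (intro power_increasing) auto
      hence "norm (chi m) / sing m ^ Suc n \<le> 1 / sing m"
        using s norm_chi_le[of m] by (intro frac_le) auto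
      thus ?thesis using s by (simp add: norm_divide norm_power norm_mult)
    qed (simp add: sing_def)
  qed (rule summable_inverse_sing)
  have bound: "norm (fps_nth KZ_F n) \<le> (2 * sqrt 3 * M + 1) * 2 ^ n * fact n" for n
  proof -
    define Q where "Q = fact (2 * n + 2) / (4 ^ Suc n * fact (Suc n) :: real)"
    have "Q \<le> fact (Suc n)"
      using fact_double_le[of "Suc n"] by (simp add: Q_def divide_le_eq mult_ac del: fact_Suc power_Suc)
    also have "(fact (Suc n) :: real) \<le> 2 ^ n * fact n"
    proof -
      have "Suc n \<le> 2 ^ n" by (rule Suc_leI) (rule less_exp)
      hence "real (Suc n) \<le> 2 ^ n" by (metis of_nat_le_iff of_nat_numeral of_nat_power)
      thus ?thesis unfolding fact_Suc by (intro mult_right_mono) auto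
    qed
    finally have Q: "Q \<le> 2 ^ n * fact n" .
    have Q0: "Q \<ge> 0" by (simp add: Q_def)
    have "fps_nth KZ_F n = of_real (2 * sqrt 3 * Q) * moment (Suc n)"
      unfolding KZ_F_nth_moment Q_def by (simp del: fact_Suc power_Suc)
    hence "norm (fps_nth KZ_F n) = 2 * sqrt 3 * Q * norm (moment (Suc n))"
      using Q0 by (simp add: norm_mult)
    also have "\<dots> \<le> 2 * sqrt 3 * (2 ^ n * fact n) * M"
      using mom[of n] Q Q0 M by (intro mult_mono) auto
    also have "\<dots> \<le> (2 * sqrt 3 * M + 1) * (2 ^ n * fact n)" by (simp add: algebra_simps)
    finally show ?thesis by (simp add: mult.assoc)
  qed
  show ?thesis unfolding gevrey1_def
    by (rule exI[of _ 2], rule exI[of _ "2 * sqrt 3 * M + 1"]) (use bound M in \<open>auto intro: add_nonneg_pos\<close>)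
qed

text \<open>
  After division by \<open>n!\<close> the coefficients of a fixed \<open>m\<close> are binomial; this is where the exponent
  \<open>-5/2\<close> comes from.
\<close>

lemma borel_coefficient:
  "complex_of_real (2 * sqrt 3) * fact (2 * Suc n + 2) / (4 ^ Suc (Suc n) * fact (Suc (Suc n))) / fact n
     = complex_of_real (3 * sqrt 3 / 2) * ((- 1) ^ n * ((- 5 / 2) gchoose n))"
proof (induction n)
  case 0
  show ?case by (simp add: fact_numeral)
next
  case (Suc n)
  have g: "of_nat (Suc n) * ((- 5 / 2 :: complex) gchoose Suc n) = (- 5 / 2 - of_nat n) * ((- 5 / 2) gchoose n)"
    using gbinomial_mult_1[of "- 5 / 2 :: complex" n] by (simp add: algebra_simps)
  have f: "(fact (2 * Suc (Suc n) + 2) :: complex) = (2 * (of_nat n + 3)) * (2 * of_nat n + 5) * fact (2 * Suc n + 2)"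
    by (simp add: algebra_simps)
  have f2: "(fact (Suc (Suc (Suc n))) :: complex) = (of_nat n + 3) * fact (Suc (Suc n))"
    by (simp add: algebra_simps)
  have nz: "(of_nat n + 3 :: complex) \<noteq> 0" "(of_nat (Suc n) :: complex) \<noteq> 0"
  proof -
    have "of_nat (n + 3) \<noteq> (0 :: complex)" unfolding of_nat_eq_0_iff by simp
    thus "(of_nat n + 3 :: complex) \<noteq> 0" by simp
    show "(of_nat (Suc n) :: complex) \<noteq> 0" unfolding of_nat_eq_0_iff by simp
  qed
  have "complex_of_real (2 * sqrt 3) * fact (2 * Suc (Suc n) + 2) / (4 ^ Suc (Suc (Suc n)) * fact (Suc (Suc (Suc n)))) / fact (Suc n)
     = (complex_of_real (2 * sqrt 3) * fact (2 * Suc n + 2) / (4 ^ Suc (Suc n) * fact (Suc (Suc n))) / fact n) *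
       ((2 * (of_nat n + 3)) * (2 * of_nat n + 5) / (4 * (of_nat n + 3) * of_nat (Suc n)))"
    unfolding f f2 fact_Suc[of n] power_Suc[of 4 "Suc (Suc n)"] of_nat_mult
    by (simp only: times_divide_eq_right times_divide_eq_left divide_divide_eq_left mult_ac)
  also have "(2 * (of_nat n + 3)) * (2 * of_nat n + 5) / (4 * (of_nat n + 3) * of_nat (Suc n)) 
     = ((5 / 2 + of_nat n) / of_nat (Suc n) :: complex)"
  proof -
    have "2 * a * (2 * b + 5) / (4 * a * s) = (5 / 2 + b) / s" if "a \<noteq> 0" for a b s :: complex
      using that by (cases "s = 0") (simp_all add: field_simps)
    thus ?thesis using nz(1) by blast
  qed
  also have "complex_of_real (2 * sqrt 3) * fact (2 * Suc n + 2) / (4 ^ Suc (Suc n) * fact (Suc (Suc n))) / fact n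
      * ((5 / 2 + of_nat n) / of_nat (Suc n)) = 
      complex_of_real (3 * sqrt 3 / 2) * ((- 1) ^ Suc n * (((- 5 / 2 - of_nat n) * ((- 5 / 2) gchoose n)) / of_nat (Suc n)))"
  proof -
    have "(- 5 / 2 - of_nat n :: complex) = - (5 / 2 + of_nat n)" by simp
    moreover have "C * (s * g) * (x / S) = C * ((- 1) * s * ((- x * g) / S))" for C s g x S :: complex by simp
    ultimately show ?thesis unfolding Suc.IH power_Suc[of "- 1" n] by (simp only:)
  qed
  also have "((- 5 / 2 - of_nat n) * ((- 5 / 2 :: complex) gchoose n)) / of_nat (Suc n) = (- 5 / 2) gchoose Suc n"
    unfolding g[symmetric] using nz(2) by simp
  finally show ?case .
qed

text \<open>
  Interchanging the sums over \<open>n\<close> and \<open>m\<close> leaves, for every \<open>m\<close>, the binomial series of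
  \<open>(1 - z / sing m)\<^sup>-\<^sup>5\<^sup>/\<^sup>2\<close>.
\<close>

lemma eval_fps_borel_transform_KZ_F:
  assumes "norm z < sing 1"
  shows "eval_fps (borel_transform KZ_F) z = branch_sum principal_root z"
proof -
  define r where "r = norm z / sing 1"
  have r: "r < 1" "r \<ge> 0" using assms sing_1_gt_1 by (auto simp: r_def)
  have zr: "norm z \<le> r * sing 1" using sing_1_gt_1 by (simp add: r_def)
  define f where "f = (\<lambda>n. (- 1) ^ n * ((- 5 / 2 :: complex) gchoose n))"
  have gen: "(\<lambda>n. f n * u ^ n) sums ((1 - u) powr (- 5 / 2))" if "norm u < 1" for u
  proof -
    have "(\<lambda>n. ((- 5 / 2) gchoose n) * (- u) ^ n) sums (1 + - u) powr (- 5 / 2)"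
      using that by (intro gen_binomial_complex) auto
    thus ?thesis by (simp add: f_def power_minus[of u] mult_ac)
  qed
  have "summable (\<lambda>n. norm (f n * of_real r ^ n))"
  proof (rule powser_insidea)
    define q where "q = (1 + r) / 2"
    have q: "norm (of_real q :: complex) < 1" "norm (of_real r :: complex) < norm (of_real q :: complex)"
      unfolding norm_of_real using r by (auto simp: q_def)
    show "summable (\<lambda>n. f n * of_real q ^ n)" using sums_summable[OF gen[OF q(1)]] .
    show "norm (of_real r :: complex) < norm (of_real q :: complex)" by (rule q(2))
  qed
  hence sf: "summable (\<lambda>n. norm (f n) * r ^ n)" using r by (simp add: norm_mult norm_power)
  have base: "(\<lambda>n. f n * moment (n + 2) * z ^ n) sums
     (\<Sum>m. chi m / of_real (sing m) ^ 2 * (\<Sum>n. f n * (z / of_real (sing m)) ^ n))"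
    by (rule moment_series[OF _ zr sf]) simp
  have "(\<lambda>n. 3 * sqrt 3 / 2 * (f n * moment (n + 2) * z ^ n)) sums
     (3 * sqrt 3 / 2 * (\<Sum>m. chi m / of_real (sing m) ^ 2 * (\<Sum>n. f n * (z / of_real (sing m)) ^ n)))"
    by (rule sums_mult[OF base])
  also have "(\<lambda>n. 3 * sqrt 3 / 2 * (f n * moment (n + 2) * z ^ n)) = (\<lambda>n. fps_nth (borel_transform KZ_F) n * z ^ n)"
  proof
    fix n
    have "fps_nth (borel_transform KZ_F) n = complex_of_real (2 * sqrt 3) * fact (2 * Suc n + 2) / (4 ^ Suc (Suc n) * fact (Suc (Suc n))) / fact n * moment (n + 2)"
      unfolding borel_transform_def fps_nth_Abs_fps Suc_eq_plus1[symmetric] KZ_F_nth_moment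
      by (simp del: fact_Suc power_Suc add: mult_ac)
    thus "3 * sqrt 3 / 2 * (f n * moment (n + 2) * z ^ n) = fps_nth (borel_transform KZ_F) n * z ^ n"
      unfolding borel_coefficient f_def by simp
  qed
  also have "3 * sqrt 3 / 2 * (\<Sum>m. chi m / of_real (sing m) ^ 2 * (\<Sum>n. f n * (z / of_real (sing m)) ^ n))
      = (\<Sum>m. 3 * sqrt 3 / 2 * (chi m / of_real (sing m) ^ 2 * (\<Sum>n. f n * (z / of_real (sing m)) ^ n)))"
  proof (rule suminf_mult[symmetric])
    show "summable (\<lambda>m. chi m / of_real (sing m) ^ 2 * (\<Sum>n. f n * (z / of_real (sing m)) ^ n))"
    proof (rule summable_comparison_test'[OF summable_mult2[OF summable_moment[of 2]], of 0 _ "suminf (\<lambda>n. norm (f n) * r ^ n)"])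
      fix m
      have "norm (\<Sum>n. f n * (z / of_real (sing m)) ^ n) \<le> suminf (\<lambda>n. norm (f n) * r ^ n)"
      proof (rule norm_suminf_le)
        fix n show "norm (f n * (z / of_real (sing m)) ^ n) \<le> norm (f n) * r ^ n"
          unfolding norm_mult norm_power using norm_div_sing_le[OF zr, of m]
          by (intro mult_left_mono power_mono) auto
      qed (rule sf)
      thus "norm (chi m / of_real (sing m) ^ 2 * (\<Sum>n. f n * (z / of_real (sing m)) ^ n))
         \<le> norm (chi m / of_real (sing m) ^ 2) * suminf (\<lambda>n. norm (f n) * r ^ n)"
        unfolding norm_mult by (intro mult_left_mono) auto
    qed auto
  qed
  also have "\<dots> = branch_sum principal_root z"
    unfolding branch_sum_def
  proof (rule suminf_cong)
    fix m
    show "3 * sqrt 3 / 2 * (chi m / of_real (sing m) ^ 2 * (\<Sum>n. f n * (z / of_real (sing m)) ^ n)) =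
       3 * sqrt 3 / 2 * chi m * sqrt (sing m) / principal_root m z ^ 5"
    proof (cases "m = 0")
      case False
      hence s: "sing m > 0" using sing_pos by simp
      define u where "u = z / of_real (sing m)"
      have u: "norm u < 1" using norm_div_sing_le[OF zr, of m] r by (simp add: u_def)
      hence u1: "1 - u \<noteq> 0" by auto
      have "principal_root m z = csqrt (of_real (sing m) * (1 - u))"
        using s by (simp add: principal_root_def u_def right_diff_distrib)
      also have "\<dots> = of_real (sqrt (sing m)) * csqrt (1 - u)" by (rule csqrt_of_real_mult[OF s])
      finally have "principal_root m z ^ 5 = of_real (sqrt (sing m)) ^ 5 * csqrt (1 - u) ^ 5"
        by (simp add: power_mult_distrib)
      also have "complex_of_real (sqrt (sing m)) ^ 5 = of_real (sing m) ^ 2 * of_real (sqrt (sing m))"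
      proof -
        have "sqrt (sing m) ^ (2 * 2 + 1) = (sqrt (sing m) ^ 2) ^ 2 * sqrt (sing m)"
          unfolding power_add power_mult by simp
        hence "sqrt (sing m) ^ 5 = sing m ^ 2 * sqrt (sing m)" using s by simp
        thus ?thesis by (metis of_real_mult of_real_power)
      qed
      also have "csqrt (1 - u) ^ 5 = (1 - u) powr (5 / 2)"
      proof -
        have "csqrt (1 - u) ^ 5 = exp (of_nat 5 * (Ln (1 - u) / 2))"
          unfolding exp_of_nat_mult csqrt_exp_Ln[OF u1] ..
        thus ?thesis using u1 by (simp add: powr_def)
      qed
      finally have p: "principal_root m z ^ 5 = of_real (sing m) ^ 2 * of_real (sqrt (sing m)) * (1 - u) powr (5 / 2)" .
      have "(\<Sum>n. f n * u ^ n) = (1 - u) powr (- 5 / 2)" using sums_unique[OF gen[OF u]] by simp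
      also have "\<dots> = 1 / (1 - u) powr (5 / 2)" 
        using powr_minus[of "1 - u" "5 / 2"] by (simp add: inverse_eq_divide)
      finally show ?thesis unfolding p u_def[symmetric] using s by simp
    qed simp
  qed
  finally show ?thesis unfolding eval_fps_def by (rule sums_unique[symmetric])
qed

lemma resurgent_outside_sings_KZ_F: "resurgent_outside sings KZ_F"
proof (rule resurgent_outside_sings)
  have "\<forall>\<^sub>F z in nhds 0. z \<in> ball (0 :: complex) (sing 1)"
    using sing_1_gt_1 by (intro eventually_nhds_in_open) auto
  thus "\<forall>\<^sub>F z in nhds 0. eval_fps (borel_transform KZ_F) z = branch_sum principal_root z"
    by eventually_elim (auto intro: eval_fps_borel_transform_KZ_F)
qed (rule gevrey1_KZ_F)

section \<open>Laplace integrals along rays\<close>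

lemma set_integrable_of_real:
  assumes "set_integrable M A f"
  shows "set_integrable M A (\<lambda>x. complex_of_real (f x))"
proof -
  have "integrable M (\<lambda>x. complex_of_real (indicator A x *\<^sub>R f x))"
    using assms by (intro integrable_of_real) (simp add: set_integrable_def)
  thus ?thesis by (simp add: set_integrable_def scaleR_conv_of_real)
qed

text \<open>
  Dominated convergence for series, in the form used throughout: it is enough to dominate the partial
  sums, not the sum of the absolute values.
\<close>

lemma set_integral_dominated_sums:
  fixes f :: "nat \<Rightarrow> real \<Rightarrow> complex"
  assumes "\<And>n. set_integrable lborel A (f n)" "set_integrable lborel A g" "A \<in> sets borel"
    and "\<And>x. x \<in> A \<Longrightarrow> (\<lambda>n. f n x) sums F x" "\<And>N x. x \<in> A \<Longrightarrow> norm (\<Sum>n<N. f n x) \<le> g x"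
  shows "set_integrable lborel A F" "(\<lambda>n. LINT x:A|lborel. f n x) sums (LINT x:A|lborel. F x)"
proof -
  define s where "s = (\<lambda>N x. indicator A x *\<^sub>R (\<Sum>n<N. f n x))"
  define h where "h = (\<lambda>x. indicator A x *\<^sub>R F x)"
  have si: "integrable lborel (s N)" for N
  proof -
    have "integrable lborel (\<lambda>x. \<Sum>n<N. indicator A x *\<^sub>R f n x)"
      using assms(1) by (intro Bochner_Integration.integrable_sum) (simp add: set_integrable_def)
    thus ?thesis by (simp add: s_def scaleR_sum_right)
  qed
  hence sm: "s N \<in> borel_measurable lborel" for N by (rule borel_measurable_integrable)
  have lim: "(\<lambda>N. s N x) \<longlonglongrightarrow> h x" for x
    using assms(4)[of x] by (cases "x \<in> A") (auto simp: s_def h_def sums_def)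
  hence hm: "h \<in> borel_measurable lborel"
    using sm borel_measurable_LIMSEQ_metric by blast
  have bd: "norm (s N x) \<le> indicator A x *\<^sub>R g x" for N x
    using assms(5)[of x N] by (cases "x \<in> A") (auto simp: s_def)
  have gi: "integrable lborel (\<lambda>x. indicator A x *\<^sub>R g x)" using assms(2) by (simp add: set_integrable_def)
  have "integrable lborel h"
    by (rule integrable_dominated_convergence[where s = s, OF hm sm gi]) (use lim bd in auto)
  thus "set_integrable lborel A F" by (simp add: set_integrable_def h_def)
  have "(\<lambda>N. integral\<^sup>L lborel (s N)) \<longlonglongrightarrow> integral\<^sup>L lborel h"
    by (rule integral_dominated_convergence[where s = s, OF hm sm gi]) (use lim bd in auto)
  moreover have "integral\<^sup>L lborel (s N) = (\<Sum>n<N. LINT x:A|lborel. f n x)" for N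
  proof -
    have "integral\<^sup>L lborel (s N) = (\<integral>x. (\<Sum>n<N. indicator A x *\<^sub>R f n x) \<partial>lborel)"
      by (simp add: s_def scaleR_sum_right)
    also have "\<dots> = (\<Sum>n<N. LINT x:A|lborel. f n x)"
      unfolding set_lebesgue_integral_def using assms(1)
      by (intro Bochner_Integration.integral_sum) (simp add: set_integrable_def)
    finally show ?thesis .
  qed
  ultimately show "(\<lambda>n. LINT x:A|lborel. f n x) sums (LINT x:A|lborel. F x)"
    by (simp add: sums_def set_lebesgue_integral_def h_def)
qed

lemma laplace_power_real:
  fixes s a :: real
  assumes "s > 0" "a > 0"
  shows "set_integrable lborel {0<..} (\<lambda>r. r powr (s - 1) * exp (- (a * r)))"
    and "(LINT r:{0<..}|lborel. r powr (s - 1) * exp (- (a * r))) = Gamma s * a powr (- s)"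
proof -
  define f where "f = (\<lambda>t::real. indicator {0..} t * t powr (s - 1) / exp t)"
  define g where "g = (\<lambda>r::real. indicator {0<..} r *\<^sub>R (r powr (s - 1) * exp (- (a * r))))"
  have "has_bochner_integral lborel f (Gamma s)"
  proof (rule has_bochner_integral_nn_integral)
    show "(\<integral>\<^sup>+ x. ennreal (f x) \<partial>lborel) = ennreal (Gamma s)"
      using Gamma_conv_nn_integral_real[OF assms(1)] by (simp add: f_def)
    show "0 \<le> Gamma s" using assms(1) by (simp add: Gamma_real_pos less_imp_le)
  qed (auto simp: f_def)
  hence "has_bochner_integral lborel (\<lambda>x. f (0 + a * x)) (Gamma s /\<^sub>R \<bar>a\<bar>)"
    using lborel_has_bochner_integral_real_affine_iff[of a f "Gamma s" 0] assms(2) by simp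
  also have "(\<lambda>x. f (0 + a * x)) = (\<lambda>x. a powr (s - 1) * g x)"
  proof
    fix x :: real
    show "f (0 + a * x) = a powr (s - 1) * g x"
      using assms(2) by (cases "x = 0") (auto simp: f_def g_def indicator_def powr_mult exp_minus field_simps zero_le_mult_iff)
  qed
  finally have "has_bochner_integral lborel (\<lambda>x. a powr (1 - s) * (a powr (s - 1) * g x)) (a powr (1 - s) * (Gamma s /\<^sub>R \<bar>a\<bar>))"
    by (rule has_bochner_integral_mult_right)
  also have "(\<lambda>x. a powr (1 - s) * (a powr (s - 1) * g x)) = g"
    using assms(2) by (simp add: mult.assoc[symmetric] flip: powr_add)
  also have "a powr (1 - s) * (Gamma s /\<^sub>R \<bar>a\<bar>) = Gamma s * a powr (- s)"
    using assms(2) by (simp add: powr_diff powr_minus field_simps)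
  finally have *: "has_bochner_integral lborel g (Gamma s * a powr (- s))" .
  show "set_integrable lborel {0<..} (\<lambda>r. r powr (s - 1) * exp (- (a * r)))"
    using * by (simp add: set_integrable_def g_def has_bochner_integral_iff)
  show "(LINT r:{0<..}|lborel. r powr (s - 1) * exp (- (a * r))) = Gamma s * a powr (- s)"
    using * by (simp add: set_lebesgue_integral_def g_def has_bochner_integral_iff)
qed

lemma set_integrable_laplace_bound:
  fixes f :: "real \<Rightarrow> complex"
  assumes "s > 0" "b > 0" "f \<in> borel_measurable borel"
    and "\<And>r. r > 0 \<Longrightarrow> norm (f r) \<le> C * (r powr (s - 1) * exp (- (b * r)))"
  shows "set_integrable lborel {0<..} f"
proof (rule set_integrable_bound)
  show "set_integrable lborel {0<..} (\<lambda>r. C * (r powr (s - 1) * exp (- (b * r))))"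
    by (intro set_integrable_mult_right laplace_power_real assms)
  show "set_borel_measurable lborel {0<..} f"
    unfolding set_borel_measurable_def using assms(3) by measurable
  show "AE x in lborel. x \<in> {0<..} \<longrightarrow> norm (f x) \<le> norm (C * (x powr (s - 1) * exp (- (b * x))))"
    using assms(4) by (intro always_eventually) (auto intro!: order_trans[OF _ abs_ge_self])
qed

text \<open>
  Euler's integral for complex frequency. Write \<open>z = a + h\<close> with \<open>a\<close> real and expand \<open>e\<^sup>-\<^sup>h\<^sup>r\<close>; the
  resulting binomial series converges if \<open>norm h < a\<close>, and every \<open>z\<close> in the right half-plane has such
  an \<open>a\<close>.
\<close>

lemma laplace_power:
  fixes z :: complex and s :: real
  assumes "s > 0" "Re z > 0"
  shows "set_integrable lborel {0<..} (\<lambda>r. of_real (r powr (s - 1)) * exp (- (of_real r * z)))"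
    and "(LINT r:{0<..}|lborel. of_real (r powr (s - 1)) * exp (- (of_real r * z))) = of_real (Gamma s) * z powr (- of_real s)"
proof -
  \<comment> \<open>the circle with centre \<open>a\<close> and radius \<open>a\<close> contains every \<open>z\<close> in the half-plane once \<open>a > (norm z)\<^sup>2 / (2 * Re z)\<close>\<close>
  define a where "a = (norm z)\<^sup>2 / Re z"
  have z0: "z \<noteq> 0" using assms(2) by auto
  have a: "a > 0" using assms(2) z0 by (simp add: a_def)
  define h where "h = z - of_real a"
  have "(norm h)\<^sup>2 < a\<^sup>2"
  proof -
    have "(norm h)\<^sup>2 = (norm z)\<^sup>2 - 2 * a * Re z + a\<^sup>2"
      by (simp add: h_def cmod_power2 power2_diff algebra_simps)
    also have "a * Re z = (norm z)\<^sup>2" using assms(2) by (simp add: a_def)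
    hence "(norm z)\<^sup>2 - 2 * a * Re z + a\<^sup>2 = a\<^sup>2 - (norm z)\<^sup>2" by simp
    finally show ?thesis using z0 by simp
  qed
  hence h: "norm h < a" using a by (simp add: power2_less_imp_less)
  define f where "f = (\<lambda>k r. (- h) ^ k / fact k * of_real (r powr (s + real k - 1) * exp (- (a * r))))"
  define g where "g = (\<lambda>r. r powr (s - 1) * exp (- ((a - norm h) * r)))"
  define F where "F = (\<lambda>r. of_real (r powr (s - 1)) * exp (- (of_real r * z)))"
  have fi: "set_integrable lborel {0<..} (f k)" for k
    unfolding f_def using laplace_power_real(1)[of "s + real k" a] a assms(1)
    by (intro set_integrable_mult_right set_integrable_of_real) auto
  have fk: "f k r = of_real (r powr (s - 1) * exp (- (a * r))) * ((- (of_real r * h)) ^ k / fact k)" if "r > 0" for k r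
  proof -
    have "s + real k - 1 = (s - 1) + real k" by simp
    hence "r powr (s + real k - 1) = r powr (s - 1) * r ^ k" using that by (simp only: powr_add powr_realpow)
    moreover have "(- (of_real r * h)) ^ k = of_real r ^ k * (- h) ^ k" by (simp flip: power_mult_distrib)
    ultimately show ?thesis by (simp add: f_def)
  qed
  have gi: "set_integrable lborel {0<..} g" unfolding g_def using h assms(1) by (intro laplace_power_real) auto
  have sums: "(\<lambda>k. f k r) sums F r" if "r \<in> {0<..}" for r
  proof -
    have r: "r > 0" using that by simp
    have "(\<lambda>k. (- (of_real r * h)) ^ k / fact k) sums exp (- (of_real r * h))"
      using exp_converges[of "- (of_real r * h)"] by (simp add: scaleR_conv_of_real divide_inverse mult.commute)
    hence "(\<lambda>k. of_real (r powr (s - 1) * exp (- (a * r))) * ((- (of_real r * h)) ^ k / fact k)) sums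
       (of_real (r powr (s - 1) * exp (- (a * r))) * exp (- (of_real r * h)))" by (rule sums_mult)
    also have "of_real (r powr (s - 1) * exp (- (a * r))) * exp (- (of_real r * h)) = F r"
    proof -
      have "- (of_real r * z) = of_real (- (a * r)) + - (of_real r * h)" by (simp add: h_def algebra_simps)
      thus ?thesis unfolding F_def by (simp only: exp_add exp_of_real of_real_mult mult.assoc)
    qed
    finally show ?thesis by (simp add: fk[OF r])
  qed
  have bound: "norm (\<Sum>k<N. f k r) \<le> g r" if "r \<in> {0<..}" for N r
  proof -
    have r: "r > 0" using that by simp
    have e: "(\<lambda>k. (r * norm h) ^ k / fact k) sums exp (r * norm h)"
      using exp_converges[of "r * norm h"] by (simp add: divide_inverse mult.commute)
    have "norm (\<Sum>k<N. f k r) \<le> (\<Sum>k<N. norm (f k r))" by (rule norm_sum)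
    also have "\<dots> = (\<Sum>k<N. r powr (s - 1) * exp (- (a * r)) * ((r * norm h) ^ k / fact k))"
      using r by (intro sum.cong refl) (simp add: fk[OF r] norm_mult norm_divide norm_power power_mult_distrib)
    also have "\<dots> = r powr (s - 1) * exp (- (a * r)) * (\<Sum>k<N. (r * norm h) ^ k / fact k)"
      by (simp add: sum_distrib_left)
    also have "\<dots> \<le> r powr (s - 1) * exp (- (a * r)) * exp (r * norm h)"
    proof (rule mult_left_mono)
      show "(\<Sum>k<N. (r * norm h) ^ k / fact k) \<le> exp (r * norm h)"
        unfolding sums_unique[OF e] using r by (intro sum_le_suminf sums_summable[OF e]) auto
    qed auto
    also have "\<dots> = g r" by (simp add: g_def mult.assoc flip: exp_add) (simp add: algebra_simps)
    finally show ?thesis .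
  qed
  note dom = set_integral_dominated_sums[of "{0<..}" f g F, OF fi gi _ sums bound]
  show "set_integrable lborel {0<..} (\<lambda>r. of_real (r powr (s - 1)) * exp (- (of_real r * z)))"
    using dom(1) by (simp add: F_def)
  have int_f: "(LINT r:{0<..}|lborel. f k r) = of_real (Gamma s * a powr (- s)) * (((- of_real s) gchoose k) * (h / of_real a) ^ k)" for k
  proof -
    have "(LINT r:{0<..}|lborel. f k r) = (- h) ^ k / fact k * of_real (LINT r:{0<..}|lborel. r powr (s + real k - 1) * exp (- (a * r)))"
      unfolding f_def set_integral_mult_right set_integral_complex_of_real ..
    also have "(LINT r:{0<..}|lborel. r powr (s + real k - 1) * exp (- (a * r))) = Gamma (s + real k) * a powr (- (s + real k))"
      using a assms(1) by (intro laplace_power_real) auto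
    also have "Gamma (s + real k) = pochhammer s k * Gamma s"
      using pochhammer_Gamma[of s k] assms(1) Gamma_real_pos[OF assms(1)] by (simp add: field_simps nonpos_Ints_def)
    also have "a powr (- (s + real k)) = a powr (- s) / a ^ k"
      using a by (simp add: powr_diff powr_realpow)
    also have "(- h) ^ k / fact k * of_real (pochhammer s k * Gamma s * (a powr (- s) / a ^ k)) =
      of_real (Gamma s * a powr (- s)) * (((- 1) ^ k * pochhammer (of_real s) k / fact k) * (h / of_real a) ^ k)"
      using a by (simp add: pochhammer_of_real power_divide power_minus[of h])
    also have "(- 1) ^ k * pochhammer (of_real s :: complex) k / fact k = ((- of_real s) gchoose k)"
      by (simp add: gbinomial_pochhammer)
    finally show ?thesis .
  qed
  have "norm (h / of_real a) < 1" using h a by (simp add: norm_divide)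
  hence "(\<lambda>k. ((- of_real s) gchoose k) * (h / of_real a) ^ k) sums (1 + h / of_real a) powr (- of_real s)"
    by (rule gen_binomial_complex)
  hence "(\<lambda>k. LINT r:{0<..}|lborel. f k r) sums (of_real (Gamma s * a powr (- s)) * (1 + h / of_real a) powr (- of_real s))"
    unfolding int_f by (rule sums_mult)
  moreover have "(\<lambda>k. LINT r:{0<..}|lborel. f k r) sums (LINT r:{0<..}|lborel. F r)"
    by (rule dom(2)) auto
  ultimately have "(LINT r:{0<..}|lborel. F r) = of_real (Gamma s * a powr (- s)) * (1 + h / of_real a) powr (- of_real s)"
    by (rule sums_unique2[symmetric])
  also have "\<dots> = of_real (Gamma s) * (of_real a powr (- of_real s) * (1 + h / of_real a) powr (- of_real s))"
    using a by (simp add: powr_of_real[symmetric])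
  also have "of_real a powr (- of_real s) * (1 + h / of_real a) powr (- of_real s) = (of_real a * (1 + h / of_real a)) powr (- of_real s)"
    using a by (intro powr_times_real_left[symmetric]) auto
  also have "of_real a * (1 + h / of_real a) = z" using a by (simp add: h_def field_simps)
  finally show "(LINT r:{0<..}|lborel. of_real (r powr (s - 1)) * exp (- (of_real r * z))) = of_real (Gamma s) * z powr (- of_real s)"
    by (simp add: F_def)
qed

text \<open>
  Rotating the ray of integration does not change the value of Euler's integral. For the principal
  powers this amounts to the arguments of \<open>x\<close> and \<open>cis \<theta>\<close> adding up without crossing the cut.
\<close>

lemma ray_power:
  assumes "\<bar>\<theta>\<bar> < pi / 2" "Re x > 0"
  shows "cis (s * \<theta>) * (cis \<theta> * x) powr (- of_real s) = x powr (- of_real s)"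
proof -
  have x: "x \<noteq> 0" using assms by auto
  have "\<bar>Im (Ln x)\<bar> < pi / 2" using Re_Ln_pos_lt[OF x] assms(2) by simp
  hence "Ln (exp (\<i> * of_real \<theta> + Ln x)) = \<i> * of_real \<theta> + Ln x"
    using assms(1) by (intro Ln_exp) auto
  hence L: "Ln (cis \<theta> * x) = \<i> * of_real \<theta> + Ln x"
    using x by (simp add: exp_add cis_conv_exp)
  have "cis (s * \<theta>) * exp (- of_real s * (\<i> * of_real \<theta> + Ln x)) = exp (- of_real s * Ln x)"
    unfolding cis_conv_exp exp_add[symmetric] by (rule arg_cong[of _ _ exp]) (simp add: algebra_simps)
  thus ?thesis using x by (simp add: powr_def L)
qed

lemma Gamma_half_plus: "Gamma (real j + 1 / 2) * 4 ^ j * fact j = fact (2 * j) * sqrt pi"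
proof (induction j)
  case 0
  show ?case by (simp add: Gamma_one_half_real)
next
  case (Suc j)
  have "real j + 1 / 2 \<notin> \<int>\<^sub>\<le>\<^sub>0" by (auto simp: nonpos_Ints_def)
  hence "Gamma (real j + 1 / 2 + 1) = (real j + 1 / 2) * Gamma (real j + 1 / 2)" by (rule Gamma_plus1)
  moreover have "real (Suc j) + 1 / 2 = real j + 1 / 2 + 1" by simp
  ultimately have G: "Gamma (real (Suc j) + 1 / 2) = (real j + 1 / 2) * Gamma (real j + 1 / 2)" by (simp only:)
  have "Gamma (real (Suc j) + 1 / 2) * 4 ^ Suc j * fact (Suc j) =
     (real j + 1 / 2) * 4 * (real j + 1) * (Gamma (real j + 1 / 2) * 4 ^ j * fact j)"
    unfolding G by (simp add: algebra_simps)
  also have "\<dots> = (2 * real j + 2) * (2 * real j + 1) * (fact (2 * j) * sqrt pi)"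
    unfolding Suc.IH by (simp add: algebra_simps)
  also have "\<dots> = fact (2 * Suc j) * sqrt pi" by (simp add: algebra_simps)
  finally show ?case .
qed

lemma Gamma_three_halves_plus: "Gamma (real j + 3 / 2) * 4 ^ j * fact j * 2 = fact (2 * j + 1) * sqrt pi"
proof -
  have "real j + 1 / 2 \<notin> \<int>\<^sub>\<le>\<^sub>0" by (auto simp: nonpos_Ints_def)
  hence "Gamma (real j + 1 / 2 + 1) = (real j + 1 / 2) * Gamma (real j + 1 / 2)" by (rule Gamma_plus1)
  moreover have "real j + 3 / 2 = real j + 1 / 2 + 1" by simp
  ultimately have G: "Gamma (real j + 3 / 2) = (real j + 1 / 2) * Gamma (real j + 1 / 2)" by (simp only:)
  have "Gamma (real j + 3 / 2) * 4 ^ j * fact j * 2 = (2 * real j + 1) * (Gamma (real j + 1 / 2) * 4 ^ j * fact j)"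
    unfolding G by (simp add: algebra_simps)
  also have "\<dots> = fact (2 * j + 1) * sqrt pi" unfolding Gamma_half_plus by (simp add: algebra_simps)
  finally show ?thesis .
qed

text \<open>
  The exponential series is integrated term by term. The majorant \<open>e\<close> to a multiple of \<open>sqrt r\<close> is
  absorbed by half of the exponential decay.
\<close>

lemma ray_exp_sqrt:
  fixes c x :: complex
  assumes s: "s > 0" and th: "\<bar>\<theta>\<bar> < pi / 2" and x: "Re x > 0" "Re (cis \<theta> * x) > 0"
  shows "set_integrable lborel {0<..} (\<lambda>r. of_real (r powr (s - 1)) * exp (- (of_real r * (cis \<theta> * x))) * exp (c * (cis (\<theta> / 2) * of_real (sqrt r))))"
    and "(\<lambda>k. c ^ k / fact k * of_real (Gamma (s + real k / 2)) * x powr (- of_real (s + real k / 2))) sums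
         (cis (s * \<theta>) * (LINT r:{0<..}|lborel. of_real (r powr (s - 1)) * exp (- (of_real r * (cis \<theta> * x))) * exp (c * (cis (\<theta> / 2) * of_real (sqrt r)))))"
proof -
  define z where "z = cis \<theta> * x"
  define b where "b = Re z"
  have b: "b > 0" using x by (simp add: b_def z_def)
  define d where "d = c * cis (\<theta> / 2)"
  have nd: "norm d = norm c" by (simp add: d_def norm_mult)
  define f where "f = (\<lambda>k r. d ^ k / fact k * (of_real (r powr (s + real k / 2 - 1)) * exp (- (of_real r * z))))"
  define g where "g = (\<lambda>r. exp ((norm c)\<^sup>2 / (2 * b)) * (r powr (s - 1) * exp (- ((b / 2) * r))))"
  define F where "F = (\<lambda>r. of_real (r powr (s - 1)) * exp (- (of_real r * z)) * exp (c * (cis (\<theta> / 2) * of_real (sqrt r))))"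
  have fi: "set_integrable lborel {0<..} (f k)" for k
    unfolding f_def using s b by (intro set_integrable_mult_right laplace_power) (auto simp: b_def)
  have fk: "f k r = of_real (r powr (s - 1)) * exp (- (of_real r * z)) * ((d * of_real (sqrt r)) ^ k / fact k)" if "r > 0" for k r
  proof -
    have "s + real k / 2 - 1 = (s - 1) + (1 / 2) * real k" by simp
    hence "r powr (s + real k / 2 - 1) = r powr (s - 1) * (r powr (1 / 2)) powr real k"
      by (simp only: powr_add powr_powr)
    also have "(r powr (1 / 2)) powr real k = sqrt r ^ k" using that by (simp add: powr_half_sqrt powr_realpow)
    finally show ?thesis by (simp add: f_def power_mult_distrib)
  qed
  have gi: "set_integrable lborel {0<..} g" unfolding g_def using b s by (intro set_integrable_mult_right laplace_power_real) auto
  have sums: "(\<lambda>k. f k r) sums F r" if "r \<in> {0<..}" for r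
  proof -
    have r: "r > 0" using that by simp
    have "(\<lambda>k. (d * of_real (sqrt r)) ^ k / fact k) sums exp (d * of_real (sqrt r))"
      using exp_converges[of "d * of_real (sqrt r)"] by (simp add: scaleR_conv_of_real divide_inverse mult.commute)
    from sums_mult[OF this, of "of_real (r powr (s - 1)) * exp (- (of_real r * z))"]
    show ?thesis by (simp add: fk[OF r] F_def d_def mult.assoc)
  qed
  have bound: "norm (\<Sum>k<N. f k r) \<le> g r" if "r \<in> {0<..}" for N r
  proof -
    have r: "r > 0" using that by simp
    have e: "(\<lambda>k. (norm c * sqrt r) ^ k / fact k) sums exp (norm c * sqrt r)"
      using exp_converges[of "norm c * sqrt r"] by (simp add: divide_inverse mult.commute)
    have "norm (\<Sum>k<N. f k r) \<le> (\<Sum>k<N. norm (f k r))" by (rule norm_sum)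
    also have "\<dots> = (\<Sum>k<N. r powr (s - 1) * exp (- (r * b)) * ((norm c * sqrt r) ^ k / fact k))"
      using r by (intro sum.cong refl) (simp add: fk[OF r] norm_mult norm_divide norm_power nd b_def)
    also have "\<dots> = r powr (s - 1) * exp (- (r * b)) * (\<Sum>k<N. (norm c * sqrt r) ^ k / fact k)"
      by (simp add: sum_distrib_left)
    also have "\<dots> \<le> r powr (s - 1) * exp (- (r * b)) * exp (norm c * sqrt r)"
    proof (rule mult_left_mono)
      show "(\<Sum>k<N. (norm c * sqrt r) ^ k / fact k) \<le> exp (norm c * sqrt r)"
        unfolding sums_unique[OF e] using r by (intro sum_le_suminf sums_summable[OF e]) auto
    qed auto
    also have "\<dots> \<le> r powr (s - 1) * exp (- (r * b)) * exp ((norm c)\<^sup>2 / (2 * b) + b / 2 * r)"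
    proof (intro mult_left_mono)
      have "0 \<le> (norm c - b * sqrt r)\<^sup>2" by simp
      hence "2 * b * (norm c * sqrt r) \<le> (norm c)\<^sup>2 + b\<^sup>2 * r"
        using r by (simp add: power2_diff power_mult_distrib algebra_simps)
      hence "norm c * sqrt r \<le> (norm c)\<^sup>2 / (2 * b) + b / 2 * r"
        using b by (simp add: field_simps power2_eq_square)
      thus "exp (norm c * sqrt r) \<le> exp ((norm c)\<^sup>2 / (2 * b) + b / 2 * r)" by simp
    qed auto
    also have "\<dots> = g r"
    proof -
      have "exp (- (r * b)) * exp ((norm c)\<^sup>2 / (2 * b) + b / 2 * r) = exp ((norm c)\<^sup>2 / (2 * b)) * exp (- ((b / 2) * r))"
        unfolding exp_add[symmetric] by (rule arg_cong[of _ _ exp]) (simp add: field_simps)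
      thus ?thesis by (simp add: g_def mult_ac)
    qed
    finally show ?thesis .
  qed
  note dom = set_integral_dominated_sums[of "{0<..}" f g F, OF fi gi _ sums bound]
  show "set_integrable lborel {0<..} (\<lambda>r. of_real (r powr (s - 1)) * exp (- (of_real r * (cis \<theta> * x))) * exp (c * (cis (\<theta> / 2) * of_real (sqrt r))))"
    using dom(1) by (simp add: F_def z_def)
  have int_f: "cis (s * \<theta>) * (LINT r:{0<..}|lborel. f k r) = c ^ k / fact k * of_real (Gamma (s + real k / 2)) * x powr (- of_real (s + real k / 2))" for k
  proof -
    have "(LINT r:{0<..}|lborel. f k r) = d ^ k / fact k * (of_real (Gamma (s + real k / 2)) * z powr (- of_real (s + real k / 2)))"
      unfolding f_def set_integral_mult_right using s b laplace_power(2)[of "s + real k / 2" z] by (simp add: b_def)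
    also have "d ^ k = c ^ k * cis (real k / 2 * \<theta>)"
    proof -
      have "cis (\<theta> / 2) ^ k = cis (real k / 2 * \<theta>)"
        unfolding Complex.DeMoivre by (rule arg_cong[of _ _ cis]) simp
      thus ?thesis by (simp add: d_def power_mult_distrib)
    qed
    finally have "cis (s * \<theta>) * (LINT r:{0<..}|lborel. f k r) = c ^ k / fact k * of_real (Gamma (s + real k / 2)) *
        ((cis (s * \<theta>) * cis (real k / 2 * \<theta>)) * z powr (- of_real (s + real k / 2)))" by (simp only: mult_ac times_divide_eq_left times_divide_eq_right)
    also have "cis (s * \<theta>) * cis (real k / 2 * \<theta>) = cis ((s + real k / 2) * \<theta>)" by (simp add: cis_mult algebra_simps)
    also have "cis ((s + real k / 2) * \<theta>) * z powr (- of_real (s + real k / 2)) = x powr (- of_real (s + real k / 2))"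
      unfolding z_def by (rule ray_power[OF th x(1)])
    finally show ?thesis .
  qed
  have "(\<lambda>k. cis (s * \<theta>) * (LINT r:{0<..}|lborel. f k r)) sums (cis (s * \<theta>) * (LINT r:{0<..}|lborel. F r))"
    by (intro sums_mult dom(2)) auto
  thus "(\<lambda>k. c ^ k / fact k * of_real (Gamma (s + real k / 2)) * x powr (- of_real (s + real k / 2))) sums
         (cis (s * \<theta>) * (LINT r:{0<..}|lborel. of_real (r powr (s - 1)) * exp (- (of_real r * (cis \<theta> * x))) * exp (c * (cis (\<theta> / 2) * of_real (sqrt r)))))"
    unfolding int_f by (simp add: F_def z_def)
qed

text \<open>
  The Laplace integral of \<open>p\<^sup>s\<^sup>-\<^sup>1 A(p\<^sup>1\<^sup>/\<^sup>2)\<close> along the ray of argument \<open>\<theta>\<close>, where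
  the square root of \<open>p = r e\<^sup>i\<^sup>\<theta>\<close> is the one of argument \<open>\<theta> / 2\<close>.
\<close>

definition ray_int :: "real \<Rightarrow> real \<Rightarrow> complex \<Rightarrow> (complex \<Rightarrow> complex) \<Rightarrow> complex" where
  "ray_int s \<theta> x A = cis (s * \<theta>) * (LINT r:{0<..}|lborel. of_real (r powr (s - 1)) * exp (- (of_real r * (cis \<theta> * x))) * A (cis (\<theta> / 2) * of_real (sqrt r)))"

lemma sums_odd_reindex:
  fixes f :: "nat \<Rightarrow> complex"
  assumes "f sums S" "\<And>k. even k \<Longrightarrow> f k = 0"
  shows "(\<lambda>j. f (2 * j + 1)) sums S"
proof -
  have "(\<lambda>n. f (2 * n + 1)) sums S \<longleftrightarrow> f sums S"
  proof (rule sums_mono_reindex)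
    show "strict_mono (\<lambda>n::nat. 2 * n + 1)" by (auto simp: strict_mono_def)
    fix k :: nat assume k: "k \<notin> range (\<lambda>n. 2 * n + 1)"
    have "even k"
    proof (rule ccontr)
      assume "odd k"
      then obtain b where "k = 2 * b + 1" by (rule oddE)
      thus False using k by blast
    qed
    thus "f k = 0" by (rule assms(2))
  qed
  thus ?thesis using assms(1) by simp
qed

lemma exp_sums: "(\<lambda>j. w ^ j / fact j) sums exp (w :: complex)"
  using exp_converges[of w] by (simp add: scaleR_conv_of_real divide_inverse mult.commute)

lemma powr_minus_add_nat:
  fixes x :: complex
  assumes "x \<noteq> 0"
  shows "x powr (- of_real (real j + a)) = x powr (- of_real a) * (1 / x) ^ j"
proof -
  have "- of_real (real j + a) = (- of_real a - of_nat j :: complex)" by simp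
  hence "x powr (- of_real (real j + a)) = x powr (- of_real a - of_nat j)" by (simp only:)
  also have "\<dots> = x powr (- of_real a) / x powr of_nat j" by (rule powr_diff)
  finally show ?thesis using assms by (simp add: powr_nat' power_one_over)
qed

text \<open>
  The difference over a ray and its mirror image leaves the odd powers of \<open>c\<close>, and by the duplication
  formula these sum to an exponential. Morally it is a Gaussian integral over the line that the two
  rays form in the variable \<open>p\<^sup>1\<^sup>/\<^sup>2\<close>.
\<close>

lemma ray_exp_pair:
  fixes c x :: complex
  assumes th: "\<bar>\<theta>\<bar> < pi / 2" and x: "Re x > 0" "Re (cis \<theta> * x) > 0" "Re (cis (- \<theta>) * x) > 0"
  shows "ray_int 1 \<theta> x (\<lambda>v. exp (c * v)) - ray_int 1 (- \<theta>) x (\<lambda>v. exp (- c * v))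
           = c * of_real (sqrt pi) * x powr (- (3 / 2)) * exp (c\<^sup>2 / (4 * x))"
proof -
  have x0: "x \<noteq> 0" using x by auto
  have th': "\<bar>- \<theta>\<bar> < pi / 2" using th by simp
  have S: "(\<lambda>k. c ^ k / fact k * of_real (Gamma (s + real k / 2)) * x powr (- of_real (s + real k / 2))) sums ray_int s \<theta> x (\<lambda>v. exp (c * v))"
      "(\<lambda>k. (- c) ^ k / fact k * of_real (Gamma (s + real k / 2)) * x powr (- of_real (s + real k / 2))) sums ray_int s (- \<theta>) x (\<lambda>v. exp (- c * v))"
    if "s > 0" for s
    unfolding ray_int_def using ray_exp_sqrt(2)[OF that th x(1,2), of c] ray_exp_sqrt(2)[OF that th' x(1,3), of "- c"] by simp_all
  define T where "T = (\<lambda>s k. of_real (Gamma (s + real k / 2)) * x powr (- of_real (s + real k / 2)))"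
  have "(\<lambda>k. c ^ k / fact k * T 1 k - (- c) ^ k / fact k * T 1 k) sums
      (ray_int 1 \<theta> x (\<lambda>v. exp (c * v)) - ray_int 1 (- \<theta>) x (\<lambda>v. exp (- c * v)))"
    unfolding T_def mult.assoc[symmetric] by (intro sums_diff S) auto
  hence "(\<lambda>j. c ^ (2 * j + 1) / fact (2 * j + 1) * T 1 (2 * j + 1) - (- c) ^ (2 * j + 1) / fact (2 * j + 1) * T 1 (2 * j + 1)) sums
      (ray_int 1 \<theta> x (\<lambda>v. exp (c * v)) - ray_int 1 (- \<theta>) x (\<lambda>v. exp (- c * v)))"
    by (rule sums_odd_reindex) simp
  also have "(\<lambda>j. c ^ (2 * j + 1) / fact (2 * j + 1) * T 1 (2 * j + 1) - (- c) ^ (2 * j + 1) / fact (2 * j + 1) * T 1 (2 * j + 1)) =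
     (\<lambda>j. c * of_real (sqrt pi) * x powr (- (3 / 2)) * ((c\<^sup>2 / (4 * x)) ^ j / fact j))"
  proof
    fix j
    have G: "Gamma (real j + 3 / 2) = fact (2 * j + 1) * sqrt pi / (4 ^ j * fact j * 2)"
      using Gamma_three_halves_plus[of j] by (simp add: field_simps del: fact_Suc)
    have e: "1 + real (2 * j + 1) / 2 = real j + 3 / 2" by (simp add: field_simps)
    have pw: "x powr (- of_real (real j + 3 / 2)) = x powr (- (3 / 2)) * (1 / x) ^ j"
      using powr_minus_add_nat[OF x0, of j "3 / 2"] by simp
    have T: "T 1 (2 * j + 1) = fact (2 * j + 1) * of_real (sqrt pi) / (4 ^ j * fact j * 2) * (x powr (- (3 / 2)) * (1 / x) ^ j)"
      unfolding T_def e G pw by simp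
    have cc: "(- c) ^ (2 * j + 1) = - (c ^ (2 * j + 1))" by simp
    have ca: "C / f * (f * p / (4 ^ j * g * 2) * q) - - C / f * (f * p / (4 ^ j * g * 2) * q) = C * p * q / (4 ^ j * g)"
      if "f \<noteq> 0" for C f p g q :: complex using that by (simp add: mult_ac)
    have "c ^ (2 * j + 1) / fact (2 * j + 1) * T 1 (2 * j + 1) - (- c) ^ (2 * j + 1) / fact (2 * j + 1) * T 1 (2 * j + 1)
       = c ^ (2 * j + 1) * of_real (sqrt pi) * (x powr (- (3 / 2)) * (1 / x) ^ j) / (4 ^ j * fact j)"
      unfolding T cc by (rule ca) (rule fact_nonzero)
    also have "\<dots> = c * (c\<^sup>2) ^ j * of_real (sqrt pi) * (x powr (- (3 / 2)) * (1 / x) ^ j) / (4 ^ j * fact j)"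
      by (simp add: power_mult)
    also have "c * (c\<^sup>2) ^ j * of_real (sqrt pi) * (x powr (- (3 / 2)) * (1 / x) ^ j) / (4 ^ j * fact j)
       = c * of_real (sqrt pi) * x powr (- (3 / 2)) * ((c\<^sup>2 / (4 * x)) ^ j / fact j)"
      by (simp add: power_divide power_mult_distrib mult_ac)
    finally show "c ^ (2 * j + 1) / fact (2 * j + 1) * T 1 (2 * j + 1) - (- c) ^ (2 * j + 1) / fact (2 * j + 1) * T 1 (2 * j + 1)
        = c * of_real (sqrt pi) * x powr (- (3 / 2)) * ((c\<^sup>2 / (4 * x)) ^ j / fact j)" .
  qed
  finally show "ray_int 1 \<theta> x (\<lambda>v. exp (c * v)) - ray_int 1 (- \<theta>) x (\<lambda>v. exp (- c * v))
           = c * of_real (sqrt pi) * x powr (- (3 / 2)) * exp (c\<^sup>2 / (4 * x))"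
    by (rule sums_unique2[OF _ sums_mult[OF exp_sums]])
qed

section \<open>Theta series as Laplace integrals\<close>

abbreviation root6 :: complex where "root6 \<equiv> complex_of_real (sqrt 6)"

lemma ray_int_sums:
  fixes h :: "nat \<Rightarrow> complex \<Rightarrow> complex"
  assumes s: "\<tau> < s" "Re (cis \<theta> * x) > 0"
    and int: "\<And>n. set_integrable lborel {0<..} (\<lambda>r. of_real (r powr (s - 1)) * exp (- (of_real r * (cis \<theta> * x))) * h n (cis (\<theta> / 2) * of_real (sqrt r)))"
    and sums: "\<And>r. r > 0 \<Longrightarrow> (\<lambda>n. h n (cis (\<theta> / 2) * of_real (sqrt r))) sums H (cis (\<theta> / 2) * of_real (sqrt r))"
    and bound: "\<And>N r. r > 0 \<Longrightarrow> norm (\<Sum>n<N. h n (cis (\<theta> / 2) * of_real (sqrt r))) \<le> C * r powr (- \<tau>)"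
  shows "set_integrable lborel {0<..} (\<lambda>r. of_real (r powr (s - 1)) * exp (- (of_real r * (cis \<theta> * x))) * H (cis (\<theta> / 2) * of_real (sqrt r)))"
    and "(\<lambda>n. ray_int s \<theta> x (h n)) sums ray_int s \<theta> x H"
proof -
  define f where "f = (\<lambda>n r. of_real (r powr (s - 1)) * exp (- (of_real r * (cis \<theta> * x))) * h n (cis (\<theta> / 2) * of_real (sqrt r)))"
  define F where "F = (\<lambda>r. of_real (r powr (s - 1)) * exp (- (of_real r * (cis \<theta> * x))) * H (cis (\<theta> / 2) * of_real (sqrt r)))"
  define g where "g = (\<lambda>r. C * (r powr (s - \<tau> - 1) * exp (- (Re (cis \<theta> * x) * r))))"
  have gi: "set_integrable lborel {0<..} g"
    unfolding g_def using s by (intro set_integrable_mult_right laplace_power_real) auto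
  have fi: "set_integrable lborel {0<..} (f n)" for n unfolding f_def by (rule int)
  have su: "(\<lambda>n. f n r) sums F r" if "r \<in> {0<..}" for r
    unfolding f_def F_def using that by (intro sums_mult sums) auto
  have bd: "norm (\<Sum>n<N. f n r) \<le> g r" if "r \<in> {0<..}" for N r
  proof -
    have r: "r > 0" using that by simp
    have "norm (\<Sum>n<N. f n r) = r powr (s - 1) * exp (- (Re (cis \<theta> * x) * r)) * norm (\<Sum>n<N. h n (cis (\<theta> / 2) * of_real (sqrt r)))"
      unfolding f_def sum_distrib_left[symmetric] by (simp add: norm_mult mult.commute)
    also have "\<dots> \<le> r powr (s - 1) * exp (- (Re (cis \<theta> * x) * r)) * (C * r powr (- \<tau>))"
      by (intro mult_left_mono bound r) auto
    also have "\<dots> = g r"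
    proof -
      have "r powr (s - \<tau> - 1) = r powr (s - 1) * r powr (- \<tau>)"
        unfolding powr_add[symmetric] by (rule arg_cong[of _ _ "\<lambda>u. r powr u"]) simp
      thus ?thesis by (simp add: g_def)
    qed
    finally show ?thesis .
  qed
  note dom = set_integral_dominated_sums[of "{0<..}" f g F, OF fi gi _ su bd]
  show "set_integrable lborel {0<..} (\<lambda>r. of_real (r powr (s - 1)) * exp (- (of_real r * (cis \<theta> * x))) * H (cis (\<theta> / 2) * of_real (sqrt r)))"
    using dom(1) by (simp add: F_def)
  have "(\<lambda>n. cis (s * \<theta>) * (LINT r:{0<..}|lborel. f n r)) sums (cis (s * \<theta>) * (LINT r:{0<..}|lborel. F r))"
    by (intro sums_mult dom(2)) auto
  thus "(\<lambda>n. ray_int s \<theta> x (h n)) sums ray_int s \<theta> x H"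
    by (simp add: ray_int_def f_def F_def)
qed

lemma ray_int_cmult: "ray_int s \<theta> x (\<lambda>w. c * h w) = c * ray_int s \<theta> x h"
proof -
  have "(LINT r:{0<..}|lborel. of_real (r powr (s - 1)) * exp (- (of_real r * (cis \<theta> * x))) * (c * h (cis (\<theta> / 2) * of_real (sqrt r))))
      = (LINT r:{0<..}|lborel. c * (of_real (r powr (s - 1)) * exp (- (of_real r * (cis \<theta> * x))) * h (cis (\<theta> / 2) * of_real (sqrt r))))"
    by (simp only: mult_ac)
  thus ?thesis unfolding ray_int_def by (simp add: mult_ac)
qed

text \<open>
  Bounded weights \<open>g\<close> together with their generating function \<open>A\<close> in \<open>e\<^sup>i\<^sup>v\<close>. The median sum
  needs the weights \<open>chi\<close>; the radial limits need \<open>chi\<close> twisted by a Gaussian phase.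
\<close>

locale theta_kernel =
  fixes g :: "nat \<Rightarrow> complex" and A :: "complex \<Rightarrow> complex"
  assumes norm_g: "norm (g n) \<le> 1" and g_0: "g 0 = 0"
    and kernel: "Im v > 0 \<Longrightarrow> (\<lambda>n. g n * exp (\<i> * of_nat n * v)) sums A v"
begin

text \<open>
  The geometric series, and \<open>1 / (e\<^sup>y - 1) \<le> 1 / y\<close>. Partial sums are bounded as well as the limit, which
  is what allows integration term by term up to \<open>v = 0\<close>.
\<close>

lemma norm_partial_kernel:
  assumes "Im v > 0"
  shows "norm (\<Sum>n<N. g n * exp (\<i> * of_nat n * v)) \<le> 1 / Im v"
proof -
  define q where "q = exp (- Im v)"
  have q: "0 < q" "q < 1" using assms by (simp_all add: q_def)
  have t: "norm (g n * exp (\<i> * of_nat n * v)) \<le> (if n = 0 then 0 else q ^ n)" for n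
  proof (cases "n = 0")
    case False
    have "norm (exp (\<i> * of_nat n * v)) = q ^ n"
      by (simp add: q_def flip: exp_of_nat_mult)
    thus ?thesis using norm_g[of n] q False by (simp add: norm_mult mult_left_le_one_le)
  qed (simp add: g_0)
  have "norm (\<Sum>n<N. g n * exp (\<i> * of_nat n * v)) \<le> (\<Sum>n<N. if n = 0 then 0 else q ^ n)"
    by (rule order_trans[OF norm_sum]) (intro sum_mono t)
  also have "\<dots> \<le> q / (1 - q)"
  proof (cases N)
    case (Suc M)
    have "(\<Sum>n<N. if n = 0 then 0 else q ^ n) = (\<Sum>n<M. q ^ Suc n)"
      unfolding Suc sum.lessThan_Suc_shift by simp
    also have "\<dots> = q * ((1 - q ^ M) / (1 - q))" using q by (simp add: sum_gp_strict flip: sum_distrib_left)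
    also have "\<dots> \<le> q * (1 / (1 - q))" using q by (intro mult_left_mono divide_right_mono) auto
    finally show ?thesis by simp
  qed (use q in auto)
  also have "\<dots> = 1 / (exp (Im v) - 1)" using assms by (simp add: q_def exp_minus field_simps)
  also have "\<dots> \<le> 1 / Im v"
  proof (rule divide_left_mono)
    show le: "Im v \<le> exp (Im v) - 1" using exp_ge_add_one_self[of "Im v"] by linarith
    show "0 < (exp (Im v) - 1) * Im v" using le assms by (intro mult_pos_pos) auto
  qed simp
  finally show ?thesis .
qed

lemma norm_kernel_le:
  assumes "Im v > 0"
  shows "norm (A v) \<le> 1 / Im v"
  using kernel[OF assms] norm_partial_kernel[OF assms] unfolding sums_def
  by (intro tendsto_upperbound[OF tendsto_norm]) auto

text \<open>
  The sign \<open>\<epsilon>\<close> chooses between \<open>v\<close> and \<open>-v\<close> so that the argument of \<open>A\<close> lies in the upper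
  half-plane: on the ray of negative argument it is the negative square root that does.
\<close>

lemma ray_kernel_sums:
  assumes s: "s > 0" "\<tau> < s" and th: "\<bar>\<theta>\<bar> < pi / 2" and x: "Re x > 0" "Re (cis \<theta> * x) > 0"
    and S: "Im (\<epsilon> * cis (\<theta> / 2)) > 0"
    and C: "\<And>r. r > 0 \<Longrightarrow> 1 / (Im (\<epsilon> * cis (\<theta> / 2)) * sqrt r / sqrt 6) \<le> C * r powr (- \<tau>)"
  shows "set_integrable lborel {0<..} (\<lambda>r. of_real (r powr (s - 1)) * exp (- (of_real r * (cis \<theta> * x))) *
            A (\<epsilon> * (cis (\<theta> / 2) * complex_of_real (sqrt r) / root6)))"
    and "(\<lambda>n. g n * ray_int s \<theta> x (\<lambda>w. exp (\<i> * of_nat n * \<epsilon> / root6 * w)))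
           sums ray_int s \<theta> x (\<lambda>w. A (\<epsilon> * (w / root6)))"
proof -
  define v where "v = (\<lambda>w. \<epsilon> * (w / root6))"
  define h where "h = (\<lambda>n w. g n * exp (\<i> * of_nat n * \<epsilon> / root6 * w))"
  have h: "h n w = g n * exp (\<i> * of_nat n * v w)" for n w
  proof -
    have "\<i> * of_nat n * v w = \<i> * of_nat n * \<epsilon> / root6 * w"
      by (simp add: v_def algebra_simps)
    thus ?thesis unfolding h_def by (simp only:)
  qed
  have Imv: "Im (v (cis (\<theta> / 2) * of_real (sqrt r))) = Im (\<epsilon> * cis (\<theta> / 2)) * sqrt r / sqrt 6" for r
  proof -
    have "v (cis (\<theta> / 2) * of_real (sqrt r)) = of_real (sqrt r / sqrt 6) * (\<epsilon> * cis (\<theta> / 2))"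
      by (simp add: v_def)
    moreover have "Im (of_real a * y) = Im y * a" for a y by simp
    ultimately show ?thesis by (simp only: times_divide_eq_right)
  qed
  have pos: "Im (v (cis (\<theta> / 2) * of_real (sqrt r))) > 0" if "r > 0" for r
    unfolding Imv using S that by (intro divide_pos_pos mult_pos_pos) auto
  have int: "set_integrable lborel {0<..} (\<lambda>r. of_real (r powr (s - 1)) * exp (- (of_real r * (cis \<theta> * x))) * h n (cis (\<theta> / 2) * of_real (sqrt r)))" for n
  proof -
    have "set_integrable lborel {0<..} (\<lambda>r. g n * (of_real (r powr (s - 1)) * exp (- (of_real r * (cis \<theta> * x))) * exp (\<i> * of_nat n * \<epsilon> / root6 * (cis (\<theta> / 2) * of_real (sqrt r)))))"
      by (intro set_integrable_mult_right ray_exp_sqrt(1)[OF s(1) th x])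
    thus ?thesis unfolding h_def by (simp only: mult_ac)
  qed
  have su: "(\<lambda>n. h n (cis (\<theta> / 2) * of_real (sqrt r))) sums A (v (cis (\<theta> / 2) * of_real (sqrt r)))" if "r > 0" for r
    unfolding h by (rule kernel[OF pos[OF that]])
  have bd: "norm (\<Sum>n<N. h n (cis (\<theta> / 2) * of_real (sqrt r))) \<le> C * r powr (- \<tau>)" if "r > 0" for N r
    unfolding h by (rule order_trans[OF norm_partial_kernel[OF pos[OF that]]]) (unfold Imv, rule C[OF that])
  note R = ray_int_sums[where H = "\<lambda>w. A (v w)", OF s(2) x(2) int su bd]
  show "set_integrable lborel {0<..} (\<lambda>r. of_real (r powr (s - 1)) * exp (- (of_real r * (cis \<theta> * x))) *
            A (\<epsilon> * (cis (\<theta> / 2) * complex_of_real (sqrt r) / root6)))"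
    using R(1) by (simp add: v_def)
  have "(\<lambda>n. ray_int s \<theta> x (h n)) = (\<lambda>n. g n * ray_int s \<theta> x (\<lambda>w. exp (\<i> * of_nat n * \<epsilon> / root6 * w)))"
    unfolding h_def by (simp add: ray_int_cmult)
  thus "(\<lambda>n. g n * ray_int s \<theta> x (\<lambda>w. exp (\<i> * of_nat n * \<epsilon> / root6 * w)))
           sums ray_int s \<theta> x (\<lambda>w. A (\<epsilon> * (w / root6)))"
    using R(2) by (simp add: v_def)
qed

context
  fixes \<theta> :: real and x :: complex
  assumes th: "0 < \<theta>" "\<theta> < pi / 2" and x: "Re x > 0" "Re (cis \<theta> * x) > 0" "Re (cis (- \<theta>) * x) > 0"
begin

lemma sin_half_pos: "sin (\<theta> / 2) > 0"
  using th by (intro sin_gt_zero) auto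

text \<open>
  Insert the generating function into the integral and integrate every exponential with
  \<open>ray_exp_pair\<close>. The scaling by the root of 6 matches \<open>p = 6 v\<^sup>2\<close>.
\<close>

lemma theta_representation:
  shows "set_integrable lborel {0<..} (\<lambda>r. exp (- (of_real r * (cis \<theta> * x))) * A (cis (\<theta> / 2) * complex_of_real (sqrt r) / root6))"
    and "set_integrable lborel {0<..} (\<lambda>r. exp (- (of_real r * (cis (- \<theta>) * x))) * A (- (cis (- \<theta> / 2) * complex_of_real (sqrt r) / root6)))"
    and "(\<lambda>n. of_nat n * g n * exp (- (of_nat n)\<^sup>2 / (24 * x)) * (\<i> * of_real (sqrt pi / sqrt 6) * x powr (- (3 / 2)))) sums
           (ray_int 1 \<theta> x (\<lambda>w. A (w / root6)) - ray_int 1 (- \<theta>) x (\<lambda>w. A (- (w / root6))))"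
proof -
  have th1: "\<bar>\<theta>\<bar> < pi / 2" "\<bar>- \<theta>\<bar> < pi / 2" using th by auto
  have S: "Im (1 * cis (\<theta> / 2)) = sin (\<theta> / 2)" "Im (- 1 * cis (- \<theta> / 2)) = sin (\<theta> / 2)" by simp_all
  have C: "1 / (sin (\<theta> / 2) * sqrt r / sqrt 6) \<le> sqrt 6 / sin (\<theta> / 2) * r powr (- (1 / 2))" if "r > 0" for r
    using that sin_half_pos by (simp add: powr_minus powr_half_sqrt field_simps)
  note R1 = ray_kernel_sums[where \<epsilon> = 1 and s = 1 and \<tau> = "1 / 2" and C = "sqrt 6 / sin (\<theta> / 2)", OF _ _ th1(1) x(1,2), unfolded S, OF _ _ sin_half_pos C]
  note R2 = ray_kernel_sums[where \<epsilon> = "- 1" and s = 1 and \<tau> = "1 / 2" and C = "sqrt 6 / sin (\<theta> / 2)", OF _ _ th1(2) x(1,3), unfolded S, OF _ _ sin_half_pos C]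
  have P: "of_real (r powr (1 - 1)) = (1 :: complex)" if "r \<in> {0<..}" for r :: real using that by simp
  show "set_integrable lborel {0<..} (\<lambda>r. exp (- (of_real r * (cis \<theta> * x))) * A (cis (\<theta> / 2) * complex_of_real (sqrt r) / root6))"
    by (rule iffD1[OF set_integrable_cong R1(1)]) (auto simp: P)
  show "set_integrable lborel {0<..} (\<lambda>r. exp (- (of_real r * (cis (- \<theta>) * x))) * A (- (cis (- \<theta> / 2) * complex_of_real (sqrt r) / root6)))"
    by (rule iffD1[OF set_integrable_cong R2(1)]) (auto simp: P)
  have "(\<lambda>n. g n * ray_int 1 \<theta> x (\<lambda>w. exp (\<i> * of_nat n * 1 / root6 * w)) -
         g n * ray_int 1 (- \<theta>) x (\<lambda>w. exp (\<i> * of_nat n * (- 1) / root6 * w))) sums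
      (ray_int 1 \<theta> x (\<lambda>w. A (1 * (w / root6))) - ray_int 1 (- \<theta>) x (\<lambda>w. A (- 1 * (w / root6))))"
    by (intro sums_diff R1(2) R2(2)) auto
  also have "(\<lambda>n. g n * ray_int 1 \<theta> x (\<lambda>w. exp (\<i> * of_nat n * 1 / root6 * w)) -
         g n * ray_int 1 (- \<theta>) x (\<lambda>w. exp (\<i> * of_nat n * (- 1) / root6 * w)))
       = (\<lambda>n. of_nat n * g n * exp (- (of_nat n)\<^sup>2 / (24 * x)) * (\<i> * of_real (sqrt pi / sqrt 6) * x powr (- (3 / 2))))"
  proof
    fix n
    define c where "c = \<i> * of_nat n / root6"
    have c2: "c\<^sup>2 / (4 * x) = - (of_nat n)\<^sup>2 / (24 * x)"
      by (simp add: c_def power_divide power_mult_distrib flip: of_real_power)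
    have "g n * ray_int 1 \<theta> x (\<lambda>w. exp (\<i> * of_nat n * 1 / root6 * w)) -
         g n * ray_int 1 (- \<theta>) x (\<lambda>w. exp (\<i> * of_nat n * (- 1) / root6 * w))
       = g n * (ray_int 1 \<theta> x (\<lambda>w. exp (c * w)) - ray_int 1 (- \<theta>) x (\<lambda>w. exp (- c * w)))"
      by (simp add: c_def right_diff_distrib)
    also have "\<dots> = of_nat n * g n * exp (- (of_nat n)\<^sup>2 / (24 * x)) * (\<i> * of_real (sqrt pi / sqrt 6) * x powr (- (3 / 2)))"
      unfolding ray_exp_pair[OF th1(1) x] c2 by (simp add: c_def)
    finally show "g n * ray_int 1 \<theta> x (\<lambda>w. exp (\<i> * of_nat n * 1 / root6 * w)) -
         g n * ray_int 1 (- \<theta>) x (\<lambda>w. exp (\<i> * of_nat n * (- 1) / root6 * w))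
       = of_nat n * g n * exp (- (of_nat n)\<^sup>2 / (24 * x)) * (\<i> * of_real (sqrt pi / sqrt 6) * x powr (- (3 / 2)))" .
  qed
  finally show "(\<lambda>n. of_nat n * g n * exp (- (of_nat n)\<^sup>2 / (24 * x)) * (\<i> * of_real (sqrt pi / sqrt 6) * x powr (- (3 / 2)))) sums
           (ray_int 1 \<theta> x (\<lambda>w. A (w / root6)) - ray_int 1 (- \<theta>) x (\<lambda>w. A (- (w / root6))))"
    by simp
qed

end

end

lemma power_div_fact_le_exp:
  fixes y :: real assumes "y \<ge> 0" shows "y ^ m / fact m \<le> exp y"
proof -
  have e: "(\<lambda>k. y ^ k / fact k) sums exp y"
    using exp_converges[of y] by (simp add: divide_inverse mult.commute)
  have "sum (\<lambda>k. y ^ k / fact k) {m} \<le> (\<Sum>k. y ^ k / fact k)"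
    using assms by (intro sum_le_suminf sums_summable[OF e]) auto
  thus ?thesis using sums_unique[OF e] by simp
qed

text \<open>
  The exponential dominates any power, which leaves a convergent \<open>1 / n\<^sup>2\<close>; at \<open>n = 0\<close> the
  latter is \<open>0\<close> by convention, whence the extra summand.
\<close>

lemma gaussian_le:
  fixes c :: real assumes "c > 0"
  shows "real n ^ k * exp (- (c * (real n)\<^sup>2)) \<le> (if n = 0 then 1 else 0) + fact (k + 1) / c ^ (k + 1) * inverse (real n ^ 2)"
proof (cases "n = 0")
  case True
  thus ?thesis by (cases k) auto
next
  case False
  define y where "y = c * (real n)\<^sup>2"
  have y: "y > 0" using assms False by (simp add: y_def)
  have "y ^ (k + 1) / fact (k + 1) \<le> exp y" using y by (intro power_div_fact_le_exp) auto
  hence "exp (- y) \<le> fact (k + 1) / y ^ (k + 1)" using y by (simp add: exp_minus field_simps del: fact_Suc power_Suc)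
  hence "real n ^ k * exp (- y) \<le> real n ^ k * (fact (k + 1) / y ^ (k + 1))" by (intro mult_left_mono) auto
  also have "\<dots> = fact (k + 1) / c ^ (k + 1) * (real n ^ k / (real n ^ k * real n ^ (k + 2)))"
  proof -
    have "y ^ (k + 1) = c ^ (k + 1) * (real n ^ k * real n ^ (k + 2))"
      by (simp add: y_def power_mult_distrib power_mult[symmetric] flip: power_add) (simp add: algebra_simps mult_2_right)
    thus ?thesis by (simp del: fact_Suc)
  qed
  also have "\<dots> \<le> fact (k + 1) / c ^ (k + 1) * inverse (real n ^ 2)"
  proof (rule mult_left_mono)
    have "real n ^ k / (real n ^ k * real n ^ (k + 2)) = 1 / real n ^ (k + 2)" using False by simp
    also have "\<dots> \<le> inverse (real n ^ 2)"
      unfolding inverse_eq_divide using False by (intro divide_left_mono power_increasing) auto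
    finally show "real n ^ k / (real n ^ k * real n ^ (k + 2)) \<le> inverse (real n ^ 2)" .
  qed (use assms in simp)
  finally show ?thesis using False by (simp add: y_def del: fact_Suc power_Suc)
qed

lemma summable_gaussian:
  fixes c :: real assumes "c > 0"
  shows "summable (\<lambda>n. real n ^ k * exp (- (c * (real n)\<^sup>2)))"
proof (rule summable_comparison_test')
  show "summable (\<lambda>n. (if n = 0 then 1 else 0) + fact (k + 1) / c ^ (k + 1) * inverse (real n ^ 2))"
    by (intro summable_add summable_mult inverse_power_summable) (auto simp: summable_single)
  show "norm (real n ^ k * exp (- (c * (real n)\<^sup>2))) \<le> (if n = 0 then 1 else 0) + fact (k + 1) / c ^ (k + 1) * inverse (real n ^ 2)"
    if "n \<ge> 0" for n using gaussian_le[OF assms, of n k] by simp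
qed

lemma norm_gaussian:
  "norm (exp (- (of_nat n)\<^sup>2 / (24 * X))) = exp (- (Re (1 / X) / 24 * (real n)\<^sup>2))"
proof -
  have "- (of_nat n)\<^sup>2 / (24 * X) = of_real (- (real n)\<^sup>2 / 24) * (1 / X)" by simp
  moreover have "Re (of_real a * w) = a * Re w" for a w by simp
  ultimately have "Re (- (of_nat n)\<^sup>2 / (24 * X)) = - (real n)\<^sup>2 / 24 * Re (1 / X)" by (simp only:)
  thus ?thesis unfolding norm_exp_eq_Re by simp
qed

lemma Re_inverse_pos: "Re X > 0 \<Longrightarrow> Re (1 / X) > 0"
  by (cases X) (auto simp: Re_divide complex_eq_iff sum_power2_gt_zero_iff divide_pos_pos)

lemma norm_set_integral_le:
  fixes f :: "real \<Rightarrow> complex"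
  assumes "set_integrable lborel A f" "set_integrable lborel A g" "\<And>r. r \<in> A \<Longrightarrow> norm (f r) \<le> g r"
  shows "norm (LINT r:A|lborel. f r) \<le> (LINT r:A|lborel. g r)"
  by (rule order_trans[OF set_integral_norm_bound[OF assms(1)]])
     (intro set_integral_mono set_integrable_norm assms)

lemma norm_powr_of_real:
  fixes z :: complex
  shows "norm (z powr of_real a) = norm z powr a"
  by (simp add: norm_powr_real_powr')

lemma ray_int_id:
  assumes "\<bar>\<theta>\<bar> < pi / 2" "Re x > 0" "Re (cis \<theta> * x) > 0"
  shows "set_integrable lborel {0<..} (\<lambda>r. exp (- (of_real r * (cis \<theta> * x))) * (cis (\<theta> / 2) * of_real (sqrt r)))"
    and "cis \<theta> * (LINT r:{0<..}|lborel. exp (- (of_real r * (cis \<theta> * x))) * (cis (\<theta> / 2) * of_real (sqrt r))) = of_real (sqrt pi / 2) * x powr (- (3 / 2))"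
proof -
  have eq: "cis (\<theta> / 2) * (of_real (r powr (3 / 2 - 1)) * exp (- (of_real r * (cis \<theta> * x)))) = exp (- (of_real r * (cis \<theta> * x))) * (cis (\<theta> / 2) * of_real (sqrt r))"
    if "r \<in> {0<..}" for r using that by (simp add: powr_half_sqrt)
  have i: "set_integrable lborel {0<..} (\<lambda>r. cis (\<theta> / 2) * (of_real (r powr (3 / 2 - 1)) * exp (- (of_real r * (cis \<theta> * x)))))"
    using assms by (intro set_integrable_mult_right laplace_power) auto
  show "set_integrable lborel {0<..} (\<lambda>r. exp (- (of_real r * (cis \<theta> * x))) * (cis (\<theta> / 2) * of_real (sqrt r)))"
    by (rule iffD1[OF set_integrable_cong i]) (simp_all only: eq)
  have "(LINT r:{0<..}|lborel. exp (- (of_real r * (cis \<theta> * x))) * (cis (\<theta> / 2) * of_real (sqrt r))) =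
     (LINT r:{0<..}|lborel. cis (\<theta> / 2) * (of_real (r powr (3 / 2 - 1)) * exp (- (of_real r * (cis \<theta> * x)))))"
    by (intro set_lebesgue_integral_cong allI impI eq[symmetric]) auto
  also have "\<dots> = cis (\<theta> / 2) * (of_real (Gamma (3 / 2)) * (cis \<theta> * x) powr (- of_real (3 / 2)))"
    using assms laplace_power(2)[of "3 / 2" "cis \<theta> * x"] by simp
  finally have "cis \<theta> * (LINT r:{0<..}|lborel. exp (- (of_real r * (cis \<theta> * x))) * (cis (\<theta> / 2) * of_real (sqrt r)))
     = of_real (Gamma (3 / 2)) * ((cis \<theta> * cis (\<theta> / 2)) * (cis \<theta> * x) powr (- of_real (3 / 2)))" by (simp only: mult_ac)
  also have "cis \<theta> * cis (\<theta> / 2) = cis (3 / 2 * \<theta>)" by (simp add: cis_mult)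
  also have "cis (3 / 2 * \<theta>) * (cis \<theta> * x) powr (- of_real (3 / 2)) = x powr (- of_real (3 / 2))"
    by (rule ray_power[OF assms(1,2)])
  also have "Gamma (3 / 2 :: real) = sqrt pi / 2" using Gamma_three_halves_plus[of 0] by simp
  finally show "cis \<theta> * (LINT r:{0<..}|lborel. exp (- (of_real r * (cis \<theta> * x))) * (cis (\<theta> / 2) * of_real (sqrt r))) = of_real (sqrt pi / 2) * x powr (- (3 / 2))"
    by simp
qed

context theta_kernel begin

text \<open>
  Near \<open>0\<close> this is the hypothesis; far from \<open>0\<close>, in a sector, the kernel is bounded by a multiple of
  \<open>1 / norm v\<close>, and both this and the linear part are dominated by the square.
\<close>

lemma kernel_sector_bound:
  assumes c: "0 < c" and \<rho>: "\<rho> > 0" and C: "C \<ge> 0"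
    and near: "\<And>v. Im v > 0 \<Longrightarrow> norm v < \<rho> \<Longrightarrow> norm (A v - a * v) \<le> C * (norm v)\<^sup>2"
  shows "\<exists>K. \<forall>v. Im v > 0 \<and> Im v \<ge> c * norm v \<longrightarrow> norm (A v - a * v) \<le> K * (norm v)\<^sup>2"
proof -
  have far: "norm (A v) \<le> 1 / (c * norm v)" if "Im v > 0" "Im v \<ge> c * norm v" for v
  proof -
    have "v \<noteq> 0" using that by auto
    hence "1 / Im v \<le> 1 / (c * norm v)" using c that by (intro divide_left_mono mult_pos_pos) auto
    thus ?thesis using norm_kernel_le[OF that(1)] by linarith
  qed
  have "norm (A v - a * v) \<le> (C + (1 / (c * \<rho> ^ 3) + norm a / \<rho>)) * (norm v)\<^sup>2" if v: "Im v > 0" "Im v \<ge> c * norm v" for v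
  proof (cases "norm v < \<rho>")
    case True
    have "norm (A v - a * v) \<le> C * (norm v)\<^sup>2" using near[OF v(1) True] .
    also have "\<dots> \<le> (C + (1 / (c * \<rho> ^ 3) + norm a / \<rho>)) * (norm v)\<^sup>2" using c \<rho> by (intro mult_right_mono) auto
    finally show ?thesis .
  next
    case False
    define t where "t = norm v"
    have t: "t \<ge> \<rho>" "t > 0" using False \<rho> by (auto simp: t_def)
    have "1 / (c * t) = 1 / (c * t ^ 3) * t\<^sup>2" using t c by (simp add: power2_eq_square power3_eq_cube)
    also have "\<dots> \<le> 1 / (c * \<rho> ^ 3) * t\<^sup>2"
      using t c \<rho> by (intro mult_right_mono divide_left_mono mult_left_mono power_mono mult_pos_pos) auto
    finally have 1: "norm (A v) \<le> 1 / (c * \<rho> ^ 3) * t\<^sup>2" using far[OF v] by (simp add: t_def)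
    have "norm a * t * \<rho> \<le> norm a * t * t" using t by (intro mult_left_mono) auto
    hence 2: "norm (a * v) \<le> norm a / \<rho> * t\<^sup>2" using \<rho> by (simp add: norm_mult t_def field_simps power2_eq_square)
    have "norm (A v - a * v) \<le> norm (A v) + norm (a * v)" by (rule norm_triangle_ineq4)
    also have "\<dots> \<le> (1 / (c * \<rho> ^ 3) + norm a / \<rho>) * t\<^sup>2" using 1 2 by (simp only: distrib_right add_mono)
    also have "\<dots> \<le> (C + (1 / (c * \<rho> ^ 3) + norm a / \<rho>)) * t\<^sup>2" using C by (intro mult_right_mono) auto
    finally show ?thesis by (simp add: t_def)
  qed
  thus "\<exists>K. \<forall>v. Im v > 0 \<and> Im v \<ge> c * norm v \<longrightarrow> norm (A v - a * v) \<le> K * (norm v)\<^sup>2" by blast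
qed

end

lemma ray_int_1: "ray_int 1 \<theta> x f = cis \<theta> * (LINT r:{0<..}|lborel. exp (- (of_real r * (cis \<theta> * x))) * f (cis (\<theta> / 2) * of_real (sqrt r)))"
proof -
  have "(LINT r:{0<..}|lborel. of_real (r powr (1 - 1)) * exp (- (of_real r * (cis \<theta> * x))) * f (cis (\<theta> / 2) * of_real (sqrt r)))
     = (LINT r:{0<..}|lborel. exp (- (of_real r * (cis \<theta> * x))) * f (cis (\<theta> / 2) * of_real (sqrt r)))"
    by (intro set_lebesgue_integral_cong) auto
  thus ?thesis by (simp add: ray_int_def)
qed

text \<open>
  Watson's lemma to first order, with an explicit remainder.
\<close>

lemma ray_int_linear_approx:
  assumes th: "\<bar>\<theta>\<bar> < pi / 2" and x: "Re x > 0" "Re (cis \<theta> * x) > 0"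
    and int: "set_integrable lborel {0<..} (\<lambda>r. exp (- (of_real r * (cis \<theta> * x))) * B (cis (\<theta> / 2) * of_real (sqrt r)))"
    and bound: "\<And>r. r > 0 \<Longrightarrow> norm (B (cis (\<theta> / 2) * of_real (sqrt r)) - q * (cis (\<theta> / 2) * of_real (sqrt r))) \<le> M * r"
  shows "norm (ray_int 1 \<theta> x B - q * (of_real (sqrt pi / 2) * x powr (- (3 / 2)))) \<le> M * Re (cis \<theta> * x) powr (- 2)"
proof -
  define w where "w = (\<lambda>r. cis (\<theta> / 2) * complex_of_real (sqrt r))"
  define e where "e = (\<lambda>r. exp (- (complex_of_real r * (cis \<theta> * x))))"
  define b where "b = Re (cis \<theta> * x)"
  have b: "b > 0" using x by (simp add: b_def)
  note id = ray_int_id[OF th x]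
  have i2: "set_integrable lborel {0<..} (\<lambda>r. q * (e r * w r))"
    using id(1) unfolding e_def w_def by (rule set_integrable_mult_right)
  have i1: "set_integrable lborel {0<..} (\<lambda>r. e r * B (w r))" using int by (simp add: e_def w_def)
  have "ray_int 1 \<theta> x B - q * (of_real (sqrt pi / 2) * x powr (- (3 / 2))) = cis \<theta> * ((LINT r:{0<..}|lborel. e r * B (w r)) - (LINT r:{0<..}|lborel. q * (e r * w r)))"
    unfolding ray_int_1 id(2)[symmetric] e_def w_def set_integral_mult_right by (simp add: algebra_simps)
  also have "(LINT r:{0<..}|lborel. e r * B (w r)) - (LINT r:{0<..}|lborel. q * (e r * w r)) = (LINT r:{0<..}|lborel. e r * B (w r) - q * (e r * w r))"
    by (rule set_integral_diff(2)[OF i1 i2, symmetric])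
  also have "norm (cis \<theta> * \<dots>) = norm \<dots>" by (simp add: norm_mult)
  also have "\<dots> \<le> (LINT r:{0<..}|lborel. M * (r powr (2 - 1) * exp (- (b * r))))"
  proof (rule norm_set_integral_le)
    show "set_integrable lborel {0<..} (\<lambda>r. e r * B (w r) - q * (e r * w r))"
      by (rule set_integral_diff(1)[OF i1 i2])
    show "set_integrable lborel {0<..} (\<lambda>r. M * (r powr (2 - 1) * exp (- (b * r))))"
      using b by (intro set_integrable_mult_right laplace_power_real) auto
    fix r :: real assume "r \<in> {0<..}"
    hence r: "r > 0" by simp
    have "norm (e r * B (w r) - q * (e r * w r)) = norm (e r) * norm (B (w r) - q * w r)"
      by (simp add: algebra_simps flip: norm_mult)
    also have "norm (e r) = exp (- (b * r))" by (simp add: e_def b_def mult.commute)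
    also have "exp (- (b * r)) * norm (B (w r) - q * w r) \<le> exp (- (b * r)) * (M * r)"
      using bound[OF r] by (intro mult_left_mono) (auto simp: w_def)
    also have "\<dots> = M * (r powr (2 - 1) * exp (- (b * r)))" using r by simp
    finally show "norm (e r * B (w r) - q * (e r * w r)) \<le> M * (r powr (2 - 1) * exp (- (b * r)))" .
  qed
  also have "\<dots> = M * b powr (- 2)"
    using laplace_power_real(2)[of 2 b] b Gamma_fact[of 1, where 'a = real] by (simp add: numeral_2_eq_2)
  finally show ?thesis by (simp add: b_def)
qed

context theta_kernel begin

lemma summable_theta:
  assumes "Re X > 0"
  shows "summable (\<lambda>n. norm (of_nat n ^ k * g n * exp (- (of_nat n)\<^sup>2 / (24 * X))))"
proof (rule summable_comparison_test')
  show "summable (\<lambda>n. real n ^ k * exp (- (Re (1 / X) / 24 * (real n)\<^sup>2)))"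
    using Re_inverse_pos[OF assms] by (intro summable_gaussian) auto
  fix n
  have "norm (of_nat n ^ k * g n * exp (- (of_nat n)\<^sup>2 / (24 * X))) = real n ^ k * norm (g n) * exp (- (Re (1 / X) / 24 * (real n)\<^sup>2))"
    unfolding norm_mult norm_gaussian by (simp add: norm_power)
  also have "\<dots> \<le> real n ^ k * 1 * exp (- (Re (1 / X) / 24 * (real n)\<^sup>2))"
    by (intro mult_right_mono mult_left_mono norm_g) auto
  finally show "norm (norm (of_nat n ^ k * g n * exp (- (of_nat n)\<^sup>2 / (24 * X)))) \<le> real n ^ k * exp (- (Re (1 / X) / 24 * (real n)\<^sup>2))"
    by simp
qed

text \<open>
  Replacing the kernel by its linear part \<open>a * v\<close> makes both integrals equal to \<open>ray_int_id\<close>, which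
  produces \<open>- \<i> * a\<close>.
\<close>

lemma theta_bound:
  assumes th: "0 < \<theta>" "\<theta> < pi / 2" and x: "Re x > 0" "Re (cis \<theta> * x) > 0" "Re (cis (- \<theta>) * x) > 0"
    and K: "\<And>v. Im v > 0 \<Longrightarrow> Im v \<ge> sin (\<theta> / 2) * norm v \<Longrightarrow> norm (A v - a * v) \<le> K * (norm v)\<^sup>2"
  shows "norm ((\<Sum>n. of_nat n * g n * exp (- (of_nat n)\<^sup>2 / (24 * x))) + \<i> * a)
          \<le> sqrt 6 / sqrt pi * (norm x powr (3 / 2) * (K / 6 * (Re (cis \<theta> * x) powr (- 2) + Re (cis (- \<theta>) * x) powr (- 2))))"
proof -
  have x0: "x \<noteq> 0" using x by auto
  have sp: "sin (\<theta> / 2) > 0" using th by (intro sin_gt_zero) auto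
  have r6: "norm root6 = sqrt 6" by simp
  define P where "P = of_real (sqrt pi / 2) * x powr (- (3 / 2))"
  define S where "S = (\<Sum>n. of_nat n * g n * exp (- (of_nat n)\<^sup>2 / (24 * x)))"
  define Rp where "Rp = ray_int 1 \<theta> x (\<lambda>w. A (w / root6))"
  define Rm where "Rm = ray_int 1 (- \<theta>) x (\<lambda>w. A (- (w / root6)))"
  note rep = theta_representation[OF th x]
  have ap: "norm (A v - a * v) \<le> K * r / 6" if "Im v = sin (\<theta> / 2) * sqrt r / sqrt 6" "norm v = sqrt r / sqrt 6" "r > 0" for v r
  proof -
    have "norm (A v - a * v) \<le> K * (norm v)\<^sup>2" using that sp by (intro K) auto
    thus ?thesis using that by (simp add: power_divide)
  qed
  have p: "norm (Rp - a / root6 * P) \<le> K / 6 * Re (cis \<theta> * x) powr (- 2)"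
    unfolding Rp_def P_def
  proof (rule ray_int_linear_approx)
    show "set_integrable lborel {0<..} (\<lambda>r. exp (- (of_real r * (cis \<theta> * x))) * A (cis (\<theta> / 2) * of_real (sqrt r) / root6))" by (rule rep(1))
    fix r :: real assume r: "r > 0"
    have "cis (\<theta> / 2) * of_real (sqrt r) / root6 = of_real (sqrt r / sqrt 6) * cis (\<theta> / 2)" by simp
    hence "Im (cis (\<theta> / 2) * of_real (sqrt r) / root6) = sin (\<theta> / 2) * sqrt r / sqrt 6" by (simp only: ) simp
    moreover have "norm (cis (\<theta> / 2) * of_real (sqrt r) / root6) = sqrt r / sqrt 6" using r by (simp add: norm_divide norm_mult)
    ultimately have "norm (A (cis (\<theta> / 2) * of_real (sqrt r) / root6) - a * (cis (\<theta> / 2) * of_real (sqrt r) / root6)) \<le> K * r / 6"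
      using r by (intro ap) auto
    thus "norm (A (cis (\<theta> / 2) * of_real (sqrt r) / root6) - a / root6 * (cis (\<theta> / 2) * of_real (sqrt r))) \<le> K / 6 * r" by simp
  qed (use th x in auto)
  have m: "norm (Rm - (- a / root6) * P) \<le> K / 6 * Re (cis (- \<theta>) * x) powr (- 2)"
    unfolding Rm_def P_def
  proof (rule ray_int_linear_approx)
    show "set_integrable lborel {0<..} (\<lambda>r. exp (- (of_real r * (cis (- \<theta>) * x))) * A (- (cis (- \<theta> / 2) * of_real (sqrt r) / root6)))" by (rule rep(2))
    fix r :: real assume r: "r > 0"
    have "- (cis (- \<theta> / 2) * of_real (sqrt r) / root6) = - of_real (sqrt r / sqrt 6) * cis (- \<theta> / 2)" by simp
    hence "Im (- (cis (- \<theta> / 2) * of_real (sqrt r) / root6)) = sin (\<theta> / 2) * sqrt r / sqrt 6" by (simp only: ) simp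
    moreover have "norm (- (cis (- \<theta> / 2) * of_real (sqrt r) / root6)) = sqrt r / sqrt 6" using r by (simp add: norm_divide norm_mult)
    ultimately have "norm (A (- (cis (- \<theta> / 2) * of_real (sqrt r) / root6)) - a * (- (cis (- \<theta> / 2) * of_real (sqrt r) / root6))) \<le> K * r / 6"
      using r by (intro ap) auto
    thus "norm (A (- (cis (- \<theta> / 2) * of_real (sqrt r) / root6)) - - a / root6 * (cis (- \<theta> / 2) * of_real (sqrt r))) \<le> K / 6 * r" by simp
  qed (use th x in auto)
  define k where "k = \<i> * of_real (sqrt pi / sqrt 6) * x powr (- (3 / 2))"
  have kP: "k = \<i> * (2 * P / root6)" by (simp add: k_def P_def)
  have "(\<lambda>n. of_nat n * g n * exp (- (of_nat n)\<^sup>2 / (24 * x)) * k) sums (S * k)"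
    unfolding S_def using summable_norm_cancel[OF summable_theta[OF x(1), of 1]] by (intro sums_mult2 summable_sums) simp
  with rep(3) have "S * k = Rp - Rm" unfolding k_def Rp_def Rm_def by (rule sums_unique2[symmetric])
  also have "\<dots> = - \<i> * a * k + ((Rp - a / root6 * P) - (Rm - (- a / root6) * P))"
    unfolding kP by (simp add: algebra_simps)
  finally have e: "(S + \<i> * a) * k = (Rp - a / root6 * P) - (Rm - (- a / root6) * P)" by (simp add: algebra_simps)
  have nk: "norm k = sqrt pi / sqrt 6 * norm x powr (- (3 / 2))"
    using norm_powr_of_real[of x "- (3 / 2)"] by (simp add: k_def norm_mult norm_divide)
  have "norm (S + \<i> * a) * norm k \<le> norm (Rp - a / root6 * P) + norm (Rm - (- a / root6) * P)"
    unfolding norm_mult[symmetric] e by (rule norm_triangle_ineq4)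
  also have "\<dots> \<le> K / 6 * (Re (cis \<theta> * x) powr (- 2) + Re (cis (- \<theta>) * x) powr (- 2))"
    unfolding distrib_left by (intro add_mono p m)
  finally have "norm (S + \<i> * a) * norm k \<le> K / 6 * (Re (cis \<theta> * x) powr (- 2) + Re (cis (- \<theta>) * x) powr (- 2))" .
  hence "norm (S + \<i> * a) * norm k / norm k \<le> K / 6 * (Re (cis \<theta> * x) powr (- 2) + Re (cis (- \<theta>) * x) powr (- 2)) / norm k"
    by (intro divide_right_mono) auto
  moreover have "norm k \<noteq> 0" using x0 by (simp add: nk)
  ultimately have "norm (S + \<i> * a) \<le> K / 6 * (Re (cis \<theta> * x) powr (- 2) + Re (cis (- \<theta>) * x) powr (- 2)) / norm k" by simp
  also have "\<dots> = sqrt 6 / sqrt pi * (norm x powr (3 / 2) * (K / 6 * (Re (cis \<theta> * x) powr (- 2) + Re (cis (- \<theta>) * x) powr (- 2))))"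
    unfolding nk powr_minus[of "norm x"] by (simp add: field_simps)
  finally show ?thesis by (simp add: S_def)
qed

end

context theta_kernel begin

text \<open>
  As \<open>X \<rightarrow> \<infinity>\<close> in a sector the remainder in \<open>theta_bound\<close> is of the order of \<open>norm X powr (-1/2)\<close>. A theta
  series with weights \<open>g\<close> thus has a limit as soon as its generating function vanishes to first
  order at \<open>0\<close>, and the limit is read off from the slope.
\<close>

lemma theta_limit:
  fixes X :: "real \<Rightarrow> complex"
  assumes \<rho>: "\<rho> > 0" "C \<ge> 0" and near: "\<And>v. Im v > 0 \<Longrightarrow> norm v < \<rho> \<Longrightarrow> norm (A v - a * v) \<le> C * (norm v)\<^sup>2"
    and th: "0 < \<theta>" "\<theta> < pi / 2" and k: "\<kappa> > 0"
    and X: "\<forall>\<^sub>F t in F. Re (X t) > 0 \<and> Re (cis \<theta> * X t) \<ge> \<kappa> * norm (X t) \<and> Re (cis (- \<theta>) * X t) \<ge> \<kappa> * norm (X t)"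
    and lim: "filterlim (\<lambda>t. norm (X t)) at_top F"
  shows "((\<lambda>t. \<Sum>n. of_nat n * g n * exp (- (of_nat n)\<^sup>2 / (24 * X t))) \<longlongrightarrow> - \<i> * a) F"
proof -
  have sp: "sin (\<theta> / 2) > 0" using th by (intro sin_gt_zero) auto
  obtain K where K: "\<And>v. Im v > 0 \<Longrightarrow> Im v \<ge> sin (\<theta> / 2) * norm v \<Longrightarrow> norm (A v - a * v) \<le> K * (norm v)\<^sup>2"
    using kernel_sector_bound[OF sp \<rho> near] by blast
  have si: "sin (\<theta> / 2) \<le> 1" by simp
  have K0: "K \<ge> 0" using order_trans[OF norm_ge_zero K[of \<i>]] si by simp
  have ev: "\<forall>\<^sub>F t in F. norm (X t) > 0" using lim unfolding filterlim_at_top_dense by blast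
  have lim0: "((\<lambda>t. norm (X t) powr (- (1 / 2))) \<longlongrightarrow> 0) F"
    by (rule tendsto_neg_powr[OF _ lim]) simp
  define c1 where "c1 = sqrt 6 / sqrt pi * (K / 6 * (2 * \<kappa> powr (- 2)))"
  have b1: "\<forall>\<^sub>F t in F. norm ((\<Sum>n. of_nat n * g n * exp (- (of_nat n)\<^sup>2 / (24 * X t))) + \<i> * a) \<le> c1 * norm (X t) powr (- (1 / 2))"
    using X ev
  proof eventually_elim
    case (elim t)
    define m where "m = norm (X t)"
    have m: "m > 0" using elim by (simp add: m_def)
    have pos: "\<kappa> * m > 0" using k m by simp
    have le: "Re (cis \<theta> * X t) powr (- 2) \<le> (\<kappa> * m) powr (- 2)" "Re (cis (- \<theta>) * X t) powr (- 2) \<le> (\<kappa> * m) powr (- 2)"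
      by (rule powr_mono2'[OF _ pos]; use elim in \<open>simp add: m_def\<close>)+
    have "norm ((\<Sum>n. of_nat n * g n * exp (- (of_nat n)\<^sup>2 / (24 * X t))) + \<i> * a) \<le>
       sqrt 6 / sqrt pi * (m powr (3 / 2) * (K / 6 * (Re (cis \<theta> * X t) powr (- 2) + Re (cis (- \<theta>) * X t) powr (- 2))))"
      unfolding m_def using elim pos m_def K by (intro theta_bound th) auto
    also have "\<dots> \<le> sqrt 6 / sqrt pi * (m powr (3 / 2) * (K / 6 * ((\<kappa> * m) powr (- 2) + (\<kappa> * m) powr (- 2))))"
      using K0 by (intro mult_left_mono add_mono le) auto
    also have "(\<kappa> * m) powr (- 2) = \<kappa> powr (- 2) * m powr (- 2)" using k m by (intro powr_mult)
    also have "sqrt 6 / sqrt pi * (m powr (3 / 2) * (K / 6 * (\<kappa> powr (- 2) * m powr (- 2) + \<kappa> powr (- 2) * m powr (- 2)))) = c1 * (m powr (3 / 2) * m powr (- 2))"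
      by (simp add: c1_def)
    also have "m powr (3 / 2) * m powr (- 2) = m powr (- (1 / 2))" unfolding powr_add[symmetric] by simp
    finally show ?case by (simp add: m_def)
  qed
  have "((\<lambda>t. c1 * norm (X t) powr (- (1 / 2))) \<longlongrightarrow> 0) F" using tendsto_mult[OF tendsto_const lim0] by simp
  from Lim_null_comparison[OF b1 this]
  have "((\<lambda>t. ((\<Sum>n. of_nat n * g n * exp (- (of_nat n)\<^sup>2 / (24 * X t))) + \<i> * a) - \<i> * a) \<longlongrightarrow> 0 - \<i> * a) F" by (intro tendsto_diff tendsto_const)
  thus "((\<lambda>t. \<Sum>n. of_nat n * g n * exp (- (of_nat n)\<^sup>2 / (24 * X t))) \<longlongrightarrow> - \<i> * a) F" by simp
qed

end

section \<open>The generating function at a root of unity\<close>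

text \<open>
  The product that enters the series of Kontsevich and Zagier at \<open>\<zeta>\<close>, deformed by \<open>x\<close>.
\<close>

definition qfac :: "complex \<Rightarrow> nat \<Rightarrow> complex \<Rightarrow> complex" where
  "qfac \<zeta> n x = (\<Prod>k=1..n. 1 - x * \<zeta> ^ k)"

lemma qfac_0 [simp]: "qfac \<zeta> 0 x = 1" by (simp add: qfac_def)

lemma qfac_Suc: "qfac \<zeta> (Suc n) x = qfac \<zeta> n x * (1 - x * \<zeta> ^ Suc n)"
  by (simp add: qfac_def)

lemma qfac_Suc': "qfac \<zeta> (Suc n) x = (1 - x * \<zeta>) * qfac \<zeta> n (\<zeta> * x)"
  by (induction n) (simp_all add: qfac_Suc mult_ac)

definition qpoly :: "complex \<Rightarrow> nat \<Rightarrow> complex \<Rightarrow> complex" where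
  "qpoly \<zeta> N x = (\<Sum>r<N. qfac \<zeta> r x * x ^ r)"

definition qdenom :: "complex \<Rightarrow> nat \<Rightarrow> complex \<Rightarrow> complex" where
  "qdenom \<zeta> N x = 1 - x ^ N * qfac \<zeta> N x"

text \<open>
  At a root of unity of order dividing \<open>N\<close> the deformed series
  \<open>(1 - x) * (\<Sum>n. qfac \<zeta> n x * x\<^sup>n)\<close> has factors that repeat with period \<open>N\<close>, so it is geometric in
  blocks of length \<open>N\<close>; this is its sum.
\<close>

definition qrational :: "complex \<Rightarrow> nat \<Rightarrow> complex \<Rightarrow> complex" where
  "qrational \<zeta> N x = (1 - x) * qpoly \<zeta> N x / qdenom \<zeta> N x"

lemma qpoly_shift:
  "(1 - x) * (\<Sum>r<M. qfac \<zeta> r x * x ^ r) = 1 - x ^ M * qfac \<zeta> M x - \<zeta> * x\<^sup>2 * (\<Sum>r<M. qfac \<zeta> r x * (\<zeta> * x) ^ r)"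
proof (induction M)
  case (Suc M)
  have "(1 - x) * (\<Sum>r<Suc M. qfac \<zeta> r x * x ^ r) = (1 - x) * (\<Sum>r<M. qfac \<zeta> r x * x ^ r) + (1 - x) * (qfac \<zeta> M x * x ^ M)"
    by (simp add: distrib_left)
  also have "\<dots> = 1 - x ^ Suc M * qfac \<zeta> (Suc M) x - \<zeta> * x\<^sup>2 * (\<Sum>r<Suc M. qfac \<zeta> r x * (\<zeta> * x) ^ r)"
    unfolding Suc.IH qfac_Suc by (simp add: algebra_simps power_mult_distrib power2_eq_square)
  finally show ?case .
qed simp

lemma qpoly_shift':
  "(\<Sum>r<M. qfac \<zeta> r x * (\<zeta> * x) ^ r) = 1 - (\<zeta> * x) ^ M * qfac \<zeta> M x + \<zeta> * x * ((1 - \<zeta> * x) * (\<Sum>r<M. qfac \<zeta> r (\<zeta> * x) * (\<zeta> * x) ^ r))"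
proof (induction M)
  case (Suc M)
  show ?case
    unfolding sum.lessThan_Suc Suc.IH qfac_Suc' by (simp add: algebra_simps)
qed simp

text \<open>
  The same \<open>q\<close>-difference equation as for formal \<open>q\<close>, now between rational functions of \<open>x\<close>.
\<close>

lemma qrational_functional_equation:
  assumes "\<zeta> ^ N = 1" "x * \<zeta> \<noteq> 1" "qdenom \<zeta> N x \<noteq> 0"
  shows "qdenom \<zeta> N (\<zeta> * x) = qdenom \<zeta> N x"
    and "qrational \<zeta> N x = 1 - \<zeta> * x\<^sup>2 - \<zeta>\<^sup>2 * x ^ 3 * qrational \<zeta> N (\<zeta> * x)"
proof -
  have p: "(\<zeta> * x) ^ N = x ^ N" using assms(1) by (simp add: power_mult_distrib)
  have "(1 - x * \<zeta>) * qfac \<zeta> N (\<zeta> * x) = qfac \<zeta> (Suc N) x" by (rule qfac_Suc'[symmetric])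
  also have "\<dots> = (1 - x * \<zeta>) * qfac \<zeta> N x" unfolding qfac_Suc using assms(1) by simp
  finally have "qfac \<zeta> N (\<zeta> * x) = qfac \<zeta> N x" using assms(2) by simp
  thus d: "qdenom \<zeta> N (\<zeta> * x) = qdenom \<zeta> N x" by (simp add: qdenom_def p)
  define D where "D = qdenom \<zeta> N x"
  have "(1 - x) * qpoly \<zeta> N x = D - \<zeta> * x\<^sup>2 * (D + \<zeta> * x * ((1 - \<zeta> * x) * qpoly \<zeta> N (\<zeta> * x)))"
  proof -
    have V: "(\<Sum>r<N. qfac \<zeta> r x * (\<zeta> * x) ^ r) = D + \<zeta> * x * ((1 - \<zeta> * x) * qpoly \<zeta> N (\<zeta> * x))"
      unfolding D_def qdenom_def qpoly_def p[symmetric] by (rule qpoly_shift')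
    have "(1 - x) * qpoly \<zeta> N x = 1 - x ^ N * qfac \<zeta> N x - \<zeta> * x\<^sup>2 * (\<Sum>r<N. qfac \<zeta> r x * (\<zeta> * x) ^ r)"
      unfolding qpoly_def by (rule qpoly_shift)
    thus ?thesis unfolding V by (simp only: D_def qdenom_def)
  qed
  hence "qrational \<zeta> N x = (D - \<zeta> * x\<^sup>2 * (D + \<zeta> * x * ((1 - \<zeta> * x) * qpoly \<zeta> N (\<zeta> * x)))) / D"
    by (simp add: qrational_def D_def)
  also have "\<dots> = 1 - \<zeta> * x\<^sup>2 - \<zeta>\<^sup>2 * x ^ 3 * ((1 - \<zeta> * x) * qpoly \<zeta> N (\<zeta> * x) / D)"
  proof -
    have "(D - \<zeta> * x\<^sup>2 * (D + \<zeta> * x * Y)) / D = 1 - \<zeta> * x\<^sup>2 - \<zeta>\<^sup>2 * x ^ 3 * (Y / D)" if "D \<noteq> 0" for D Y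
    proof -
      have "(D - \<zeta> * x\<^sup>2 * (D + \<zeta> * x * Y)) / D = D / D - \<zeta> * x\<^sup>2 * (D / D) - (\<zeta> * x\<^sup>2 * (\<zeta> * x)) * (Y / D)"
        by (simp add: diff_divide_distrib add_divide_distrib distrib_left mult.assoc)
      also have "\<zeta> * x\<^sup>2 * (\<zeta> * x) = \<zeta>\<^sup>2 * x ^ 3" by (simp add: power2_eq_square power3_eq_cube)
      finally show ?thesis using that by simp
    qed
    thus ?thesis using assms(3) unfolding D_def by blast
  qed
  finally show "qrational \<zeta> N x = 1 - \<zeta> * x\<^sup>2 - \<zeta>\<^sup>2 * x ^ 3 * qrational \<zeta> N (\<zeta> * x)"
    by (simp add: qrational_def d D_def)
qed

text \<open>
  At \<open>x = 1\<close> the products vanish from the index \<open>N\<close> on.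
\<close>

lemma KZ_eq_qpoly:
  assumes "\<zeta> ^ N = 1" "N > 0"
  shows "KZ \<zeta> = qpoly \<zeta> N 1"
proof -
  have "KZ \<zeta> = (\<Sum>n<N. \<Prod>k=1..n. 1 - \<zeta> ^ k)"
    unfolding KZ_def
  proof (rule suminf_finite)
    fix n assume "n \<notin> {..<N}"
    with assms show "(\<Prod>k=1..n. 1 - \<zeta> ^ k) = 0"
      by (intro prod_zero bexI[of _ N]) auto
  qed simp
  thus ?thesis by (simp add: qpoly_def qfac_def)
qed

text \<open>
  Moving the base point of the theta series to the boundary point \<open>-1/(2 pi i \<alpha>)\<close> multiplies its \<open>n\<close>-th
  term by this phase.
\<close>

definition twisted_chi :: "real \<Rightarrow> nat \<Rightarrow> complex" where
  "twisted_chi \<alpha> n = chi n * exp (\<i> * of_real (pi * \<alpha> * (real n)\<^sup>2 / 12))"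

definition twisted_kernel :: "real \<Rightarrow> complex \<Rightarrow> complex" where
  "twisted_kernel \<alpha> v = (\<Sum>n. twisted_chi \<alpha> n * exp (\<i> * of_nat n * v))"

lemma norm_twisted_chi: "norm (twisted_chi \<alpha> n) \<le> 1"
  using norm_chi_le[of n] by (simp add: twisted_chi_def norm_mult)

lemma summable_twisted_kernel:
  assumes "Im v > 0"
  shows "summable (\<lambda>n. twisted_chi \<alpha> n * exp (\<i> * of_nat n * v))"
proof (rule summable_comparison_test')
  show "summable (\<lambda>n. exp (- Im v) ^ n)" using assms by (intro summable_geometric) simp
  fix n
  have "norm (exp (\<i> * of_nat n * v)) = exp (- Im v) ^ n" by (simp flip: exp_of_nat_mult)
  thus "norm (twisted_chi \<alpha> n * exp (\<i> * of_nat n * v)) \<le> exp (- Im v) ^ n"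
    using norm_twisted_chi[of \<alpha> n] by (simp add: norm_mult mult_left_le_one_le)
qed

interpretation twisted: theta_kernel "twisted_chi \<alpha>" "twisted_kernel \<alpha>" for \<alpha>
proof
  show "(\<lambda>n. twisted_chi \<alpha> n * exp (\<i> * of_nat n * v)) sums twisted_kernel \<alpha> v" if "Im v > 0" for v
    unfolding twisted_kernel_def by (intro summable_sums summable_twisted_kernel that)
  show "norm (twisted_chi \<alpha> n) \<le> 1" for n by (rule norm_twisted_chi)
  show "twisted_chi \<alpha> 0 = 0" by (simp add: twisted_chi_def)
qed

lemma chi_plus_6: "chi (n + 6) = - chi n"
proof -
  have "n mod 12 = 0 \<or> n mod 12 = 1 \<or> n mod 12 = 2 \<or> n mod 12 = 3 \<or> n mod 12 = 4 \<or> n mod 12 = 5 \<or>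
        n mod 12 = 6 \<or> n mod 12 = 7 \<or> n mod 12 = 8 \<or> n mod 12 = 9 \<or> n mod 12 = 10 \<or> n mod 12 = 11"
    by presburger
  moreover have "(n + 6) mod 12 = (n mod 12 + 6) mod 12" by (simp add: mod_add_left_eq)
  ultimately show ?thesis unfolding chi_def by (elim disjE) simp_all
qed

lemma chi_values: "chi 1 = 1" "chi 2 = 0" "chi 3 = 0" "chi 4 = 0" "chi 5 = - 1"
  by (simp_all add: chi_def)

text \<open>
  Shift the summation index by 6: \<open>chi\<close> changes sign, and \<open>(n + 6)\<^sup>2 = n\<^sup>2 + 12 n + 36\<close> turns the
  phase into a translation of \<open>v\<close> by \<open>pi * \<alpha>\<close>.
\<close>

lemma twisted_kernel_functional_equation:
  assumes "Im v > 0"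
  shows "twisted_kernel \<alpha> v = exp (\<i> * of_real (pi * \<alpha> / 12) + \<i> * v) - exp (\<i> * of_real (25 * pi * \<alpha> / 12) + 5 * \<i> * v)
           - exp (\<i> * of_real (3 * pi * \<alpha>) + 6 * \<i> * v) * twisted_kernel \<alpha> (v + of_real (pi * \<alpha>))"
proof -
  define f where "f = (\<lambda>n. twisted_chi \<alpha> n * exp (\<i> * of_nat n * v))"
  have "twisted_kernel \<alpha> v = (\<Sum>n. f (n + 6)) + (\<Sum>n<6. f n)"
    unfolding twisted_kernel_def f_def[symmetric]
    by (rule suminf_split_initial_segment) (use summable_twisted_kernel[OF assms] in \<open>simp add: f_def\<close>)
  also have "(\<lambda>n. f (n + 6)) = (\<lambda>n. - exp (\<i> * of_real (3 * pi * \<alpha>) + 6 * \<i> * v) * (twisted_chi \<alpha> n * exp (\<i> * of_nat n * (v + of_real (pi * \<alpha>)))))"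
  proof
    fix n
    have e: "\<i> * of_real (pi * \<alpha> * (real (n + 6))\<^sup>2 / 12) + \<i> * of_nat (n + 6) * v =
       (\<i> * of_real (3 * pi * \<alpha>) + 6 * \<i> * v) + (\<i> * of_real (pi * \<alpha> * (real n)\<^sup>2 / 12) + \<i> * of_nat n * (v + of_real (pi * \<alpha>)))"
      by (simp add: power2_eq_square field_simps)
    have "f (n + 6) = - chi n * exp (\<i> * of_real (pi * \<alpha> * (real (n + 6))\<^sup>2 / 12) + \<i> * of_nat (n + 6) * v)"
      unfolding f_def twisted_chi_def chi_plus_6 exp_add by (simp only: mult_ac)
    also have "\<dots> = - exp (\<i> * of_real (3 * pi * \<alpha>) + 6 * \<i> * v) * (twisted_chi \<alpha> n * exp (\<i> * of_nat n * (v + of_real (pi * \<alpha>))))"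
      unfolding e twisted_chi_def exp_add by (simp only: mult_ac mult_minus_left mult_minus_right)
    finally show "f (n + 6) = - exp (\<i> * of_real (3 * pi * \<alpha>) + 6 * \<i> * v) * (twisted_chi \<alpha> n * exp (\<i> * of_nat n * (v + of_real (pi * \<alpha>))))" .
  qed
  also have "(\<Sum>n. - exp (\<i> * of_real (3 * pi * \<alpha>) + 6 * \<i> * v) * (twisted_chi \<alpha> n * exp (\<i> * of_nat n * (v + of_real (pi * \<alpha>)))))
     = - exp (\<i> * of_real (3 * pi * \<alpha>) + 6 * \<i> * v) * twisted_kernel \<alpha> (v + of_real (pi * \<alpha>))"
    unfolding twisted_kernel_def using assms by (intro suminf_mult summable_twisted_kernel) simp
  also have "(\<Sum>n<6. f n) = f 1 + f 5"
    by (simp add: lessThan_nat_numeral) (simp add: f_def twisted_chi_def chi_values)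
  also have "f 1 = exp (\<i> * of_real (pi * \<alpha> / 12) + \<i> * v)"
    by (simp add: f_def twisted_chi_def chi_values exp_add)
  also have "f 5 = - exp (\<i> * of_real (25 * pi * \<alpha> / 12) + 5 * \<i> * v)"
  proof -
    have "f 5 = - (exp (\<i> * of_real (pi * \<alpha> * (real 5)\<^sup>2 / 12)) * exp (\<i> * of_nat 5 * v))"
      by (simp add: f_def twisted_chi_def chi_values)
    also have "pi * \<alpha> * (real 5)\<^sup>2 / 12 = 25 * pi * \<alpha> / 12" by simp
    also have "\<i> * of_nat 5 * v = 5 * \<i> * v" by simp
    finally show ?thesis by (simp only: exp_add)
  qed
  finally show ?thesis by simp
qed

lemma exp_int_period: "exp (\<i> * (of_int m * (of_real pi * 2))) = 1"
  using exp_integer_2pi[of "of_int m"] by (simp add: mult_ac)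

text \<open>
  With \<open>x = e\<^sup>2\<^sup>i\<^sup>v\<close> both sides satisfy the same functional equation, so their difference is
  multiplied by a factor of modulus \<open>e\<^sup>-\<^sup>6\<^sup>I\<^sup>m\<^sup>v < 1\<close> under every translation by \<open>pi * \<alpha>\<close>. After \<open>2 N\<close>
  translations it returns to itself, as \<open>\<alpha>\<close> is rational with denominator \<open>N\<close>; so it vanishes.
\<close>

lemma twisted_kernel_eq_qrational:
  fixes \<alpha> :: real and p :: int
  assumes N: "N > 0" "\<alpha> * real N = of_int p" and v: "Im v > 0"
    and \<zeta>: "\<zeta> = exp (2 * of_real pi * \<i> * of_real \<alpha>)"
    and d: "qdenom \<zeta> N (exp (2 * \<i> * v)) \<noteq> 0"
  shows "twisted_kernel \<alpha> v = exp (\<i> * of_real (pi * \<alpha> / 12) + \<i> * v) * qrational \<zeta> N (exp (2 * \<i> * v))"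
proof -
  define B where "B = (\<lambda>v. exp (\<i> * of_real (pi * \<alpha> / 12) + \<i> * v) * qrational \<zeta> N (exp (2 * \<i> * v)))"
  define D where "D = (\<lambda>v. twisted_kernel \<alpha> v - B v)"
  have \<zeta>N: "\<zeta> ^ N = 1"
  proof -
    have "\<zeta> ^ N = exp (of_nat N * (2 * of_real pi * \<i> * of_real \<alpha>))" by (simp add: \<zeta> exp_of_nat_mult)
    also have "of_nat N * (2 * of_real pi * \<i> * of_real \<alpha>) = 2 * of_real pi * \<i> * of_real (\<alpha> * real N)" by simp
    also have "\<dots> = \<i> * (of_int p * (of_real pi * 2))" unfolding N(2) by simp
    also have "exp \<dots> = 1" by (rule exp_int_period)
    finally show ?thesis .
  qed
  have norm\<zeta>: "norm \<zeta> = 1" by (simp add: \<zeta>)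
  have shift: "exp (2 * \<i> * (u + of_real (pi * \<alpha>))) = \<zeta> * exp (2 * \<i> * u)" for u
    unfolding \<zeta> exp_add[symmetric] by (rule arg_cong[of _ _ exp]) (simp add: algebra_simps)
  have step: "norm (D u) = exp (- 6 * Im u) * norm (D (u + of_real (pi * \<alpha>)))"
    "qdenom \<zeta> N (exp (2 * \<i> * (u + of_real (pi * \<alpha>)))) = qdenom \<zeta> N (exp (2 * \<i> * u))"
    if u: "Im u > 0" "qdenom \<zeta> N (exp (2 * \<i> * u)) \<noteq> 0" for u
  proof -
    define x where "x = exp (2 * \<i> * u)"
    have "norm x < 1" using u by (simp add: x_def)
    hence "norm (x * \<zeta>) < 1" using norm\<zeta> by (simp add: norm_mult)
    hence x: "x * \<zeta> \<noteq> 1" by auto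
    note Q = qrational_functional_equation[OF \<zeta>N x u(2)[folded x_def]]
    show "qdenom \<zeta> N (exp (2 * \<i> * (u + of_real (pi * \<alpha>)))) = qdenom \<zeta> N (exp (2 * \<i> * u))"
      unfolding shift using Q(1) by (simp add: x_def)
    define e where "e = exp (\<i> * of_real (pi * \<alpha> / 12) + \<i> * u)"
    have e1: "e * (\<zeta> * x\<^sup>2) = exp (\<i> * of_real (25 * pi * \<alpha> / 12) + 5 * \<i> * u)"
      unfolding e_def \<zeta> x_def power2_eq_square exp_add[symmetric] by (rule arg_cong[of _ _ exp]) (simp add: algebra_simps)
    have e2: "e * (\<zeta>\<^sup>2 * x ^ 3) = exp (\<i> * of_real (3 * pi * \<alpha>) + 6 * \<i> * u) * exp (\<i> * of_real (pi * \<alpha> / 12) + \<i> * (u + of_real (pi * \<alpha>)))"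
      unfolding e_def \<zeta> x_def power2_eq_square power3_eq_cube exp_add[symmetric] by (rule arg_cong[of _ _ exp]) (simp add: algebra_simps)
    have "B u = e * qrational \<zeta> N x" by (simp add: B_def e_def x_def)
    also have "\<dots> = e - e * (\<zeta> * x\<^sup>2) - e * (\<zeta>\<^sup>2 * x ^ 3) * qrational \<zeta> N (\<zeta> * x)"
      unfolding Q(2) by (simp only: right_diff_distrib mult.assoc mult_1_right)
    also have "e * (\<zeta>\<^sup>2 * x ^ 3) * qrational \<zeta> N (\<zeta> * x) = exp (\<i> * of_real (3 * pi * \<alpha>) + 6 * \<i> * u) * B (u + of_real (pi * \<alpha>))"
      unfolding B_def shift e2 x_def[symmetric] by (simp only: mult.assoc)
    finally have Bu: "B u = e - exp (\<i> * of_real (25 * pi * \<alpha> / 12) + 5 * \<i> * u) - exp (\<i> * of_real (3 * pi * \<alpha>) + 6 * \<i> * u) * B (u + of_real (pi * \<alpha>))"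
      unfolding e1 .
    have "D u = - (exp (\<i> * of_real (3 * pi * \<alpha>) + 6 * \<i> * u) * D (u + of_real (pi * \<alpha>)))"
    proof -
      have "(e - f - k * a) - (e - f - k * b) = - (k * (a - b))" for f k a b :: complex by (simp add: algebra_simps)
      thus ?thesis unfolding D_def Bu twisted_kernel_functional_equation[OF u(1)] e_def .
    qed
    hence "norm (D u) = norm (exp (\<i> * of_real (3 * pi * \<alpha>) + 6 * \<i> * u)) * norm (D (u + of_real (pi * \<alpha>)))"
      by (simp only: norm_minus_cancel norm_mult)
    also have "norm (exp (\<i> * of_real (3 * pi * \<alpha>) + 6 * \<i> * u)) = exp (- 6 * Im u)" by simp
    finally show "norm (D u) = exp (- 6 * Im u) * norm (D (u + of_real (pi * \<alpha>)))" .
  qed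
  \<comment> \<open>the denominator is invariant under the translation, so the functional equation applies at every step\<close>
  have iter: "norm (D v) = exp (- 6 * Im v) ^ k * norm (D (v + of_nat k * of_real (pi * \<alpha>))) \<and>
       qdenom \<zeta> N (exp (2 * \<i> * (v + of_nat k * of_real (pi * \<alpha>)))) \<noteq> 0" for k
  proof (induction k)
    case (Suc k)
    define u where "u = v + of_nat k * of_real (pi * \<alpha>)"
    have u: "Im u = Im v" by (simp add: u_def)
    have us: "v + of_nat (Suc k) * of_real (pi * \<alpha>) = u + of_real (pi * \<alpha>)" by (simp add: u_def algebra_simps)
    have nz: "qdenom \<zeta> N (exp (2 * \<i> * u)) \<noteq> 0" using Suc.IH by (simp add: u_def)
    have "Im u > 0" using u v by simp
    note st = step[OF this nz]
    have "norm (D v) = exp (- 6 * Im v) ^ k * norm (D u)" using Suc.IH by (simp add: u_def)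
    also have "\<dots> = exp (- 6 * Im v) ^ Suc k * norm (D (u + of_real (pi * \<alpha>)))" unfolding st(1) u by simp
    finally show ?case unfolding us st(2) using nz by simp
  qed (use d in simp)
  have per: "v + of_nat (2 * N) * of_real (pi * \<alpha>) = v + 2 * of_real pi * of_int p"
  proof -
    have "complex_of_real (\<alpha> * real N) = of_int p" unfolding N(2) by simp
    hence "of_nat N * complex_of_real \<alpha> = of_int p" by (simp add: mult.commute)
    thus ?thesis by (simp add: mult_ac)
  qed
  have e2pi: "exp (\<i> * (of_int m * (of_real pi * 2))) = 1" for m :: int by (rule exp_int_period)
  have expv: "exp (\<i> * of_int n * (v + 2 * of_real pi * of_int p)) = exp (\<i> * of_int n * v)" for n :: int
  proof -
    have "\<i> * of_int n * (v + 2 * of_real pi * of_int p) = \<i> * of_int n * v + \<i> * (of_int (n * p) * (of_real pi * 2))"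
      by (simp add: algebra_simps)
    thus ?thesis by (simp only: exp_add e2pi mult_1_right)
  qed
  have "D (v + 2 * of_real pi * of_int p) = D v"
  proof -
    have "twisted_kernel \<alpha> (v + 2 * of_real pi * of_int p) = twisted_kernel \<alpha> v"
      unfolding twisted_kernel_def using expv[of "int _"] by (simp only: of_int_of_nat_eq)
    moreover have "B (v + 2 * of_real pi * of_int p) = B v"
      unfolding B_def exp_add using expv[of 1] expv[of 2] by (simp add: mult_ac)
    ultimately show ?thesis by (simp add: D_def)
  qed
  hence "norm (D v) = exp (- 6 * Im v) ^ (2 * N) * norm (D v)" using iter[of "2 * N"] unfolding per by simp
  moreover have "exp (- 6 * Im v) ^ (2 * N) < 1" using v N by (intro power_less_one_iff[THEN iffD2]) auto
  ultimately have "norm (D v) = 0" by (metis mult_cancel_right1 less_irrefl)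
  thus ?thesis by (simp add: D_def B_def)
qed

lemma linear_approx_at:
  fixes E :: "complex \<Rightarrow> complex"
  assumes "(E has_field_derivative E') (at 0)"
  shows "\<exists>r>0. \<forall>v. norm v < r \<longrightarrow> norm (E v - E 0) \<le> (norm E' + 1) * norm v"
proof -
  have "((\<lambda>v. (E v - E 0) / v) \<longlongrightarrow> E') (at 0)" using assms by (simp add: has_field_derivative_iff)
  hence "\<forall>\<^sub>F v in at 0. dist ((E v - E 0) / v) E' < 1" by (rule tendstoD) simp
  then obtain r where r: "r > 0" "\<And>v. v \<noteq> 0 \<Longrightarrow> norm v < r \<Longrightarrow> dist ((E v - E 0) / v) E' < 1"
    unfolding eventually_at by (auto simp: dist_norm)
  have "norm (E v - E 0) \<le> (norm E' + 1) * norm v" if "norm v < r" for v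
  proof (cases "v = 0")
    case False
    have "norm ((E v - E 0) / v) \<le> norm E' + norm ((E v - E 0) / v - E')"
      using norm_triangle_ineq[of E' "(E v - E 0) / v - E'"] by simp
    also have "\<dots> \<le> norm E' + 1" using r(2)[OF False that] by (simp add: dist_norm)
    finally show ?thesis using False by (simp add: norm_divide divide_le_eq)
  qed simp
  thus ?thesis using r(1) by blast
qed

text \<open>
  The factor \<open>1 - x\<close> contributes the zero at \<open>v = 0\<close>, with slope \<open>-2 \<i>\<close>, and the remaining factor at
  \<open>x = 1\<close> is the value of the series of Kontsevich and Zagier at the root of unity.
\<close>

lemma twisted_kernel_near_0:
  fixes \<alpha> :: real and p :: int
  assumes N: "N > 0" "\<alpha> * real N = of_int p"
    and \<zeta>: "\<zeta> = exp (2 * of_real pi * \<i> * of_real \<alpha>)"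
  shows "\<exists>\<rho> C. \<rho> > 0 \<and> C \<ge> 0 \<and> (\<forall>v. Im v > 0 \<longrightarrow> norm v < \<rho> \<longrightarrow>
     norm (twisted_kernel \<alpha> v - exp (\<i> * of_real (pi * \<alpha> / 12)) * (- 2 * \<i>) * qpoly \<zeta> N 1 * v) \<le> C * (norm v)\<^sup>2)"
proof -
  have \<zeta>N: "\<zeta> ^ N = 1"
  proof -
    have "\<zeta> ^ N = exp (of_nat N * (2 * of_real pi * \<i> * of_real \<alpha>))" by (simp add: \<zeta> exp_of_nat_mult)
    also have "of_nat N * (2 * of_real pi * \<i> * of_real \<alpha>) = 2 * of_real pi * \<i> * of_real (\<alpha> * real N)" by simp
    also have "\<dots> = \<i> * (of_int p * (of_real pi * 2))" unfolding N(2) by simp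
    also have "exp \<dots> = 1" by (rule exp_int_period)
    finally show ?thesis .
  qed
  have "qfac \<zeta> N 1 = 0" unfolding qfac_def using N(1) \<zeta>N by (intro prod_zero bexI[of _ N]) auto
  hence d1: "qdenom \<zeta> N 1 = 1" by (simp add: qdenom_def)
  define h where "h = (\<lambda>v. qdenom \<zeta> N (exp (2 * \<i> * v)))"
  define E where "E = (\<lambda>v. exp (\<i> * of_real (pi * \<alpha> / 12) + \<i> * v) * qpoly \<zeta> N (exp (2 * \<i> * v)) / h v)"
  have h_hol: "h holomorphic_on UNIV"
    unfolding h_def qdenom_def qfac_def by (intro holomorphic_intros)
  hence "isCont h 0"
    using holomorphic_on_imp_continuous_on continuous_on_eq_continuous_at open_UNIV by blast
  hence "(h \<longlongrightarrow> h 0) (nhds 0)" by (simp add: continuous_at_imp_continuous_at_within tendsto_nhds_iff isCont_def)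
  hence "\<forall>\<^sub>F v in nhds 0. h v \<noteq> 0" by (rule tendsto_imp_eventually_ne) (simp add: h_def d1)
  then obtain r0 where r0: "r0 > 0" "\<And>v. norm v < r0 \<Longrightarrow> h v \<noteq> 0"
    unfolding eventually_nhds_metric by (auto simp: dist_norm)
  have "E holomorphic_on ball 0 r0"
    unfolding E_def qpoly_def qfac_def
  proof (intro holomorphic_intros)
    show "h holomorphic_on ball 0 r0" using h_hol holomorphic_on_subset by blast
  qed (use r0(2) in auto)
  hence "E field_differentiable (at 0)"
    by (rule holomorphic_on_imp_differentiable_at) (use r0(1) in auto)
  then obtain E' where "(E has_field_derivative E') (at 0)" unfolding field_differentiable_def by blast
  then obtain r1 where r1: "r1 > 0" "\<And>v. norm v < r1 \<Longrightarrow> norm (E v - E 0) \<le> (norm E' + 1) * norm v"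
    using linear_approx_at by blast
  have E0: "E 0 = exp (\<i> * of_real (pi * \<alpha> / 12)) * qpoly \<zeta> N 1" by (simp add: E_def h_def d1)
  define c where "c = 4 * exp (2 :: real)"
  define \<rho> where "\<rho> = min 1 (min r0 r1)"
  have "norm (twisted_kernel \<alpha> v - exp (\<i> * of_real (pi * \<alpha> / 12)) * (- 2 * \<i>) * qpoly \<zeta> N 1 * v)
          \<le> ((2 + c) * (norm E' + 1) + c * norm (E 0)) * (norm v)\<^sup>2"
    if v: "Im v > 0" "norm v < \<rho>" for v
  proof -
    define x where "x = exp (2 * \<i> * v)"
    have vr: "norm v < 1" "norm v < r0" "norm v < r1" using v by (auto simp: \<rho>_def)
    have "qdenom \<zeta> N (exp (2 * \<i> * v)) \<noteq> 0" using r0(2)[OF vr(2)] by (simp add: h_def)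
    hence A: "twisted_kernel \<alpha> v = (1 - x) * E v"
      using twisted_kernel_eq_qrational[OF N v(1) \<zeta>] by (simp add: E_def h_def qrational_def x_def)
    have t: "norm (1 - x + 2 * \<i> * v) \<le> c * (norm v)\<^sup>2"
    proof -
      have "norm (exp (2 * \<i> * v) - (\<Sum>k\<le>1. (2 * \<i> * v) ^ k / fact k)) \<le> exp \<bar>Re (2 * \<i> * v)\<bar> * norm (2 * \<i> * v) ^ Suc 1 / fact 1"
        by (rule Taylor_exp)
      hence "norm (x - (1 + 2 * \<i> * v)) \<le> exp \<bar>Re (2 * \<i> * v)\<bar> * (4 * (norm v)\<^sup>2)"
        by (simp add: x_def norm_mult power_mult_distrib power2_eq_square)
      also have "\<dots> \<le> exp 2 * (4 * (norm v)\<^sup>2)"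
      proof (rule mult_right_mono)
        have "\<bar>Re (2 * \<i> * v)\<bar> \<le> norm (2 * \<i> * v)" by (rule abs_Re_le_cmod)
        also have "\<dots> \<le> 2" using vr(1) by (simp add: norm_mult)
        finally show "exp \<bar>Re (2 * \<i> * v)\<bar> \<le> exp 2" by simp
      qed simp
      finally have "norm (x - (1 + 2 * \<i> * v)) \<le> c * (norm v)\<^sup>2" by (simp add: c_def)
      moreover have "1 - x + 2 * \<i> * v = - (x - (1 + 2 * \<i> * v))" by simp
      ultimately show ?thesis by (simp only: norm_minus_cancel)
    qed
    have t1: "norm (1 - x) \<le> (2 + c) * norm v"
    proof -
      have "1 - x = - (2 * \<i> * v) + (1 - x + 2 * \<i> * v)" by simp
      hence "norm (1 - x) \<le> norm (- (2 * \<i> * v)) + norm (1 - x + 2 * \<i> * v)" by (metis norm_triangle_ineq)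
      also have "norm (- (2 * \<i> * v)) = 2 * norm v" by (simp add: norm_mult)
      also have "norm (1 - x + 2 * \<i> * v) \<le> c * norm v"
      proof -
        have "(norm v)\<^sup>2 \<le> norm v" using vr(1) by (simp add: power2_eq_square mult_left_le_one_le)
        hence "c * (norm v)\<^sup>2 \<le> c * norm v" by (intro mult_left_mono) (auto simp: c_def)
        thus ?thesis using t by linarith
      qed
      finally show ?thesis by (simp add: distrib_right)
    qed
    have "twisted_kernel \<alpha> v - exp (\<i> * of_real (pi * \<alpha> / 12)) * (- 2 * \<i>) * qpoly \<zeta> N 1 * v
        = (1 - x) * (E v - E 0) + (1 - x + 2 * \<i> * v) * E 0"
      unfolding A E0 by (simp add: algebra_simps)
    also have "norm \<dots> \<le> norm (1 - x) * norm (E v - E 0) + norm (1 - x + 2 * \<i> * v) * norm (E 0)"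
      unfolding norm_mult[symmetric] by (rule norm_triangle_ineq)
    also have "\<dots> \<le> ((2 + c) * norm v) * ((norm E' + 1) * norm v) + (c * (norm v)\<^sup>2) * norm (E 0)"
      by (intro add_mono mult_mono t t1 r1 vr) (auto simp: c_def)
    also have "\<dots> = ((2 + c) * (norm E' + 1) + c * norm (E 0)) * (norm v)\<^sup>2"
      by (simp add: algebra_simps power2_eq_square)
    finally show ?thesis .
  qed
  moreover have "\<rho> > 0" using r0 r1 by (simp add: \<rho>_def)
  moreover have "(2 + c) * (norm E' + 1) + c * norm (E 0) \<ge> 0" by (simp add: c_def)
  ultimately show ?thesis by blast
qed

text \<open>
  The terms of the theta series that the median sum will turn out to be.
\<close>

definition theta_term :: "complex \<Rightarrow> nat \<Rightarrow> complex" where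
  "theta_term x n = of_nat n * chi n * exp (- (of_nat n)\<^sup>2 / (24 * x))"

text \<open>
  For \<open>x = x\<^sub>0 + t\<close> one has \<open>1/x = 1/x\<^sub>0 + 1/X\<close> with \<open>X = -x\<^sub>0 - x\<^sub>0\<^sup>2/t\<close>. The first summand
  becomes the phase in \<open>twisted_chi\<close>, and \<open>X\<close> tends to infinity along a horizontal line, inside every
  sector around the positive axis.
\<close>

lemma theta_sum_limit:
  fixes \<alpha> :: real and p :: int
  assumes N: "N > 0" "\<alpha> * real N = of_int p" and "\<alpha> \<noteq> 0"
    and \<zeta>: "\<zeta> = exp (2 * of_real pi * \<i> * of_real \<alpha>)"
    and x0: "x0 = - 1 / (2 * of_real pi * \<i> * of_real \<alpha>)"
  shows "((\<lambda>t. \<Sum>n. theta_term (x0 + of_real t) n) \<longlongrightarrow> - 2 * (exp (\<i> * of_real (pi * \<alpha> / 12)) * KZ \<zeta>)) (at_right 0)"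
proof -
  define y where "y = 1 / (2 * pi * \<alpha>)"
  have y0: "y \<noteq> 0" using assms(3) by (simp add: y_def)
  have x0y: "x0 = \<i> * of_real y"
  proof -
    have "- 1 / (\<i> * w) = \<i> * (1 / w)" for w :: complex
    proof -
      have "- 1 / (\<i> * w) = (\<i> * \<i>) / (\<i> * w)" by simp
      also have "\<dots> = \<i> / w" by (rule mult_divide_mult_cancel_left) simp
      finally show ?thesis by simp
    qed
    from this[of "2 * of_real pi * of_real \<alpha>"] show ?thesis unfolding x0 y_def by (simp add: mult_ac)
  qed
  \<comment> \<open>with \<open>x0 = i y\<close> this is \<open>-x0 - x0\<^sup>2 / t\<close>\<close>
  define X where "X = (\<lambda>t::real. of_real (y\<^sup>2 / t) - \<i> * of_real y)"
  have ReX: "Re (X t) = y\<^sup>2 / t" "Im (X t) = - y" for t by (simp_all add: X_def)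
  have inv: "1 / (x0 + of_real t) = 1 / x0 + 1 / X t" if t: "t > 0" for t
  proof -
    have nz: "x0 \<noteq> 0" "x0 + of_real t \<noteq> 0" "X t \<noteq> 0" using y0 t by (auto simp: x0y X_def complex_eq_iff)
    have e: "X t * of_real t = - x0 * (x0 + of_real t)"
      using t by (simp add: X_def x0y algebra_simps power2_eq_square)
    have "1 / X t = of_real t / (X t * of_real t)" using t by simp
    hence "1 / X t = - of_real t / (x0 * (x0 + of_real t))" unfolding e by simp
    also have "\<dots> = 1 / (x0 + of_real t) - 1 / x0" using nz by (simp add: field_simps)
    finally show ?thesis by simp
  qed
  have summand: "theta_term (x0 + of_real t) n = of_nat n * twisted_chi \<alpha> n * exp (- (of_nat n)\<^sup>2 / (24 * X t))" if t: "t > 0" for n t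
  proof -
    have "- (of_nat n)\<^sup>2 / (24 * (x0 + of_real t)) = - (of_nat n)\<^sup>2 / 24 * (1 / (x0 + of_real t))" by simp
    also have "\<dots> = - (of_nat n)\<^sup>2 / 24 * (1 / x0) + - (of_nat n)\<^sup>2 / (24 * X t)" unfolding inv[OF t] by (simp add: algebra_simps)
    also have "- (of_nat n)\<^sup>2 / 24 * (1 / x0) = \<i> * of_real (pi * \<alpha> * (real n)\<^sup>2 / 12)" unfolding x0 using assms(3) by (simp add: field_simps)
    finally have "- (of_nat n)\<^sup>2 / (24 * (x0 + of_real t)) = \<i> * of_real (pi * \<alpha> * (real n)\<^sup>2 / 12) + - (of_nat n)\<^sup>2 / (24 * X t)" .
    thus ?thesis unfolding theta_term_def twisted_chi_def by (simp only: exp_add mult.assoc)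
  qed
  define a where "a = exp (\<i> * of_real (pi * \<alpha> / 12)) * (- 2 * \<i>) * qpoly \<zeta> N 1"
  obtain \<rho> C where near: "\<rho> > 0" "C \<ge> 0" "\<And>v. Im v > 0 \<Longrightarrow> norm v < \<rho> \<Longrightarrow> norm (twisted_kernel \<alpha> v - a * v) \<le> C * (norm v)\<^sup>2"
    using twisted_kernel_near_0[OF N \<zeta>] unfolding a_def by blast
  have th: "0 < pi / 4" "pi / 4 < pi / 2" by auto
  have ev: "\<forall>\<^sub>F t in at_right 0. Re (X t) > 0 \<and> Re (cis (pi / 4) * X t) \<ge> 1 / 4 * norm (X t) \<and> Re (cis (- (pi / 4)) * X t) \<ge> 1 / 4 * norm (X t)"
  proof -
    have "\<forall>\<^sub>F t::real in at_right 0. t < \<bar>y\<bar> / 4" 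
      using eventually_at_right_real[of 0 "\<bar>y\<bar> / 4"] y0 by (auto elim: eventually_mono)
    moreover have "\<forall>\<^sub>F t::real in at_right 0. t > 0" by (rule eventually_at_right_less)
    ultimately show ?thesis
    proof eventually_elim
      case (elim t)
      define u where "u = y\<^sup>2 / t"
      have "\<bar>y\<bar> * (4 * t) \<le> \<bar>y\<bar> * \<bar>y\<bar>" using elim by (intro mult_left_mono) auto
      hence u: "u \<ge> 4 * \<bar>y\<bar>" using elim by (simp add: u_def field_simps power2_eq_square)
      have u0: "u > 0" using u y0 by linarith
      have nX: "norm (X t) \<le> u + \<bar>y\<bar>" using cmod_le[of "X t"] u0 by (simp add: ReX u_def)
      have s: "cos (pi / 4) \<ge> 1 / 2" "sin (pi / 4) = cos (pi / 4)"
        unfolding cos_45 sin_45 using real_sqrt_ge_1_iff[of 2] by auto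
      have "1 / 4 * norm (X t) \<le> 1 / 4 * (u + \<bar>y\<bar>)" using nX by simp
      also have "\<dots> \<le> 1 / 2 * (u - \<bar>y\<bar>)" using u by simp
      also have "\<dots> \<le> cos (pi / 4) * (u - \<bar>y\<bar>)" using s u by (intro mult_right_mono) auto
      finally have m: "1 / 4 * norm (X t) \<le> cos (pi / 4) * (u - \<bar>y\<bar>)" .
      have "Re (cis (pi / 4) * X t) = cos (pi / 4) * (u + y)" "Re (cis (- (pi / 4)) * X t) = cos (pi / 4) * (u - y)"
        using s(2) by (simp_all add: ReX u_def algebra_simps)
      moreover have "cos (pi / 4) * (u - \<bar>y\<bar>) \<le> cos (pi / 4) * (u + y)" "cos (pi / 4) * (u - \<bar>y\<bar>) \<le> cos (pi / 4) * (u - y)"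
        using s(1) by (intro mult_left_mono; simp)+
      ultimately show ?case using m u0 by (simp add: ReX flip: u_def)
    qed
  qed
  have lim: "filterlim (\<lambda>t. norm (X t)) at_top (at_right 0)"
  proof (rule filterlim_at_top_mono)
    show "filterlim (\<lambda>t. y\<^sup>2 * inverse t) at_top (at_right 0)"
      using y0 by (intro filterlim_tendsto_pos_mult_at_top[OF tendsto_const] filterlim_inverse_at_top_right) auto
    show "\<forall>\<^sub>F t in at_right 0. y\<^sup>2 * inverse t \<le> norm (X t)"
      using complex_Re_le_cmod[of "X _"] by (simp add: ReX divide_inverse)
  qed
  have quarter: "(0 :: real) < 1 / 4" by simp
  note L = twisted.theta_limit[OF near th quarter ev lim]
  have pos: "\<forall>\<^sub>F t::real in at_right 0. t > 0" by (rule eventually_at_right_less)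
  have KZ: "KZ \<zeta> = qpoly \<zeta> N 1"
  proof (rule KZ_eq_qpoly[OF _ N(1)])
    have "\<zeta> ^ N = exp (of_nat N * (2 * of_real pi * \<i> * of_real \<alpha>))" by (simp add: \<zeta> exp_of_nat_mult)
    also have "of_nat N * (2 * of_real pi * \<i> * of_real \<alpha>) = 2 * of_real pi * \<i> * of_real (\<alpha> * real N)" by simp
    also have "\<dots> = \<i> * (of_int p * (of_real pi * 2))" unfolding N(2) by simp
    also have "exp \<dots> = 1" by (rule exp_int_period)
    finally show "\<zeta> ^ N = 1" .
  qed
  have "- \<i> * a = - 2 * (exp (\<i> * of_real (pi * \<alpha> / 12)) * KZ \<zeta>)" by (simp add: a_def KZ)
  moreover have "((\<lambda>t. \<Sum>n. of_nat n * twisted_chi \<alpha> n * exp (- (of_nat n)\<^sup>2 / (24 * X t))) \<longlongrightarrow> - \<i> * a) (at_right 0)"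
    by (rule L)
  ultimately have "((\<lambda>t. \<Sum>n. of_nat n * twisted_chi \<alpha> n * exp (- (of_nat n)\<^sup>2 / (24 * X t))) \<longlongrightarrow> - 2 * (exp (\<i> * of_real (pi * \<alpha> / 12)) * KZ \<zeta>)) (at_right 0)" by (simp only:)
  thus "((\<lambda>t. \<Sum>n. theta_term (x0 + of_real t) n) \<longlongrightarrow> - 2 * (exp (\<i> * of_real (pi * \<alpha> / 12)) * KZ \<zeta>)) (at_right 0)"
    by (rule Lim_transform_eventually) (use pos in eventually_elim, simp add: summand)
qed

section \<open>From square roots to simple poles\<close>

text \<open>
  Fubini for the function \<open>f r * g (u - r)\<close>, both factors being extended by zero.
\<close>

lemma set_integral_convolution:
  fixes f g :: "real \<Rightarrow> complex"
  assumes f: "set_integrable lborel {0<..} f" and g: "set_integrable lborel {0<..} g"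
  shows "(LINT r:{0<..}|lborel. f r) * (LINT r:{0<..}|lborel. g r) =
    (LINT u:{0<..}|lborel. (LINT r:{0<..<u}|lborel. f r * g (u - r)))"
proof -
  define F where "F = (\<lambda>r::real. indicator {0<..} r *\<^sub>R f r)"
  define G where "G = (\<lambda>r::real. indicator {0<..} r *\<^sub>R g r)"
  have iF: "integrable lborel F" and iG: "integrable lborel G"
    using f g by (simp_all add: F_def G_def set_integrable_def)
  have mF: "F \<in> borel_measurable borel" and mG: "G \<in> borel_measurable borel"
    using iF iG by (auto dest: borel_measurable_integrable)
  have shift: "integrable lborel (\<lambda>u. G (u - r))" "(\<integral>u. G (u - r) \<partial>lborel) = (\<integral>u. G u \<partial>lborel)"
    "(\<integral>u. norm (G (u - r)) \<partial>lborel) = (\<integral>u. norm (G u) \<partial>lborel)" for r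
    using lborel_integrable_real_affine[OF iG, of 1 "- r"] lborel_integral_real_affine[of 1 G "- r"]
      lborel_integral_real_affine[of 1 "\<lambda>u. norm (G u)" "- r"] by simp_all
  have i2: "integrable (lborel \<Otimes>\<^sub>M lborel) (\<lambda>(r, u). F r * G (u - r))"
  proof (rule lborel_pair.Fubini_integrable)
    show "(\<lambda>(r, u). F r * G (u - r)) \<in> borel_measurable (lborel \<Otimes>\<^sub>M lborel)"
      using mF mG by measurable
    show "integrable lborel (\<lambda>x. \<integral>y. norm ((\<lambda>(r, u). F r * G (u - r)) (x, y)) \<partial>lborel)"
      using integrable_norm[OF iF] by (simp add: norm_mult shift(3))
    show "AE x in lborel. integrable lborel (\<lambda>y. (\<lambda>(r, u). F r * G (u - r)) (x, y))"
      using shift(1) by simp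
  qed
  have "(LINT r:{0<..}|lborel. f r) * (LINT r:{0<..}|lborel. g r) = (\<integral>r. F r \<partial>lborel) * (\<integral>u. G u \<partial>lborel)"
    by (simp add: F_def G_def set_lebesgue_integral_def)
  also have "\<dots> = (\<integral>r. (\<integral>u. F r * G (u - r) \<partial>lborel) \<partial>lborel)"
    by (simp add: shift(2))
  also have "\<dots> = (\<integral>u. (\<integral>r. F r * G (u - r) \<partial>lborel) \<partial>lborel)"
    using lborel_pair.Fubini_integral[OF i2] by simp
  also have "\<dots> = (LINT u:{0<..}|lborel. (LINT r:{0<..<u}|lborel. f r * g (u - r)))"
  proof -
    have *: "F r * G (u - r) = indicator {0<..} u *\<^sub>R (indicator {0<..<u} r *\<^sub>R (f r * g (u - r)))" for r u
      by (auto simp: F_def G_def indicator_def)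
    show ?thesis by (simp only: set_lebesgue_integral_def * integral_scaleR_right)
  qed
  finally show ?thesis .
qed

lemma off_axis_notin_nonpos_Reals:
  assumes "a > 0" "sin \<theta> \<noteq> 0"
  shows "of_real a - of_real r * cis \<theta> \<notin> \<real>\<^sub>\<le>\<^sub>0"
  using assms by (auto simp: complex_nonpos_Reals_iff)

lemma norm_off_axis_ge: "\<bar>a * sin \<theta>\<bar> \<le> norm (of_real a - of_real r * cis \<theta>)"
proof -
  have "a * sin \<theta> = Im ((of_real a - of_real r * cis \<theta>) * cnj (- cis \<theta>))"
    by (simp add: algebra_simps)
  hence "\<bar>a * sin \<theta>\<bar> \<le> norm ((of_real a - of_real r * cis \<theta>) * cnj (- cis \<theta>))"
    using abs_Im_le_cmod[of "(of_real a - of_real r * cis \<theta>) * cnj (- cis \<theta>)"] by simp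
  thus ?thesis by (simp add: norm_mult)
qed

text \<open>
  Elementary: an antiderivative is \<open>2/3\<close> times \<open>(u - r)\<^sup>3\<^sup>/\<^sup>2 (a - r e\<^sup>i\<^sup>\<theta>)\<^sup>-\<^sup>3\<^sup>/\<^sup>2 / (u e\<^sup>i\<^sup>\<theta> - a)\<close>.
  The point is that the convolution of \<open>(a - p)\<^sup>-\<^sup>5\<^sup>/\<^sup>2\<close> with \<open>p\<^sup>1\<^sup>/\<^sup>2\<close> has a simple pole in place
  of the branch point.
\<close>

lemma integral_sqrt_over_root_power_five:
  assumes a: "a > 0" and u: "u > 0" and s: "sin \<theta> \<noteq> 0"
  shows "(LINT r:{0<..<u}|lborel. of_real (sqrt (u - r)) / csqrt (of_real a - of_real r * cis \<theta>) ^ 5) =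
    2 / 3 * of_real (sqrt u) ^ 3 / (of_real (sqrt a) ^ 3 * (of_real a - of_real u * cis \<theta>))"
proof -
  define w where "w = cis \<theta>"
  define q where "q = (\<lambda>r::real. csqrt (of_real a - of_real r * w))"
  define d where "d = w * of_real u - of_real a"
  define f where "f = (\<lambda>r. complex_of_real (sqrt (u - r)) / q r ^ 5)"
  define \<Phi> where "\<Phi> = (\<lambda>r. 2 / 3 * of_real (sqrt (u - r)) ^ 3 / (q r ^ 3 * d))"
  have np: "of_real a - of_real r * w \<notin> \<real>\<^sub>\<le>\<^sub>0" for r
    unfolding w_def by (rule off_axis_notin_nonpos_Reals) fact+
  have d0: "d \<noteq> 0" using np[of u] by (auto simp: d_def mult.commute)
  have q0: "q r \<noteq> 0" for r using np[of r] by (auto simp: q_def)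
  have qc: "continuous_on S q" for S
    unfolding q_def using np by (intro continuous_on_compose2[OF continuous_on_csqrt] continuous_intros) auto
  have fc: "continuous_on {0..u} f" unfolding f_def using q0 by (intro continuous_intros qc) auto
  have "(f has_integral \<Phi> u - \<Phi> 0) {0..u}"
  proof (rule fundamental_theorem_of_calculus_interior)
    show "continuous_on {0..u} \<Phi>" unfolding \<Phi>_def using q0 d0 by (intro continuous_intros qc) auto
    fix r assume r: "r \<in> {0<..<u}"
    define c where "c = q r"
    define t where "t = csqrt (of_real (u - r))"
    have ts: "t = of_real (sqrt (u - r))" using r by (simp add: t_def del: of_real_diff)
    have t0: "t \<noteq> 0" using r by (simp add: ts)
    have t2: "t ^ 2 = of_real u - of_real r" by (simp add: t_def)
    have c2: "c ^ 2 = of_real a - of_real r * w" by (simp add: c_def q_def)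
    have c0: "c \<noteq> 0" using q0 by (simp add: c_def)
    have dd: "w * t ^ 2 - c ^ 2 = d" unfolding t2 c2 d_def by (simp add: algebra_simps)
    have "((\<lambda>z. 2 / 3 * csqrt (of_real u - z) ^ 3 / (csqrt (of_real a - z * w) ^ 3 * d)) has_field_derivative
       ((2/3 * (of_nat 3 * (t ^ 2 * ((- 1) / (2 * t))))) * (c ^ 3 * d) - 2/3 * t ^ 3 * (of_nat 3 * (c ^ 2 * ((- w) / (2 * c))) * d)) /
        ((c ^ 3 * d) * (c ^ 3 * d))) (at (of_real r))"
    proof -
      have nu: "of_real u - complex_of_real r \<notin> \<real>\<^sub>\<le>\<^sub>0" using r by (auto simp: complex_nonpos_Reals_iff)
      have tt: "csqrt (of_real u - of_real r) = t" "csqrt (of_real a - of_real r * w) = c" 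
        by (simp_all add: t_def c_def q_def)
      have "((\<lambda>z. of_real u - z) has_field_derivative - 1) (at (of_real r))"
        by (auto intro!: derivative_eq_intros)
      hence S: "((\<lambda>z. csqrt (of_real u - z)) has_field_derivative (- 1) / (2 * t)) (at (of_real r))"
        using has_field_derivative_csqrt'[of "\<lambda>z. of_real u - z" "- 1" "of_real r" UNIV] nu
        by (simp add: tt)
      have "((\<lambda>z. of_real a - z * w) has_field_derivative - w) (at (of_real r))"
        by (auto intro!: derivative_eq_intros)
      hence Q: "((\<lambda>z. csqrt (of_real a - z * w)) has_field_derivative (- w) / (2 * c)) (at (of_real r))"
        using has_field_derivative_csqrt'[of "\<lambda>z. of_real a - z * w" "- w" "of_real r" UNIV] np[of r]
        by (simp add: tt)
      have nz: "csqrt (of_real a - of_real r * w) ^ 3 * d \<noteq> 0" using c0 d0 by (simp add: tt)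
      show ?thesis
        using DERIV_divide[OF DERIV_cmult[OF DERIV_power[OF S, of 3], of "2/3"] DERIV_cmult_right[OF DERIV_power[OF Q, of 3], of d] nz]
        unfolding tt by (simp only: diff_Suc_Suc diff_0 minus_nat.diff_0 numeral_3_eq_3 One_nat_def numeral_2_eq_2 mult.commute mult.left_commute mult.assoc)
    qed
    also have "((2/3 * (of_nat 3 * (t ^ 2 * ((- 1) / (2 * t))))) * (c ^ 3 * d) - 2/3 * t ^ 3 * (of_nat 3 * (c ^ 2 * ((- w) / (2 * c))) * d)) /
        ((c ^ 3 * d) * (c ^ 3 * d)) = t * (w * t ^ 2 - c ^ 2) / (c ^ 5 * d)"
    proof -
      have e: "t ^ 2 * ((- 1) / (2 * t)) = - t / 2" "c ^ 2 * ((- w) / (2 * c)) = - (c * w) / 2"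
        using t0 c0 by (simp_all add: power2_eq_square)
      have "(2/3 * (of_nat 3 * (t ^ 2 * ((- 1) / (2 * t))))) * (c ^ 3 * d) - 2/3 * t ^ 3 * (of_nat 3 * (c ^ 2 * ((- w) / (2 * c))) * d) =
        (2/3 * (3 * (- t / 2))) * (c ^ 3 * d) - 2/3 * t ^ 3 * (3 * (- (c * w) / 2) * d)" by (simp only: e of_nat_numeral)
      also have "\<dots> = (c * d) * (t * (w * t ^ 2 - c ^ 2))"
        by (simp add: power2_eq_square power3_eq_cube algebra_simps)
      finally have N: "(2/3 * (of_nat 3 * (t ^ 2 * ((- 1) / (2 * t))))) * (c ^ 3 * d) - 2/3 * t ^ 3 * (of_nat 3 * (c ^ 2 * ((- w) / (2 * c))) * d) =
        (c * d) * (t * (w * t ^ 2 - c ^ 2))" .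
      have D: "(c ^ 3 * d) * (c ^ 3 * d) = (c * d) * (c ^ 5 * d)" by (simp add: power_def)
      show ?thesis unfolding N D using c0 d0 by (intro nonzero_mult_divide_mult_cancel_left) simp
    qed
    also have "\<dots> = f r" unfolding dd using d0 by (simp add: f_def ts c_def)
    finally have "((\<lambda>r. 2 / 3 * csqrt (of_real u - of_real r) ^ 3 / (csqrt (of_real a - of_real r * w) ^ 3 * d)) has_vector_derivative f r) (at r)"
      by (rule has_vector_derivative_real_field)
    thus "(\<Phi> has_vector_derivative f r) (at r)"
    proof (rule has_vector_derivative_transform_within_open)
      show "open {0<..<u}" "r \<in> {0<..<u}" using r by auto
      fix x assume "x \<in> {0<..<u}"
      thus "2 / 3 * csqrt (of_real u - of_real x) ^ 3 / (csqrt (of_real a - of_real x * w) ^ 3 * d) = \<Phi> x"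
        by (simp add: \<Phi>_def q_def flip: of_real_diff)
    qed
  qed (use u in auto)
  moreover have "(LINT r:{0<..<u}|lborel. f r) = integral {0<..<u} f"
    by (rule set_borel_integral_eq_integral(2)[OF set_integrable_subset[OF borel_integrable_atLeastAtMost'[OF fc]]]) auto
  hence "(LINT r:{0<..<u}|lborel. f r) = integral {0..u} f" by (simp add: integral_open_interval_real)
  ultimately have "(LINT r:{0<..<u}|lborel. f r) = \<Phi> u - \<Phi> 0" by (simp add: integral_unique)
  also have "\<dots> = - (2 / 3 * of_real (sqrt u) ^ 3 / (of_real (sqrt a) ^ 3 * d))"
    using a by (simp add: \<Phi>_def q_def)
  also have "\<dots> = 2 / 3 * of_real (sqrt u) ^ 3 / (of_real (sqrt a) ^ 3 * (- d))"
    by simp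
  also have "- d = of_real a - of_real u * cis \<theta>" by (simp add: d_def w_def)
  finally show ?thesis by (simp add: f_def q_def w_def)
qed

lemma norm_csqrt_squared: "norm (csqrt z) ^ 2 = norm z"
  by (simp flip: norm_power)

text \<open>
  Multiplying a Laplace integral by \<open>z\<^sup>-\<^sup>3\<^sup>/\<^sup>2\<close>, which is the Laplace integral of a square root up to
  a constant, is a convolution under the integral sign.
\<close>

lemma laplace_root_power_five:
  assumes a: "a > 0" and s: "sin \<theta> \<noteq> 0" and z: "Re z > 0"
  shows "set_integrable lborel {0<..} (\<lambda>r. exp (- (of_real r * z)) / csqrt (of_real a - of_real r * cis \<theta>) ^ 5)"
    and "(LINT r:{0<..}|lborel. exp (- (of_real r * z)) / csqrt (of_real a - of_real r * cis \<theta>) ^ 5) *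
       (of_real (sqrt pi / 2) * z powr (- (3/2))) =
     (LINT u:{0<..}|lborel. exp (- (of_real u * z)) *
        (2 / 3 * of_real (sqrt u) ^ 3 / (of_real (sqrt a) ^ 3 * (of_real a - of_real u * cis \<theta>))))"
proof -
  define q where "q = (\<lambda>r::real. csqrt (of_real a - of_real r * cis \<theta>))"
  define f where "f = (\<lambda>r. exp (- (of_real r * z)) / q r ^ 5)"
  define g where "g = (\<lambda>r. of_real (r powr (3/2 - 1)) * exp (- (of_real r * z)))"
  have np: "of_real a - of_real r * cis \<theta> \<notin> \<real>\<^sub>\<le>\<^sub>0" for r
    by (rule off_axis_notin_nonpos_Reals) fact+
  have q0: "q r \<noteq> 0" for r using np[of r] by (auto simp: q_def)
  have qc: "continuous_on S q" for S
    unfolding q_def using np by (intro continuous_on_compose2[OF continuous_on_csqrt] continuous_intros) auto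
  have fi: "set_integrable lborel {0<..} f"
  proof (rule set_integrable_laplace_bound)
    have "continuous_on UNIV f" unfolding f_def using q0 by (intro continuous_intros qc) auto
    thus "f \<in> borel_measurable borel" by (rule borel_measurable_continuous_onI)
    define e where "e = sqrt (a * \<bar>sin \<theta>\<bar>)"
    have e: "e > 0" using a s by (simp add: e_def)
    fix r :: real assume r: "r > 0"
    have "e \<le> norm (q r)"
    proof (unfold e_def, rule real_le_lsqrt)
      show "a * \<bar>sin \<theta>\<bar> \<le> (norm (q r))\<^sup>2"
        using norm_off_axis_ge[of a \<theta> r] a by (simp add: q_def norm_csqrt_squared abs_mult)
    qed auto
    hence "e ^ 5 \<le> norm (q r) ^ 5" using e by (intro power_mono) auto
    hence "exp (- (r * Re z)) / norm (q r) ^ 5 \<le> exp (- (r * Re z)) / e ^ 5"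
      using e by (intro divide_left_mono) (auto simp: q0)
    thus "norm (f r) \<le> (1 / e ^ 5) * (r powr (1 - 1) * exp (- (Re z * r)))"
      using r by (simp add: f_def norm_divide norm_power mult.commute)
  qed (use z in auto)
  thus "set_integrable lborel {0<..} (\<lambda>r. exp (- (of_real r * z)) / csqrt (of_real a - of_real r * cis \<theta>) ^ 5)"
    by (simp add: f_def q_def)
  have gi: "set_integrable lborel {0<..} g" "(LINT r:{0<..}|lborel. g r) = of_real (sqrt pi / 2) * z powr (- (3/2))"
  proof -
    show "set_integrable lborel {0<..} g" unfolding g_def using z by (intro laplace_power) auto
    have "Gamma (3/2 :: real) = sqrt pi / 2"
      using Gamma_plus1[of "1/2 :: real"] nonpos_Ints_nonpos[of "1/2 :: real"] by (auto simp: Gamma_one_half_real)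
    thus "(LINT r:{0<..}|lborel. g r) = of_real (sqrt pi / 2) * z powr (- (3/2))"
      unfolding g_def using laplace_power(2)[of "3/2" z] z by (simp only: \<open>Gamma (3/2) = sqrt pi / 2\<close>) (simp add: \<open>Gamma (3/2) = sqrt pi / 2\<close>)
  qed
  have "(LINT r:{0<..}|lborel. f r) * (LINT r:{0<..}|lborel. g r) =
    (LINT u:{0<..}|lborel. (LINT r:{0<..<u}|lborel. f r * g (u - r)))"
    by (rule set_integral_convolution[OF fi gi(1)])
  also have "\<dots> = (LINT u:{0<..}|lborel. exp (- (of_real u * z)) *
        (2 / 3 * of_real (sqrt u) ^ 3 / (of_real (sqrt a) ^ 3 * (of_real a - of_real u * cis \<theta>))))"
  proof (rule set_lebesgue_integral_cong, simp, intro allI impI)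
    fix u :: real assume "u \<in> {0<..}"
    hence u: "u > 0" by simp
    have "(LINT r:{0<..<u}|lborel. f r * g (u - r)) =
       (LINT r:{0<..<u}|lborel. exp (- (of_real u * z)) * (of_real (sqrt (u - r)) / q r ^ 5))"
    proof (rule set_lebesgue_integral_cong, simp, intro allI impI)
      fix r assume "r \<in> {0<..<u}"
      hence "(u - r) powr (1 / 2) = sqrt (u - r)" by (simp add: powr_half_sqrt)
      moreover have "exp (- (of_real u * z)) = exp (- (of_real r * z)) * exp (- (of_real (u - r) * z))"
        by (simp add: algebra_simps flip: exp_add)
      ultimately show "f r * g (u - r) = exp (- (of_real u * z)) * (of_real (sqrt (u - r)) / q r ^ 5)"
        by (simp add: f_def g_def)
    qed
    also have "\<dots> = exp (- (of_real u * z)) * (LINT r:{0<..<u}|lborel. of_real (sqrt (u - r)) / q r ^ 5)"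
      by (rule set_integral_mult_right)
    also have "(LINT r:{0<..<u}|lborel. of_real (sqrt (u - r)) / q r ^ 5) =
      2 / 3 * of_real (sqrt u) ^ 3 / (of_real (sqrt a) ^ 3 * (of_real a - of_real u * cis \<theta>))"
      unfolding q_def by (rule integral_sqrt_over_root_power_five[OF a u s])
    finally show "(LINT r:{0<..<u}|lborel. f r * g (u - r)) = exp (- (of_real u * z)) *
        (2 / 3 * of_real (sqrt u) ^ 3 / (of_real (sqrt a) ^ 3 * (of_real a - of_real u * cis \<theta>)))" .
  qed
  finally show "(LINT r:{0<..}|lborel. exp (- (of_real r * z)) / csqrt (of_real a - of_real r * cis \<theta>) ^ 5) *
       (of_real (sqrt pi / 2) * z powr (- (3/2))) =
     (LINT u:{0<..}|lborel. exp (- (of_real u * z)) *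
        (2 / 3 * of_real (sqrt u) ^ 3 / (of_real (sqrt a) ^ 3 * (of_real a - of_real u * cis \<theta>))))"
    unfolding gi(2) by (simp add: f_def q_def)
qed

section \<open>The median sum is a theta series\<close>

text \<open>
  The generating function of \<open>chi\<close> up to a constant, see \<open>twisted_kernel_0\<close>; unlike the series it is
  defined on both sides of the real axis, and it is odd.
\<close>

definition trig_kernel :: "complex \<Rightarrow> complex" where
  "trig_kernel v = sin (2 * v) / cos (3 * v)"

lemma trig_kernel_minus: "trig_kernel (- v) = - trig_kernel v"
  by (simp add: trig_kernel_def)

lemma twisted_kernel_0:
  assumes "Im v > 0"
  shows "twisted_kernel 0 v = - \<i> * trig_kernel v"
proof -
  define A where "A = twisted_kernel 0 v"
  define X where "X = exp (\<i> * (3 * v))"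
  have X0: "X \<noteq> 0" by (simp add: X_def)
  have "A = exp (\<i> * v) - exp (5 * \<i> * v) - exp (6 * \<i> * v) * A"
    using twisted_kernel_functional_equation[OF assms, of 0] by (simp add: A_def)
  hence A: "A * (1 + exp (6 * \<i> * v)) = exp (\<i> * v) - exp (5 * \<i> * v)" by (simp add: algebra_simps)
  have e6: "1 + exp (6 * \<i> * v) = X * (2 * cos (3 * v))"
  proof -
    have "X * X = exp (\<i> * (3 * v) + \<i> * (3 * v))" by (simp only: X_def exp_add)
    also have "\<i> * (3 * v) + \<i> * (3 * v) = 6 * \<i> * v" by simp
    finally have "X * X = exp (6 * \<i> * v)" .
    moreover have "X * exp (- (\<i> * (3 * v))) = 1" by (simp add: X_def flip: exp_add)
    moreover have "2 * cos (3 * v) = X + exp (- (\<i> * (3 * v)))" by (simp add: cos_exp_eq X_def)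
    ultimately show ?thesis by (simp add: distrib_left)
  qed
  have e5: "exp (\<i> * v) - exp (5 * \<i> * v) = X * (- 2 * \<i> * sin (2 * v))"
  proof -
    have "X * exp (- (\<i> * (2 * v))) = exp (\<i> * v)" "X * exp (\<i> * (2 * v)) = exp (5 * \<i> * v)"
      unfolding X_def by (simp_all add: algebra_simps flip: exp_add)
    moreover have "- 2 * \<i> * sin (2 * v) = exp (- (\<i> * (2 * v))) - exp (\<i> * (2 * v))" by (simp add: sin_exp_eq)
    ultimately show ?thesis by (simp add: right_diff_distrib)
  qed
  have n1: "norm (exp (6 * \<i> * v)) < 1" using assms by simp
  have "1 + exp (6 * \<i> * v) \<noteq> 0"
  proof
    assume "1 + exp (6 * \<i> * v) = 0"
    hence "exp (6 * \<i> * v) = - 1" by (simp only: add_eq_0_iff)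
    thus False using n1 by simp
  qed
  hence c0: "cos (3 * v) \<noteq> 0" unfolding e6 by auto
  have "X * (2 * (A * cos (3 * v))) = X * (2 * (- \<i> * sin (2 * v)))"
    using A unfolding e6 e5 by (simp only: mult_ac mult_minus_left mult_minus_right)
  hence "2 * (A * cos (3 * v)) = 2 * (- \<i> * sin (2 * v))" by (rule iffD1[OF mult_left_cancel[OF X0]])
  hence "A * cos (3 * v) = - \<i> * sin (2 * v)" by (rule iffD1[OF mult_left_cancel[of "2 :: complex", OF zero_neq_numeral[symmetric]]])
  hence "A = - \<i> * sin (2 * v) / cos (3 * v)" by (rule iffD2[OF nonzero_eq_divide_eq[OF c0]])
  thus ?thesis by (simp add: A_def trig_kernel_def)
qed

lemma not_in_sings_off_axis:
  assumes "Im p \<noteq> 0" shows "p \<notin> sings"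
  using assms by (auto simp: sings_def)

text \<open>
  Term by term, convolution with the square root turns the Borel transform into
  \<open>chi m / (a (a - p))\<close> with \<open>a = sing m\<close>. Splitting this as \<open>(1/(a - p) - 1/a) / p\<close>, the first part sums to
  \<open>trig_kernel\<close> by partial fractions, and the second to the constant term of the series.
\<close>

lemma ray_laplace_branch_sum:
  assumes th: "\<bar>\<theta>\<bar> < pi / 2" "sin \<theta> \<noteq> 0" and x: "Re x > 0" "Re (cis \<theta> * x) > 0"
  shows "set_integrable lborel {0<..} (\<lambda>r. exp (- (of_real r * (cis \<theta> * x))) * branch_sum principal_root (of_real r * cis \<theta>))"
    and "(cis \<theta> * (LINT r:{0<..}|lborel. exp (- (of_real r * (cis \<theta> * x))) * branch_sum principal_root (of_real r * cis \<theta>)) + fps_nth KZ_F 0)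
           * (of_real (sqrt pi / 2) * x powr (- (3 / 2)))
         = root6 / 2 * ray_int 1 \<theta> x (\<lambda>w. trig_kernel (w / root6))"
proof -
  define w where "w = cis \<theta>"
  define h where "h = cis (\<theta> / 2)"
  define z where "z = cis \<theta> * x"
  define s where "s = \<bar>sin \<theta>\<bar>"
  define c0 where "c0 = fps_nth KZ_F 0"
  define a where "a = sing"
  define K where "K = of_real (sqrt pi / 2) * z powr (- (3 / 2))"
  define k where "k = (\<lambda>m. complex_of_real (3 * sqrt 3 / 2) * chi m * of_real (sqrt (a m)))"
  define e where "e = (\<lambda>r::real. exp (- (of_real r * z)))"
  define f where "f = (\<lambda>m r. k m * (e r / csqrt (of_real (a m) - of_real r * w) ^ 5))"
  define g where "g = (\<lambda>m u. k m * (e u * (2 / 3 * of_real (sqrt u) ^ 3 / (of_real (sqrt (a m)) ^ 3 * (of_real (a m) - of_real u * w)))))"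
  define v where "v = (\<lambda>u::real. h * of_real (sqrt u) / root6)"
  define G where "G = (\<lambda>u. root6 / (2 * (w * h)) * (e u * trig_kernel (v u)) - c0 / (w * h) * (e u * (h * of_real (sqrt u))))"
  have s: "s > 0" using th(2) by (simp add: s_def)
  have z: "Re z > 0" using x(2) by (simp add: z_def)
  have a: "a m > 0" if "m > 0" for m using that by (simp add: a_def sing_pos)
  have k_0: "k 0 = 0" by (simp add: k_def)
  have w0: "w \<noteq> 0" "h \<noteq> 0" by (simp_all add: w_def h_def)
  have hh: "h ^ 2 = w" by (simp add: h_def w_def power2_eq_square cis_mult)
  have c0: "c0 = sqrt 3 * moment 1"
    unfolding c0_def KZ_F_nth_moment by (simp add: fact_numeral)
  have far: "a m * s \<le> norm (of_real (a m) - of_real r * w)" for m r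
    using norm_off_axis_ge[of "a m" \<theta> r] sing_nonneg[of m] by (simp add: w_def s_def a_def abs_mult)
  have off: "of_real r * w \<notin> sings" if "r > 0" for r
    using that th(2) by (intro not_in_sings_off_axis) (simp add: w_def)
  have norm_e: "norm (e r) = exp (- (Re z * r))" for r by (simp add: e_def mult.commute)
  note base = laplace_root_power_five[OF a th(2) z]
  have fi: "set_integrable lborel {0<..} (f m)" for m
  proof (cases "m = 0")
    case False
    thus ?thesis unfolding f_def e_def w_def by (intro set_integrable_mult_right base(1)) simp
  qed (simp add: f_def k_0 set_integrable_def)
  have fg: "(LINT r:{0<..}|lborel. f m r) * K = (LINT u:{0<..}|lborel. g m u)" for m
  proof (cases "m = 0")
    case False
    thus ?thesis unfolding f_def g_def set_integral_mult_right mult.assoc e_def w_def K_def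
      by (subst base(2)[symmetric]) simp_all
  qed (simp add: f_def g_def k_0)
  have f_sums: "(\<lambda>m. f m r) sums (e r * branch_sum principal_root (of_real r * w))" if "r > 0" for r
  proof -
    have "summable (\<lambda>m. 3 * sqrt 3 / 2 * chi m * sqrt (sing m) / principal_root m (of_real r * w) ^ 5)"
      by (rule branch_sum_summable[where \<sigma> = principal_root, OF off[OF that] principal_root_sq])
    hence "(\<lambda>m. e r * (3 * sqrt 3 / 2 * chi m * sqrt (sing m) / principal_root m (of_real r * w) ^ 5)) sums
       (e r * branch_sum principal_root (of_real r * w))"
      unfolding branch_sum_def by (intro sums_mult summable_sums)
    thus ?thesis by (simp add: f_def k_def principal_root_def a_def mult_ac)
  qed
  define D where "D = 3 * sqrt 3 / 2 / sqrt s ^ 5"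
  have f_le: "norm (f m r) \<le> D * (1 / a m ^ 2) * exp (- (Re z * r))" for m r
  proof (cases "m = 0")
    case False
    hence am: "a m > 0" by (intro a) simp
    define N where "N = norm (csqrt (of_real (a m) - of_real r * w))"
    have "sqrt (a m * s) \<le> N"
      using far[of m r] by (intro real_le_lsqrt) (simp_all add: N_def norm_csqrt_squared)
    hence "sqrt (a m) * sqrt s \<le> N" by (simp add: real_sqrt_mult)
    hence N: "(sqrt (a m) * sqrt s) ^ 5 \<le> N ^ 5" using am s by (intro power_mono) auto
    have "norm (k m) \<le> 3 * sqrt 3 / 2 * sqrt (a m)"
      using norm_chi_le[of m] am by (simp add: k_def norm_mult mult_left_le)
    hence "norm (k m) / N ^ 5 \<le> 3 * sqrt 3 / 2 * sqrt (a m) / (sqrt (a m) * sqrt s) ^ 5"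
      using N am s by (intro frac_le) auto
    also have "\<dots> = D * (sqrt (a m) / sqrt (a m) ^ 5)"
      by (simp add: D_def power_mult_distrib)
    also have "sqrt (a m) ^ 5 = sqrt (a m) * ((sqrt (a m))\<^sup>2)\<^sup>2"
    proof -
      have "y ^ 5 = y * (y\<^sup>2)\<^sup>2" for y :: real by (simp add: power_numeral_reduce mult_ac)
      thus ?thesis .
    qed
    also have "sqrt (a m) / (sqrt (a m) * ((sqrt (a m))\<^sup>2)\<^sup>2) = 1 / a m ^ 2" using am by simp
    finally have "norm (k m) / N ^ 5 * exp (- (Re z * r)) \<le> D * (1 / a m ^ 2) * exp (- (Re z * r))"
      by (intro mult_right_mono) auto
    moreover have "norm (f m r) = norm (k m) / N ^ 5 * exp (- (Re z * r))"
      unfolding f_def norm_mult norm_divide norm_power norm_e N_def by (simp only: times_divide_eq_right times_divide_eq_left)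
    ultimately show ?thesis by (simp only:)
  qed (simp add: f_def k_0 a_def sing_def)
  define M where "M = (\<Sum>m. 1 / a m ^ 2)"
  have sumM: "summable (\<lambda>m. 1 / a m ^ 2)" unfolding a_def by (rule summable_inverse_sing_power) simp
  have partial: "(\<Sum>m<n. 1 / a m ^ 2) \<le> M" for n
    unfolding M_def by (intro sum_le_suminf sumM) auto
  have expi: "set_integrable lborel {0<..} (\<lambda>r. C * (r powr (p - 1) * exp (- (Re z * r))))" if "p > 0" for C p :: real
    using that z by (intro set_integrable_mult_right laplace_power_real) auto
  have f_dom: "norm (\<Sum>m<n. f m r) \<le> D * M * (r powr (1 - 1) * exp (- (Re z * r)))" if "r \<in> {0<..}" for n r
  proof -
    have "norm (\<Sum>m<n. f m r) \<le> (\<Sum>m<n. D * (1 / a m ^ 2) * exp (- (Re z * r)))"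
      by (rule sum_norm_le) (rule f_le)
    also have "\<dots> = D * (\<Sum>m<n. 1 / a m ^ 2) * exp (- (Re z * r))"
      by (simp add: sum_distrib_left sum_distrib_right)
    also have "\<dots> \<le> D * M * exp (- (Re z * r))"
      using s by (intro mult_right_mono mult_left_mono partial) (auto simp: D_def)
    finally show ?thesis using that by simp
  qed
  note F = set_integral_dominated_sums[of "{0<..}" f, OF fi expi[of 1 "D * M"] _ f_sums f_dom]
  show "set_integrable lborel {0<..} (\<lambda>r. exp (- (of_real r * (cis \<theta> * x))) * branch_sum principal_root (of_real r * cis \<theta>))"
    using F(1) by (simp add: e_def w_def z_def)
  define L where "L = (LINT r:{0<..}|lborel. e r * branch_sum principal_root (of_real r * w))"
  have L: "(\<lambda>m. LINT r:{0<..}|lborel. f m r) sums L"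
    unfolding L_def by (rule F(2)) auto
  have g_eq: "g m u = e u * of_real (sqrt u) ^ 3 * (of_real (sqrt 3) * (chi m / (of_real (a m) * (of_real (a m) - of_real u * w))))" for m u
  proof (cases "m = 0")
    case False
    hence am: "complex_of_real (sqrt (a m)) \<noteq> 0" "a m \<ge> 0" using a[of m] by auto
    define b where "b = complex_of_real (sqrt (a m))"
    have b: "b \<noteq> 0" "of_real (a m) = b * b" using am by (simp_all add: b_def flip: of_real_mult)
    have "complex_of_real (3 * sqrt 3 / 2) * b * (2 / 3 / b ^ 3) = of_real (sqrt 3) / (b * b)"
      using b(1) by (simp add: power3_eq_cube)
    hence eq: "complex_of_real (3 * sqrt 3 / 2) * b * (2 / 3 / b ^ 3) = of_real (sqrt 3) / of_real (a m)" by (simp only: b(2))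
    have "g m u = (complex_of_real (3 * sqrt 3 / 2) * b * (2 / 3 / b ^ 3)) * (chi m * e u * of_real (sqrt u) ^ 3 / (of_real (a m) - of_real u * w))"
      unfolding g_def k_def b_def[symmetric] by (simp add: mult_ac)
    thus ?thesis unfolding eq by (simp add: mult_ac)
  qed (simp add: g_def k_0)
  have g_sums: "(\<lambda>m. g m u) sums G u" if u: "u > 0" for u
  proof -
    define p where "p = of_real u * w"
    have p0: "p \<noteq> 0" using u w0 by (simp add: p_def)
    have ps: "p \<notin> sings" using off[OF u] by (simp add: p_def)
    have r6: "root6 \<noteq> 0" "root6 ^ 2 = 6" by (simp_all flip: of_real_power)
    have su: "complex_of_real (sqrt u) \<noteq> 0" "complex_of_real (sqrt u) ^ 2 = of_real u" using u by (simp_all flip: of_real_power)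
    have pv: "6 * v u ^ 2 = p"
      unfolding v_def p_def power_divide power_mult_distrib r6 su hh by simp
    have v0: "v u \<noteq> 0" using su w0 r6 by (simp add: v_def)
    have S1: "(\<lambda>m. chi m / (of_real (a m) - p)) sums (of_real (sqrt 3) * trig_kernel (v u) / (6 * v u))"
    proof -
      have "(\<lambda>m. 6 * v u * (chi m / (of_real (sing m) - 6 * v u ^ 2)) / (6 * v u)) sums
         (sqrt 3 * sin (2 * v u) / cos (3 * v u) / (6 * v u))"
        using sin_cos_partial_fractions[of "v u"] ps pv by (intro sums_divide) simp
      thus ?thesis using v0 by (simp add: pv a_def trig_kernel_def)
    qed
    have S2: "(\<lambda>m. chi m / of_real (a m)) sums moment 1"
      using summable_sums[OF summable_norm_cancel[OF summable_moment[of 1]]] by (simp add: moment_def a_def)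
    \<comment> \<open>the split that separates \<open>trig_kernel\<close> from the constant term\<close>
    have t: "chi m / (of_real (a m) * (of_real (a m) - p)) = 1 / p * (chi m / (of_real (a m) - p) - chi m / of_real (a m))" for m
    proof (cases "m = 0")
      case False
      hence "complex_of_real (a m) \<noteq> 0" "of_real (a m) - p \<noteq> 0"
        using a[of m] ps sing_in_sings[of m] by (auto simp: a_def)
      thus ?thesis using p0 by (simp add: field_simps)
    qed simp
    have "(\<lambda>m. g m u) sums (e u * of_real (sqrt u) ^ 3 * (of_real (sqrt 3) * (1 / p * (of_real (sqrt 3) * trig_kernel (v u) / (6 * v u) - moment 1))))"
      unfolding g_eq p_def[symmetric] t by (intro sums_mult sums_diff S1 S2)
    also have "e u * of_real (sqrt u) ^ 3 * (of_real (sqrt 3) * (1 / p * (of_real (sqrt 3) * trig_kernel (v u) / (6 * v u) - moment 1))) = G u"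
    proof -
      have u3: "of_real (sqrt u) ^ 3 / p = of_real (sqrt u) / w"
        using su w0 u by (simp add: p_def power3_eq_cube field_simps flip: su(2)) (simp add: power2_eq_square)
      have "e u * of_real (sqrt u) ^ 3 * (of_real (sqrt 3) * (1 / p * (of_real (sqrt 3) * trig_kernel (v u) / (6 * v u) - moment 1))) =
         e u * (of_real (sqrt u) ^ 3 / p) * (of_real (sqrt 3) * of_real (sqrt 3) * trig_kernel (v u) / (6 * v u) - of_real (sqrt 3) * moment 1)"
        by (simp add: algebra_simps)
      also have "of_real (sqrt 3) * of_real (sqrt 3) = (3 :: complex)" by (simp flip: of_real_mult)
      also have "e u * (of_real (sqrt u) ^ 3 / p) * (3 * trig_kernel (v u) / (6 * v u) - of_real (sqrt 3) * moment 1) =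
          (of_real (sqrt u) / (2 * v u)) / w * (e u * trig_kernel (v u)) - c0 / w * (e u * of_real (sqrt u))"
        unfolding u3 c0 by (simp add: algebra_simps)
      also have "of_real (sqrt u) / (2 * v u) = root6 / (2 * h)"
        using su w0 by (simp add: v_def)
      also have "root6 / (2 * h) / w * (e u * trig_kernel (v u)) - c0 / w * (e u * of_real (sqrt u)) = G u"
        using w0 by (simp add: G_def)
      finally show ?thesis .
    qed
    finally show ?thesis .
  qed
  define B where "B = sqrt 3 / s"
  have g_le: "norm (g m u) \<le> B * (1 / a m ^ 2) * (u powr (5/2 - 1) * exp (- (Re z * u)))" if u: "u > 0" for m u
  proof (cases "m = 0")
    case False
    hence am: "a m > 0" by (intro a) simp
    define N where "N = norm (of_real (a m) - of_real u * w)"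
    have "u powr (5/2 - 1) = u powr (1 + 1/2)" by simp
    also have "\<dots> = u * sqrt u" using u by (simp only: powr_add) (simp add: powr_half_sqrt)
    also have "\<dots> = sqrt u ^ 3" using u by (simp add: power3_eq_cube)
    finally have u52: "sqrt u ^ 3 = u powr (5/2 - 1)" by simp
    have "norm (chi m) / (a m * N) \<le> 1 / (a m * (a m * s))"
      using far[of m u] norm_chi_le[of m] am s by (intro frac_le mult_left_mono) (auto simp: N_def)
    hence "sqrt 3 * (norm (chi m) / (a m * N)) * (u powr (5/2 - 1) * exp (- (Re z * u))) \<le>
      sqrt 3 * (1 / (a m * (a m * s))) * (u powr (5/2 - 1) * exp (- (Re z * u)))"
      by (intro mult_right_mono mult_left_mono) auto
    also have "sqrt 3 * (1 / (a m * (a m * s))) = B * (1 / a m ^ 2)" by (simp add: B_def power2_eq_square)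
    also have "sqrt 3 * (norm (chi m) / (a m * N)) * (u powr (5/2 - 1) * exp (- (Re z * u))) = norm (g m u)"
      unfolding g_eq u52[symmetric] N_def using am u
      by (simp add: norm_mult norm_divide norm_power norm_e mult_ac)
    finally show ?thesis .
  qed (simp add: g_def k_0 a_def sing_def)
  have gi: "set_integrable lborel {0<..} (g m)" for m
  proof (cases "m = 0")
    case False
    have nz: "of_real (a m) - of_real u * w \<noteq> 0" for u
      using off_axis_notin_nonpos_Reals[of "a m" \<theta> u] a[of m] th(2) False by (auto simp: w_def)
    show ?thesis
    proof (rule set_integrable_laplace_bound[where s = "5/2" and b = "Re z"])
      have "continuous_on UNIV (g m)"
        unfolding g_def e_def using nz a[of m] False by (intro continuous_intros) auto
      thus "g m \<in> borel_measurable borel" by (rule borel_measurable_continuous_onI)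
    qed (use z in simp, use z in simp, rule g_le)
  qed (simp add: g_def k_0 set_integrable_def)
  have g_dom: "norm (\<Sum>m<n. g m u) \<le> B * M * (u powr (5/2 - 1) * exp (- (Re z * u)))" if "u \<in> {0<..}" for n u
  proof -
    have "norm (\<Sum>m<n. g m u) \<le> (\<Sum>m<n. B * (1 / a m ^ 2) * (u powr (5/2 - 1) * exp (- (Re z * u))))"
      by (rule sum_norm_le) (use g_le that in simp)
    also have "\<dots> = B * (\<Sum>m<n. 1 / a m ^ 2) * (u powr (5/2 - 1) * exp (- (Re z * u)))"
      by (simp add: sum_distrib_left sum_distrib_right)
    also have "\<dots> \<le> B * M * (u powr (5/2 - 1) * exp (- (Re z * u)))"
      using s by (intro mult_right_mono mult_left_mono partial) (auto simp: B_def)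
    finally show ?thesis .
  qed
  note GG = set_integral_dominated_sums[of "{0<..}" g, OF gi expi[of "5/2" "B * M"] _ g_sums g_dom]
  have Gi: "set_integrable lborel {0<..} G" by (rule GG(1)) auto
  have "(\<lambda>m. LINT u:{0<..}|lborel. g m u) sums (LINT u:{0<..}|lborel. G u)" by (rule GG(2)) auto
  moreover have "(\<lambda>m. LINT u:{0<..}|lborel. g m u) sums (L * K)"
    unfolding fg[symmetric] by (intro sums_mult2 L)
  ultimately have LK: "L * K = (LINT u:{0<..}|lborel. G u)" by (rule sums_unique2[rotated])
  define J where "J = (\<lambda>u. e u * (h * of_real (sqrt u)))"
  define P where "P = of_real (sqrt pi / 2) * x powr (- (3 / 2))"
  define T where "T = (LINT u:{0<..}|lborel. e u * trig_kernel (v u))"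
  have Ji: "set_integrable lborel {0<..} J" "w * (LINT u:{0<..}|lborel. J u) = P"
    using ray_int_id[OF th(1) x] by (simp_all add: J_def e_def h_def w_def z_def P_def)
  have r6: "root6 \<noteq> 0" by simp
  have TG: "e u * trig_kernel (v u) = 2 * (w * h) / root6 * G u + 2 * c0 / root6 * J u" for u
  proof -
    have "2 * (w * h) / root6 * G u = (2 * (w * h) / root6 * (root6 / (2 * (w * h)))) * (e u * trig_kernel (v u)) 
       - (2 * (w * h) / root6 * (c0 / (w * h))) * J u"
      by (simp only: G_def J_def right_diff_distrib mult.assoc)
    also have "2 * (w * h) / root6 * (root6 / (2 * (w * h))) = 1" using w0 by simp
    also have "2 * (w * h) / root6 * (c0 / (w * h)) = 2 * c0 / root6" using w0 by simp
    finally show ?thesis by simp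
  qed
  have "T = 2 * (w * h) / root6 * (LINT u:{0<..}|lborel. G u) + 2 * c0 / root6 * (LINT u:{0<..}|lborel. J u)"
    unfolding T_def TG by (subst set_integral_add(2)) (auto intro!: set_integrable_mult_right Gi Ji)
  hence "root6 / 2 * (w * T) = w * ((root6 / 2 * (2 * (w * h) / root6)) * (L * K)) + (root6 / 2 * (2 * c0 / root6)) * (w * (LINT u:{0<..}|lborel. J u))"
    unfolding LK by (simp only: distrib_left mult_ac)
  also have "root6 / 2 * (2 * (w * h) / root6) = w * h" by simp
  also have "root6 / 2 * (2 * c0 / root6) = c0" by simp
  also have "w * (w * h * (L * K)) + c0 * (w * (LINT u:{0<..}|lborel. J u)) = (w * L + c0) * P"
  proof -
    have "w * h = cis (3 / 2 * \<theta>)" by (simp add: w_def h_def cis_mult)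
    hence "w * h * K = P"
      using ray_power[OF th(1) x(1), of "3/2"] by (simp add: K_def P_def z_def mult_ac)
    thus ?thesis unfolding Ji(2) by (simp add: distrib_left distrib_right mult_ac)
  qed
  finally show "(cis \<theta> * (LINT r:{0<..}|lborel. exp (- (of_real r * (cis \<theta> * x))) * branch_sum principal_root (of_real r * cis \<theta>)) + fps_nth KZ_F 0)
           * (of_real (sqrt pi / 2) * x powr (- (3 / 2)))
         = root6 / 2 * ray_int 1 \<theta> x (\<lambda>w. trig_kernel (w / root6))"
    unfolding ray_int_1 by (simp add: T_def L_def P_def c0_def e_def v_def w_def h_def z_def)
qed

text \<open>
  Off the real axis no \<open>sing m - p\<close> meets the cut of the principal root; a disc around \<open>0\<close> has to be
  added because the ray starts there.
\<close>

lemma continued_value_on_ray: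
  assumes th: "\<bar>\<theta>\<bar> < pi / 2" "sin \<theta> \<noteq> 0" and r: "r > 0"
  shows "continued_value (eval_fps (borel_transform KZ_F)) (linepath 0 (of_real r * cis \<theta>)) = branch_sum principal_root (of_real r * cis \<theta>)"
proof -
  define p where "p = of_real r * cis \<theta>"
  define S where "S = {p :: complex. Im p \<noteq> 0} \<union> ball 0 1"
  have opn: "open S"
    unfolding S_def by (intro open_Un open_ball open_Collect_neq continuous_intros)
  have p: "Im p \<noteq> 0" using th r by (simp add: p_def)
  have disj: "S \<inter> sings = {}"
    using not_in_sings_off_axis not_in_sings sing_1_gt_1 by (force simp: S_def)
  have "continuation_along (eval_fps (borel_transform KZ_F)) (linepath 0 p) (branch_sum principal_root)"
  proof (rule continuation_along_holomorphic[where S = S])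
    show "path_image (linepath 0 p) \<subseteq> S"
    proof
      fix y assume "y \<in> path_image (linepath 0 p)"
      then obtain t where t: "y = of_real t * p" "t \<ge> 0" by (auto simp: in_segment scaleR_conv_of_real)
      thus "y \<in> S" using p by (cases "t = 0") (auto simp: S_def)
    qed
    show "branch_sum principal_root holomorphic_on S"
    proof (rule branch_sum_holomorphic[where \<sigma> = principal_root, OF opn disj _ principal_root_sq])
      fix m :: nat assume m: "m > 0"
      have "of_real (sing m) - y \<notin> \<real>\<^sub>\<le>\<^sub>0" if "y \<in> S" for y
      proof (cases "Im y = 0")
        case True
        hence "norm y < 1" using that by (simp add: S_def)
        moreover have "1 \<le> sing m"
        proof -
          have "1 \<le> real m ^ 2" using m by simp
          thus ?thesis using sing_ge[of m] by linarith
        qed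
        ultimately show ?thesis using complex_Re_le_cmod[of y] by (simp add: complex_nonpos_Reals_iff)
      qed (simp add: complex_nonpos_Reals_iff)
      thus "principal_root m holomorphic_on S"
        unfolding principal_root_def by (intro holomorphic_intros)
    qed
    have "\<forall>\<^sub>F z in nhds 0. z \<in> ball (0 :: complex) (sing 1)"
      using sing_1_gt_1 by (intro eventually_nhds_in_open) auto
    thus "\<forall>\<^sub>F z in nhds (pathstart (linepath 0 p)). branch_sum principal_root z = eval_fps (borel_transform KZ_F) z"
      unfolding pathstart_linepath by eventually_elim (auto simp: eval_fps_borel_transform_KZ_F)
  qed (use opn in auto)
  from continued_value_eq[OF this] show ?thesis by (simp add: p_def)
qed

lemma laplace_integrand_KZ_F:
  assumes th: "\<bar>\<theta>\<bar> < pi / 2" "sin \<theta> \<noteq> 0" and x: "Re x > 0" "Re (cis \<theta> * x) > 0"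
  shows "set_integrable lborel {0<..} (laplace_integrand KZ_F x \<theta>)"
    and "((LINT r:{0<..}|lborel. laplace_integrand KZ_F x \<theta> r) + fps_nth KZ_F 0) * (of_real (sqrt pi / 2) * x powr (- (3 / 2)))
         = root6 / 2 * ray_int 1 \<theta> x (\<lambda>w. trig_kernel (w / root6))"
proof -
  define f where "f = (\<lambda>r. cis \<theta> * (exp (- (of_real r * (cis \<theta> * x))) * branch_sum principal_root (of_real r * cis \<theta>)))"
  have eq: "laplace_integrand KZ_F x \<theta> r = f r" if "r \<in> {0<..}" for r
    using continued_value_on_ray[OF th, of r] that by (simp add: laplace_integrand_def f_def mult_ac)
  have fi: "set_integrable lborel {0<..} f"
    unfolding f_def by (intro set_integrable_mult_right ray_laplace_branch_sum assms)
  show "set_integrable lborel {0<..} (laplace_integrand KZ_F x \<theta>)"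
    by (rule iffD2[OF set_integrable_cong fi]) (use eq in auto)
  have "(LINT r:{0<..}|lborel. laplace_integrand KZ_F x \<theta> r) = (LINT r:{0<..}|lborel. f r)"
    by (rule set_lebesgue_integral_cong) (use eq in auto)
  also have "\<dots> = cis \<theta> * (LINT r:{0<..}|lborel. exp (- (of_real r * (cis \<theta> * x))) * branch_sum principal_root (of_real r * cis \<theta>))"
    unfolding f_def by (rule set_integral_mult_right)
  finally show "((LINT r:{0<..}|lborel. laplace_integrand KZ_F x \<theta> r) + fps_nth KZ_F 0) * (of_real (sqrt pi / 2) * x powr (- (3 / 2)))
         = root6 / 2 * ray_int 1 \<theta> x (\<lambda>w. trig_kernel (w / root6))"
    using ray_laplace_branch_sum(2)[OF assms] by simp
qed

text \<open>
  Add \<open>ray_laplace_branch_sum\<close> for \<open>\<theta>\<close> and \<open>-\<theta>\<close>. As \<open>trig_kernel\<close> is odd, the sum of the two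
  integrals is, up to a constant, the difference in \<open>theta_representation\<close> for the untwisted weights.
\<close>

lemma median_representation:
  assumes th: "0 < \<theta>" "\<theta> < pi / 2" and x: "Re x > 0" "Re (cis \<theta> * x) > 0" "Re (cis (- \<theta>) * x) > 0"
  shows "- 1 / 2 * (\<Sum>n. theta_term x n) = fps_nth KZ_F 0 +
    ((LINT r:{0<..}|lborel. laplace_integrand KZ_F x \<theta> r) + (LINT r:{0<..}|lborel. laplace_integrand KZ_F x (- \<theta>) r)) / 2"
proof -
  define R where "R = (\<lambda>\<phi>. ray_int 1 \<phi> x (\<lambda>w. trig_kernel (w / root6)))"
  define L where "L = (\<lambda>\<phi>. LINT r:{0<..}|lborel. laplace_integrand KZ_F x \<phi> r)"
  define P where "P = of_real (sqrt pi / 2) * x powr (- (3 / 2))"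
  define c0 where "c0 = fps_nth KZ_F 0"
  define T where "T = (\<Sum>n. theta_term x n)"
  have P0: "P \<noteq> 0" using x(1) by (auto simp: P_def)
  have sin: "sin \<theta> \<noteq> 0" "sin (- \<theta>) \<noteq> 0" using sin_gt_zero[of \<theta>] th by auto
  have L: "(L \<theta> + c0) * P = root6 / 2 * R \<theta>" "(L (- \<theta>) + c0) * P = root6 / 2 * R (- \<theta>)"
    unfolding L_def c0_def P_def R_def using th sin x by (intro laplace_integrand_KZ_F; simp)+
  have half: "sin (\<theta> / 2) > 0" using th by (intro sin_gt_zero) auto
  have Im: "Im (cis (\<theta> / 2) * of_real (sqrt r) / root6) > 0" "Im (- (cis (- \<theta> / 2) * of_real (sqrt r) / root6)) > 0" if "r > 0" for r
    using that half by simp_all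
  have "ray_int 1 \<theta> x (\<lambda>w. twisted_kernel 0 (w / root6)) = ray_int 1 \<theta> x (\<lambda>w. - \<i> * trig_kernel (w / root6))"
    unfolding ray_int_1 using twisted_kernel_0[OF Im(1)]
    by (intro arg_cong[of _ _ "(*) (cis \<theta>)"] set_lebesgue_integral_cong) auto
  hence A1: "ray_int 1 \<theta> x (\<lambda>w. twisted_kernel 0 (w / root6)) = - \<i> * R \<theta>" by (simp only: ray_int_cmult R_def)
  have "ray_int 1 (- \<theta>) x (\<lambda>w. twisted_kernel 0 (- (w / root6))) = ray_int 1 (- \<theta>) x (\<lambda>w. \<i> * trig_kernel (w / root6))"
    unfolding ray_int_1 using twisted_kernel_0[OF Im(2)]
    by (intro arg_cong[of _ _ "(*) (cis (- \<theta>))"] set_lebesgue_integral_cong) (auto simp: trig_kernel_minus)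
  hence A2: "ray_int 1 (- \<theta>) x (\<lambda>w. twisted_kernel 0 (- (w / root6))) = \<i> * R (- \<theta>)" by (simp only: ray_int_cmult R_def)
  define q where "q = root6"
  have q: "q \<noteq> 0" by (simp add: q_def)
  have rep: "(\<lambda>n. theta_term x n * (\<i> * of_real (sqrt pi / sqrt 6) * x powr (- (3 / 2)))) sums (- \<i> * R \<theta> - \<i> * R (- \<theta>))"
    using twisted.theta_representation(3)[OF th x, of 0] unfolding A1 A2 by (simp add: theta_term_def twisted_chi_def)
  have P6: "of_real (sqrt pi / sqrt 6) * x powr (- (3 / 2)) = 2 / q * P" by (simp add: P_def q_def)
  have "(\<lambda>n. theta_term x n * (\<i> * (2 / q * P)) * (q / (2 * \<i> * P))) sums ((- \<i> * R \<theta> - \<i> * R (- \<theta>)) * (q / (2 * \<i> * P)))"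
    by (intro sums_mult2) (use rep in \<open>simp only: P6[symmetric] mult.assoc\<close>)
  moreover have "theta_term x n * (\<i> * (2 / q * P)) * (q / (2 * \<i> * P)) = theta_term x n" for n
    using q P0 by simp
  ultimately have "theta_term x sums ((- \<i> * R \<theta> - \<i> * R (- \<theta>)) * (q / (2 * \<i> * P)))" by simp
  hence "T = (- \<i> * R \<theta> - \<i> * R (- \<theta>)) * (q / (2 * \<i> * P))" unfolding T_def by (rule sums_unique[symmetric])
  also have "\<dots> = - (q / 2 * R \<theta> + q / 2 * R (- \<theta>)) / P" using P0 by (simp add: field_simps)
  also have "\<dots> = - (L \<theta> + L (- \<theta>) + 2 * c0)"
    unfolding q_def L[symmetric] using P0 by (simp add: field_simps)
  finally have T: "T = - (L \<theta> + L (- \<theta>) + 2 * c0)" .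
  have "- 1 / 2 * T = c0 + (L \<theta> + L (- \<theta>)) / 2" unfolding T by (simp add: field_simps)
  thus ?thesis by (simp only: T_def L_def c0_def)
qed

lemma has_median_sum_KZ_F:
  assumes x: "Re x > 0"
  shows "has_median_sum KZ_F x (- 1 / 2 * (\<Sum>n. theta_term x n))"
proof -
  have "((\<lambda>\<theta>. Re (cis \<theta> * x)) \<longlongrightarrow> Re (cis 0 * x)) (at_right 0)"
       "((\<lambda>\<theta>. Re (cis (- \<theta>) * x)) \<longlongrightarrow> Re (cis (- 0) * x)) (at_right 0)"
    by (intro tendsto_intros)+
  from order_tendstoD(1)[OF this(1), of 0] order_tendstoD(1)[OF this(2), of 0]
  have "\<forall>\<^sub>F \<theta> in at_right 0. Re (cis \<theta> * x) > 0" "\<forall>\<^sub>F \<theta> in at_right 0. Re (cis (- \<theta>) * x) > 0"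
    using x by simp_all
  moreover have "\<forall>\<^sub>F \<theta> in at_right 0. \<theta> \<in> {0<..<pi / 2}" by (rule eventually_at_right_real) simp
  ultimately show ?thesis
    unfolding has_median_sum_def
  proof eventually_elim
    case (elim \<theta>)
    hence "sin \<theta> \<noteq> 0" using sin_gt_zero[of \<theta>] by auto
    thus ?case
      using median_representation[of \<theta> x] laplace_integrand_KZ_F(1)[of \<theta> x] laplace_integrand_KZ_F(1)[of "- \<theta>" x] elim x
      by simp
  qed
qed

text \<open>
  The defining equation holds for all small positive angles, hence for at least one.
\<close>

lemma has_median_sum_unique:
  assumes "has_median_sum F x s" "has_median_sum F x s'" shows "s = s'"
proof -
  have "\<forall>\<^sub>F \<theta> :: real in at_right 0. s = s'"
    using assms unfolding has_median_sum_def by eventually_elim simp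
  thus ?thesis by simp
qed

lemma median_sum_KZ_F:
  assumes "Re x > 0"
  shows "median_sum KZ_F x = - 1 / 2 * (\<Sum>n. theta_term x n)"
  unfolding median_sum_def
  by (rule the_equality, rule has_median_sum_KZ_F[OF assms]) (erule has_median_sum_unique[OF _ has_median_sum_KZ_F[OF assms]])

section \<open>Holomorphy and radial limits\<close>

lemma norm_theta_term_le:
  assumes "0 \<le> c" "24 * c \<le> Re (1 / x)"
  shows "norm (theta_term x n) \<le> real n ^ 1 * exp (- (c * (real n)\<^sup>2))"
proof -
  have "c * (real n)\<^sup>2 \<le> Re (1 / x) / 24 * (real n)\<^sup>2" using assms by (intro mult_right_mono) auto
  hence "norm (chi n) * exp (- (Re (1 / x) / 24 * (real n)\<^sup>2)) \<le> 1 * exp (- (c * (real n)\<^sup>2))"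
    using norm_chi_le by (intro mult_mono) auto
  hence "real n * (norm (chi n) * exp (- (Re (1 / x) / 24 * (real n)\<^sup>2))) \<le> real n * (1 * exp (- (c * (real n)\<^sup>2)))"
    by (intro mult_left_mono) auto
  thus ?thesis unfolding theta_term_def norm_mult norm_gaussian by (simp add: mult.assoc)
qed

lemma median_sum_KZ_F_holomorphic: "median_sum KZ_F holomorphic_on {x. Re x > 0}"
proof -
  define S where "S = {x :: complex. Re x > 0}"
  have opn: "open S" unfolding S_def by (rule open_halfspace_Re_gt)
  have "(\<lambda>x. \<Sum>n. theta_term x n) holomorphic_on S"
  proof (rule holomorphic_suminf[OF opn])
    fix n show "(\<lambda>x. theta_term x n) holomorphic_on S"
      unfolding theta_term_def by (intro holomorphic_intros) (auto simp: S_def)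
  next
    fix x assume "x \<in> S"
    hence x: "Re x > 0" by (simp add: S_def)
    define d where "d = Re x / 2"
    \<comment> \<open>a lower bound for the real part of \<open>1 / (24 * y)\<close> on the disc of radius \<open>d\<close>\<close>
    define c where "c = d / (norm x + d)\<^sup>2 / 24"
    have d: "d > 0" using x by (simp add: d_def)
    have "norm x + d > 0" using d by (intro add_nonneg_pos) auto
    hence c: "c > 0" using d by (simp add: c_def)
    show "\<exists>d M. 0 < d \<and> summable M \<and> (\<forall>n. \<forall>y\<in>ball x d \<inter> S. norm (theta_term y n) \<le> M n)"
    proof (intro exI conjI allI ballI)
      show "0 < d" by (rule d)
      show "summable (\<lambda>n. real n ^ 1 * exp (- (c * (real n)\<^sup>2)))" by (rule summable_gaussian[OF c])
      fix n y assume "y \<in> ball x d \<inter> S"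
      hence xy: "norm (x - y) < d" and y: "Re y > 0" by (simp_all add: dist_norm S_def)
      have "Re x - Re y \<le> norm (x - y)" using complex_Re_le_cmod[of "x - y"] by simp
      hence "d \<le> Re y" using xy by (simp add: d_def)
      moreover have "norm y \<le> norm x + d" using norm_triangle_ineq2[of y x] xy by (simp add: norm_minus_commute)
      moreover have "norm y > 0" using y by auto
      ultimately have "d / (norm x + d)\<^sup>2 \<le> Re y / (norm y)\<^sup>2"
        using d by (intro frac_le power_mono) auto
      also have "Re y / (norm y)\<^sup>2 = Re (1 / y)" by (simp add: Re_divide cmod_power2)
      finally show "norm (theta_term y n) \<le> real n ^ 1 * exp (- (c * (real n)\<^sup>2))"
        using c by (intro norm_theta_term_le) (simp_all add: c_def)
    qed
  qed
  hence "(\<lambda>x. - 1 / 2 * (\<Sum>n. theta_term x n)) holomorphic_on S" by (intro holomorphic_intros)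
  thus ?thesis
    unfolding S_def[symmetric] by (rule holomorphic_transform) (simp add: S_def median_sum_KZ_F)
qed

text \<open>
  The boundary point \<open>0\<close>, which corresponds to no root of unity. There every term of the theta series
  is exponentially small.
\<close>

lemma median_sum_KZ_F_tendsto_0: "has_radial_limit (median_sum KZ_F) 0 0"
  unfolding has_radial_limit_def
proof (rule Lim_null_comparison)
  define M where "M = (\<Sum>n. inverse (real n ^ 2))"
  have "((\<lambda>t. 576 * M * t\<^sup>2) \<longlongrightarrow> 576 * M * 0\<^sup>2) (at_right 0)" by (intro tendsto_intros)
  thus "((\<lambda>t. 576 * M * t\<^sup>2) \<longlongrightarrow> 0) (at_right 0)" by simp
  have "\<forall>\<^sub>F t::real in at_right 0. t > 0" by (rule eventually_at_right_less)
  thus "\<forall>\<^sub>F t in at_right 0. norm (median_sum KZ_F (0 + of_real t)) \<le> 576 * M * t\<^sup>2"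
  proof eventually_elim
    case (elim t)
    have s2: "summable (\<lambda>n. inverse (real n ^ 2))" by (rule inverse_power_summable) simp
    have le: "norm (theta_term (of_real t) n) \<le> 1152 * t\<^sup>2 * inverse (real n ^ 2)" for n
    proof (cases "n = 0")
      case False
      define y where "y = (1 / t / 24) * (real n)\<^sup>2"
      have y: "y > 0" using elim False by (simp add: y_def)
      have "norm (theta_term (of_real t) n) \<le> real n ^ 1 * exp (- y)"
        unfolding y_def using elim by (intro norm_theta_term_le) (simp_all add: Re_divide power2_eq_square)
      also have "exp (- y) \<le> 2 / y\<^sup>2"
      proof -
        have "y\<^sup>2 / fact 2 \<le> exp y" using y by (intro power_div_fact_le_exp) simp
        hence "inverse (exp y) \<le> inverse (y\<^sup>2 / 2)" using y by (intro le_imp_inverse_le) (auto simp: fact_numeral)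
        thus ?thesis by (simp add: exp_minus)
      qed
      hence "real n ^ 1 * exp (- y) \<le> real n ^ 1 * (2 / y\<^sup>2)" by (intro mult_left_mono) auto
      also have "\<dots> = 1152 * t\<^sup>2 * (1 / real n ^ 3)"
        using elim False by (simp add: y_def field_simps power2_eq_square power3_eq_cube)
      also have "\<dots> \<le> 1152 * t\<^sup>2 * inverse (real n ^ 2)"
      proof (intro mult_left_mono)
        have "real n ^ 2 \<le> real n ^ 3" using False by (intro power_increasing) auto
        thus "1 / real n ^ 3 \<le> inverse (real n ^ 2)"
          using False by (simp add: field_simps)
      qed simp
      finally show ?thesis .
    qed (simp add: theta_term_def)
    have "norm (\<Sum>n. theta_term (of_real t) n) \<le> (\<Sum>n. 1152 * t\<^sup>2 * inverse (real n ^ 2))"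
      by (rule norm_suminf_le[OF le summable_mult[OF s2]])
    also have "\<dots> = 2 * (576 * M * t\<^sup>2)" unfolding M_def using s2 by (subst suminf_mult) auto
    finally have "norm (\<Sum>n. theta_term (of_real t) n) \<le> 2 * (576 * M * t\<^sup>2)" .
    thus ?case using elim by (simp add: median_sum_KZ_F norm_mult)
  qed
qed

lemma radial_limit_at_rational:
  fixes \<alpha> :: rat
  assumes "\<alpha> \<noteq> 0"
  shows "has_radial_limit (median_sum KZ_F)
         (- 1 / (2 * complex_of_real pi * \<i> * of_rat \<alpha>))
         (exp (complex_of_real pi * \<i> * of_rat \<alpha> / 12) *
          KZ (exp (2 * complex_of_real pi * \<i> * of_rat \<alpha>)))"
proof -
  define a where "a = real_of_rat \<alpha>"
  obtain p q where pq: "quotient_of \<alpha> = (p, q)" by (cases "quotient_of \<alpha>")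
  have a: "complex_of_rat \<alpha> = of_real a" using quotient_of_div[OF pq] by (simp add: a_def of_rat_divide)
  have q: "q > 0" by (rule quotient_of_denom_pos[OF pq])
  have "a = of_int p / of_int q" using quotient_of_div[OF pq] by (simp add: a_def of_rat_divide)
  hence N: "nat q > 0" "a * real (nat q) = of_int p" using q by simp_all
  have "a \<noteq> 0" using assms by (simp add: a_def)
  define x0 where "x0 = - 1 / (2 * complex_of_real pi * \<i> * of_real a)"
  have x0: "Re x0 = 0" by (simp add: x0_def Re_divide)
  from theta_sum_limit[OF N \<open>a \<noteq> 0\<close> refl x0_def]
  have "((\<lambda>t. - 1 / 2 * (\<Sum>n. theta_term (x0 + of_real t) n)) \<longlongrightarrow>
     - 1 / 2 * (- 2 * (exp (\<i> * of_real (pi * a / 12)) * KZ (exp (2 * of_real pi * \<i> * of_real a))))) (at_right 0)"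
    by (intro tendsto_mult_left)
  moreover have "\<forall>\<^sub>F t::real in at_right 0. t > 0" by (rule eventually_at_right_less)
  hence "\<forall>\<^sub>F t in at_right 0. - 1 / 2 * (\<Sum>n. theta_term (x0 + of_real t) n) = median_sum KZ_F (x0 + of_real t)"
    by eventually_elim (simp add: median_sum_KZ_F x0)
  ultimately have "((\<lambda>t. median_sum KZ_F (x0 + of_real t)) \<longlongrightarrow>
     - 1 / 2 * (- 2 * (exp (\<i> * of_real (pi * a / 12)) * KZ (exp (2 * of_real pi * \<i> * of_real a))))) (at_right 0)"
    by (rule Lim_transform_eventually)
  thus ?thesis by (simp add: has_radial_limit_def x0_def a mult_ac)
qed

section \<open>The natural boundary\<close>

text \<open>
  A weight on the interval from \<open>-c\<close> to \<open>c\<close> that vanishes to second order at its ends.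
\<close>

definition bump :: "real \<Rightarrow> real \<Rightarrow> real" where
  "bump c y = (c\<^sup>2 - y\<^sup>2)\<^sup>2"

definition bump_hat :: "real \<Rightarrow> real \<Rightarrow> complex" where
  "bump_hat c \<mu> = (LINT y:{-c..c}|lborel. exp (\<i> * of_real (\<mu> * y)) * of_real (bump c y))"

lemma set_integral_interval_eqI:
  fixes f :: "real \<Rightarrow> complex"
  assumes "continuous_on {a..b} f" "(f has_integral I) {a..b}"
  shows "(LINT y:{a..b}|lborel. f y) = I"
  by (rule trans[OF set_borel_integral_eq_integral(2)[OF borel_integrable_atLeastAtMost'[OF assms(1)]] integral_unique[OF assms(2)]])

lemma bump_hat_0:
  assumes "c > 0" shows "bump_hat c 0 = of_real (16 / 15 * c ^ 5)"
proof -
  define \<Phi> where "\<Phi> = (\<lambda>y. c ^ 4 * y - 2 / 3 * c\<^sup>2 * y ^ 3 + y ^ 5 / 5)"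
  have "(\<Phi> has_real_derivative bump c y) (at y within {-c..c})" for y
    unfolding \<Phi>_def bump_def
    by (auto intro!: derivative_eq_intros simp: power2_eq_square algebra_simps power4_eq_xxxx power3_eq_cube)
  hence "(bump c has_integral (\<Phi> c - \<Phi> (- c))) {- c..c}"
    using assms by (intro fundamental_theorem_of_calculus) (auto simp: has_real_derivative_iff_has_vector_derivative)
  also have "\<Phi> c - \<Phi> (- c) = 16 / 15 * c ^ 5" by (simp add: \<Phi>_def power_numeral_reduce)
  finally have "((\<lambda>y. complex_of_real (bump c y)) has_integral of_real (16 / 15 * c ^ 5)) {-c..c}"
    by (rule has_integral_of_real)
  thus ?thesis unfolding bump_hat_def
    by (intro set_integral_interval_eqI continuous_intros) (auto simp: bump_def intro!: continuous_intros)
qed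

text \<open>
  Integrating by parts five times, the boundary terms start at order \<open>\<mu>\<^sup>-\<^sup>3\<close> because of the double zeros.
  The bound on \<open>\<mu>\<close> from below absorbs the higher orders; \<open>1/24\<close> is the smallest gap between the
  frequencies \<open>n\<^sup>2 / 24\<close>.
\<close>

lemma norm_bump_hat_le:
  assumes c: "c > 0" and \<mu>: "\<bar>\<mu>\<bar> \<ge> 1 / 24"
  shows "norm (bump_hat c \<mu>) \<le> (16 * c\<^sup>2 + 1152 * c + 27648) / \<bar>\<mu>\<bar> ^ 3"
proof -
  define k where "k = \<i> * complex_of_real \<mu>"
  have k0: "k \<noteq> 0" using \<mu> by (auto simp: k_def)
  have nk: "norm k = \<bar>\<mu>\<bar>" by (simp add: k_def norm_mult)
  define C where "C = complex_of_real c"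
  \<comment> \<open>the polynomial \<open>Q\<close> collects the repeated integrations by parts, \<open>j\<close> standing for the integral of \<open>exp (k * z)\<close>\<close>
  define j where "j = 1 / k"
  have kj: "k * j = 1" "k * j ^ 2 = j" "k * j ^ 3 = j ^ 2" "k * j ^ 4 = j ^ 3" "k * j ^ 5 = j ^ 4"
    using k0 by (simp_all add: j_def power_numeral_reduce)
  have nj: "norm j = 1 / \<bar>\<mu>\<bar>" by (simp add: j_def norm_divide nk)
  define Q where "Q = (\<lambda>z::complex. (C\<^sup>2 - z\<^sup>2)\<^sup>2 * j - 4 * z * (z\<^sup>2 - C\<^sup>2) * j ^ 2 + (12 * z\<^sup>2 - 4 * C\<^sup>2) * j ^ 3 - 24 * z * j ^ 4 + 24 * j ^ 5)"
  define f where "f = (\<lambda>y::real. exp (\<i> * of_real (\<mu> * y)) * complex_of_real (bump c y))"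
  have der: "((\<lambda>y::real. exp (k * of_real y) * Q (of_real y)) has_vector_derivative f y) (at y within {-c..c})" for y
  proof -
    define z where "z = complex_of_real y"
    define dQ where "dQ = 4 * z * (z\<^sup>2 - C\<^sup>2) * j - (12 * z\<^sup>2 - 4 * C\<^sup>2) * j ^ 2 + 24 * z * j ^ 3 - 24 * j ^ 4"
    have dQ: "(Q has_field_derivative dQ) (at z)"
      unfolding Q_def dQ_def by (auto intro!: derivative_eq_intros simp: algebra_simps power2_eq_square)
    have de: "((\<lambda>z. exp (k * z)) has_field_derivative exp (k * z) * k) (at z)"
      by (auto intro!: derivative_eq_intros)
    have "((\<lambda>z. exp (k * z) * Q z) has_field_derivative exp (k * z) * k * Q z + dQ * exp (k * z)) (at z)"
      by (rule DERIV_mult'[OF de dQ, THEN DERIV_cong]) simp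
    also have "exp (k * z) * k * Q z + dQ * exp (k * z) = exp (k * z) * (k * Q z + dQ)" by (simp add: algebra_simps)
    also have "k * Q z + dQ = (C\<^sup>2 - z\<^sup>2)\<^sup>2"
    proof -
      have "k * Q z = (C\<^sup>2 - z\<^sup>2)\<^sup>2 * (k * j) - 4 * z * (z\<^sup>2 - C\<^sup>2) * (k * j ^ 2) + (12 * z\<^sup>2 - 4 * C\<^sup>2) * (k * j ^ 3) - 24 * z * (k * j ^ 4) + 24 * (k * j ^ 5)"
        unfolding Q_def by (simp add: distrib_left right_diff_distrib mult_ac)
      thus ?thesis unfolding kj dQ_def by simp
    qed
    also have "exp (k * z) * (C\<^sup>2 - z\<^sup>2)\<^sup>2 = f y" by (simp add: f_def k_def z_def C_def bump_def mult.assoc)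
    finally have "((\<lambda>z. exp (k * z) * Q z) has_field_derivative f y) (at (of_real y))" unfolding z_def .
    hence "((\<lambda>y::real. exp (k * of_real y) * Q (of_real y)) has_vector_derivative f y) (at y)"
      by (rule has_vector_derivative_real_field)
    thus ?thesis by (rule has_vector_derivative_at_within)
  qed
  have FTC: "(f has_integral (exp (k * of_real c) * Q (of_real c) - exp (k * of_real (- c)) * Q (of_real (- c)))) {- c..c}"
  proof (rule fundamental_theorem_of_calculus)
    show "((\<lambda>y::real. exp (k * of_real y) * Q (of_real y)) has_vector_derivative f y) (at y within {-c..c})" for y
      by (rule der)
  qed (use c in simp)
  have fc: "continuous_on {-c..c} f" unfolding f_def bump_def by (intro continuous_intros)
  have I: "bump_hat c \<mu> = exp (k * of_real c) * Q (of_real c) - exp (k * of_real (- c)) * Q (of_real (- c))"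
    unfolding bump_hat_def f_def[symmetric] by (rule set_integral_interval_eqI[OF fc FTC])
  have ne: "norm (exp (k * of_real y)) = 1" for y by (simp add: k_def)
  have Q: "norm (Q (of_real y)) \<le> (8 * c\<^sup>2 + 576 * c + 13824) / \<bar>\<mu>\<bar> ^ 3" if y: "y\<^sup>2 = c\<^sup>2" for y
  proof -
    have "\<bar>y\<bar> = c" using y c by (auto simp: power2_eq_iff)
    have yc: "(complex_of_real y)\<^sup>2 = C\<^sup>2" using y by (simp add: C_def flip: of_real_power)
    have Qy: "Q (of_real y) = 8 * C\<^sup>2 * j ^ 3 - 24 * of_real y * j ^ 4 + 24 * j ^ 5"
      unfolding Q_def yc by simp
    have "norm (Q (of_real y)) \<le> norm (8 * C\<^sup>2 * j ^ 3) + norm (24 * of_real y * j ^ 4) + norm (24 * j ^ 5)"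
      unfolding Qy by (rule order_trans[OF norm_triangle_ineq add_right_mono[OF norm_triangle_ineq4]])
    also have "\<dots> = (8 * c\<^sup>2 + 24 * c / \<bar>\<mu>\<bar> + 24 / \<bar>\<mu>\<bar> ^ 2) / \<bar>\<mu>\<bar> ^ 3"
      using c \<mu> \<open>\<bar>y\<bar> = c\<close> by (simp add: norm_mult norm_divide norm_power nj C_def add_divide_distrib power_numeral_reduce)
    also have "\<dots> \<le> (8 * c\<^sup>2 + 576 * c + 13824) / \<bar>\<mu>\<bar> ^ 3"
    proof (intro divide_right_mono add_mono order_refl)
      have i: "1 / \<bar>\<mu>\<bar> \<le> 24" using \<mu> by (simp add: field_simps)
      have "24 * c * (1 / \<bar>\<mu>\<bar>) \<le> 24 * c * 24" using c by (intro mult_left_mono i) auto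
      thus "24 * c / \<bar>\<mu>\<bar> \<le> 576 * c" by simp
      have "(1 / \<bar>\<mu>\<bar>) ^ 2 \<le> 24 ^ 2" using i by (intro power_mono) auto
      thus "24 / \<bar>\<mu>\<bar> ^ 2 \<le> 13824" by (simp add: power_divide)
    qed simp
    finally show ?thesis .
  qed
  have "norm (bump_hat c \<mu>) \<le> norm (Q (of_real c)) + norm (Q (of_real (- c)))"
    unfolding I using norm_triangle_ineq4[of "exp (k * of_real c) * Q (of_real c)" "exp (k * of_real (- c)) * Q (of_real (- c))"]
    unfolding norm_mult ne mult_1_left .
  also have "\<dots> \<le> (8 * c\<^sup>2 + 576 * c + 13824) / \<bar>\<mu>\<bar> ^ 3 + (8 * c\<^sup>2 + 576 * c + 13824) / \<bar>\<mu>\<bar> ^ 3"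
    by (intro add_mono Q) auto
  also have "\<dots> = (16 * c\<^sup>2 + 1152 * c + 27648) / \<bar>\<mu>\<bar> ^ 3" by (simp flip: add_divide_distrib)
  finally show ?thesis .
qed

text \<open>
  On a vertical line the series is a Fourier series with frequencies \<open>n\<^sup>2 / 24\<close>. Its integral over a short
  arc against \<open>e\<^sup>i\<^sup>\<lambda>\<^sup>y\<close> and the weight, \<open>\<lambda>\<close> being the \<open>N\<close>-th frequency, isolates the \<open>N\<close>-th coefficient:
  the others contribute at most \<open>n / (N\<^sup>2 - n\<^sup>2)\<^sup>3\<close> up to a constant, and since
  \<open>\<bar>N\<^sup>2 - n\<^sup>2\<bar> \<ge> n\<close> this is summable uniformly in \<open>N\<close>. A bound for the series on the arc, uniform as
  the line approaches the boundary, would therefore bound the coefficients \<open>N * chi N\<close>.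
\<close>

lemma theta_unbounded_near_arc:
  assumes \<tau>: "Re \<tau> = 0" and c: "c > 0" and e: "e > 0"
    and B: "\<And>\<sigma> y. 0 < \<sigma> \<Longrightarrow> \<sigma> < e \<Longrightarrow> \<bar>y\<bar> \<le> c \<Longrightarrow> norm (\<Sum>n. theta_term (1 / (\<tau> + of_real \<sigma> + \<i> * of_real y)) n) \<le> B"
  shows False
proof -
  define freq where "freq = (\<lambda>n::nat. (real n)\<^sup>2 / 24)"
  define \<kappa> where "\<kappa> = 16 / 15 * c ^ 5"
  define D where "D = 16 * c\<^sup>2 + 1152 * c + 27648"
  define Z where "Z = (\<Sum>n. inverse (real n ^ 2))"
  have \<kappa>: "\<kappa> > 0" using c by (simp add: \<kappa>_def)
  have D: "D > 0" using c by (simp add: D_def add_nonneg_pos)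
  have s2: "summable (\<lambda>n. inverse (real n ^ 2))" by (rule inverse_power_summable) simp
  have bound: "norm (chi N) * real N * exp (- (\<sigma> * freq N)) * \<kappa> \<le> B * \<kappa> + D * 13824 * Z" if \<sigma>: "0 < \<sigma>" "\<sigma> < e" for \<sigma> N
  proof -
    define b where "b = (\<lambda>n. of_nat n * chi n * exp (- (of_real (freq n) * (\<tau> + of_real \<sigma>))))"
    define f where "f = (\<lambda>n y. b n * (exp (\<i> * of_real ((freq N - freq n) * y)) * complex_of_real (bump c y)))"
    define S where "S = (\<lambda>y. \<Sum>n. theta_term (1 / (\<tau> + of_real \<sigma> + \<i> * of_real y)) n)"
    define F where "F = (\<lambda>y. S y * (exp (\<i> * of_real (freq N * y)) * complex_of_real (bump c y)))"
    have nb: "norm (b n) = real n * norm (chi n) * exp (- (\<sigma> * freq n))" for n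
      using \<tau> by (simp add: b_def norm_mult mult_ac)
    have nb_le: "norm (b n) \<le> real n ^ 1 * exp (- (\<sigma> / 24 * (real n)\<^sup>2))" for n
      unfolding nb using norm_chi_le[of n] by (simp add: freq_def mult_right_mono mult_left_le)
    have sb: "summable (\<lambda>n. norm (b n))"
      by (rule summable_comparison_test'[OF summable_gaussian[of "\<sigma> / 24" 1]]) (use nb_le \<sigma> in auto)
    have th: "theta_term (1 / (\<tau> + of_real \<sigma> + \<i> * of_real y)) n = b n * exp (- (\<i> * of_real (freq n * y)))" for n y
    proof -
      have e: "- (of_nat n)\<^sup>2 / (24 * (1 / (\<tau> + of_real \<sigma> + \<i> * of_real y))) = - (of_real (freq n) * (\<tau> + of_real \<sigma>)) + - (\<i> * of_real (freq n * y))"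
        by (simp add: freq_def field_simps)
      show ?thesis unfolding theta_term_def b_def e exp_add by simp
    qed
    have nbump: "bump c y \<ge> 0" for y by (simp add: bump_def)
    have nf: "norm (f n y) = norm (b n) * bump c y" for n y
      unfolding f_def norm_mult using nbump[of y] by simp
    have fi: "set_integrable lborel {-c..c} (f n)" for n
      unfolding f_def bump_def by (intro borel_integrable_atLeastAtMost' continuous_intros)
    have bi: "set_integrable lborel {-c..c} (\<lambda>y. K * bump c y)" for K
      unfolding bump_def by (intro borel_integrable_atLeastAtMost' continuous_intros)
    have f_sums: "(\<lambda>n. f n y) sums F y" if "y \<in> {-c..c}" for y
    proof -
      have "summable (\<lambda>n. theta_term (1 / (\<tau> + of_real \<sigma> + \<i> * of_real y)) n)"
        unfolding th by (rule summable_norm_cancel) (use sb in \<open>simp add: norm_mult\<close>)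
      hence "(\<lambda>n. theta_term (1 / (\<tau> + of_real \<sigma> + \<i> * of_real y)) n * (exp (\<i> * of_real (freq N * y)) * complex_of_real (bump c y))) sums F y"
        unfolding F_def S_def by (intro sums_mult2 summable_sums)
      moreover have "theta_term (1 / (\<tau> + of_real \<sigma> + \<i> * of_real y)) n * (exp (\<i> * of_real (freq N * y)) * complex_of_real (bump c y)) = f n y" for n
      proof -
        have "exp (\<i> * of_real ((freq N - freq n) * y)) = exp (- (\<i> * of_real (freq n * y))) * exp (\<i> * of_real (freq N * y))"
          by (simp add: algebra_simps flip: exp_add)
        thus ?thesis unfolding th f_def by (simp only: mult_ac)
      qed
      ultimately show ?thesis by simp
    qed
    have f_dom: "norm (\<Sum>n<M. f n y) \<le> (\<Sum>n. norm (b n)) * bump c y" if "y \<in> {-c..c}" for M y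
    proof -
      have "norm (\<Sum>n<M. f n y) \<le> (\<Sum>n<M. norm (b n) * bump c y)" by (rule sum_norm_le) (simp add: nf)
      also have "\<dots> = (\<Sum>n<M. norm (b n)) * bump c y" by (simp add: sum_distrib_right)
      also have "\<dots> \<le> (\<Sum>n. norm (b n)) * bump c y" by (intro mult_right_mono sum_le_suminf sb nbump) auto
      finally show ?thesis .
    qed
    note dom = set_integral_dominated_sums[of "{-c..c}" f, OF fi bi _ f_sums f_dom]
    define I where "I = (LINT y:{-c..c}|lborel. F y)"
    define g where "g = (\<lambda>n. b n * bump_hat c (freq N - freq n))"
    have "(\<lambda>n. LINT y:{-c..c}|lborel. f n y) sums I" unfolding I_def by (rule dom(2)) auto
    hence "g sums I" unfolding f_def set_integral_mult_right g_def bump_hat_def .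
    hence rest: "(\<lambda>n. g n - (if n = N then g n else 0)) sums (I - g N)" by (intro sums_diff sums_single)
    have "norm I \<le> (LINT y:{-c..c}|lborel. B * bump c y)"
      unfolding I_def
    proof (rule norm_set_integral_le[OF _ bi])
      show "set_integrable lborel {-c..c} F" by (rule dom(1)) auto
      fix y assume "y \<in> {-c..c}"
      hence "norm (S y) \<le> B" unfolding S_def by (intro B \<sigma>) auto
      hence "norm (S y) * bump c y \<le> B * bump c y" by (intro mult_right_mono nbump)
      thus "norm (F y) \<le> B * bump c y" unfolding F_def norm_mult using nbump[of y] by simp
    qed
    also have "\<dots> = B * \<kappa>"
    proof -
      have "complex_of_real (LINT y:{-c..c}|lborel. bump c y) = bump_hat c 0"
        by (simp add: bump_hat_def set_integral_complex_of_real)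
      hence "(LINT y:{-c..c}|lborel. bump c y) = \<kappa>" unfolding bump_hat_0[OF c] \<kappa>_def of_real_eq_iff .
      thus ?thesis by simp
    qed
    finally have I: "norm I \<le> B * \<kappa>" .
    have "norm (I - g N) \<le> (\<Sum>n. D * 13824 * inverse (real n ^ 2))"
      unfolding sums_unique[OF rest]
    proof (rule norm_suminf_le[OF _ summable_mult[OF s2]])
      fix n
      show "norm (g n - (if n = N then g n else 0)) \<le> D * 13824 * inverse (real n ^ 2)"
      proof (cases "n = N \<or> n = 0")
        case True
        thus ?thesis using D by (auto simp: g_def b_def)
      next
        case False
        define \<mu> where "\<mu> = freq N - freq n"
        have m: "\<mu> = (real N - real n) * (real N + real n) / 24" by (simp add: \<mu>_def freq_def algebra_simps power2_eq_square diff_divide_distrib)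
        have "\<bar>\<mu>\<bar> = \<bar>real N - real n\<bar> * (real N + real n) / 24" unfolding m by (simp add: abs_mult)
        moreover have "1 * real n \<le> \<bar>real N - real n\<bar> * (real N + real n)"
          using False by (intro mult_mono) auto
        ultimately have \<mu>: "real n / 24 \<le> \<bar>\<mu>\<bar>" by simp
        have n1: "1 \<le> real n" using False by simp
        have "norm (bump_hat c \<mu>) \<le> D / \<bar>\<mu>\<bar> ^ 3"
          unfolding D_def by (rule norm_bump_hat_le[OF c]) (use \<mu> n1 in linarith)
        also have "\<dots> \<le> D / (real n / 24) ^ 3"
          using D \<mu> n1 by (intro divide_left_mono power_mono mult_pos_pos zero_less_power) auto
        finally have bh: "norm (bump_hat c \<mu>) \<le> D / (real n / 24) ^ 3" .
        have "norm (b n) \<le> real n * 1"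
          unfolding nb mult.assoc using norm_chi_le[of n] \<sigma> by (intro mult_left_mono mult_le_one) (auto simp: freq_def)
        hence "norm (g n) \<le> real n * 1 * (D / (real n / 24) ^ 3)"
          unfolding g_def norm_mult \<mu>_def[symmetric] by (intro mult_mono bh) auto
        also have "\<dots> = D * 13824 * inverse (real n ^ 2)"
          using n1 by (simp add: field_simps power3_eq_cube power2_eq_square)
        finally show ?thesis using False by simp
      qed
    qed
    also have "\<dots> = D * 13824 * Z" unfolding Z_def by (rule suminf_mult[OF s2])
    finally have "norm (I - g N) \<le> D * 13824 * Z" .
    hence "norm (g N) \<le> B * \<kappa> + D * 13824 * Z"
      using I norm_triangle_ineq2[of "g N" I] by (simp add: norm_minus_commute)
    moreover have "norm (g N) = norm (b N) * \<kappa>"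
      using \<kappa> by (simp add: g_def norm_mult norm_power bump_hat_0[OF c] \<kappa>_def)
    ultimately show ?thesis unfolding nb by (simp add: mult_ac)
  qed
  define W where "W = B * \<kappa> + D * 13824 * Z"
  have "real (12 * j + 1) * \<kappa> \<le> W" for j
  proof -
    define N where "N = 12 * j + 1"
    \<comment> \<open>an index with \<open>chi N = 1\<close>\<close>
    have "N mod 12 = 1" by (simp add: N_def mod_Suc)
    hence "chi N = 1" by (simp add: chi_def)
    have "((\<lambda>\<sigma>. real N * exp (- (\<sigma> * freq N)) * \<kappa>) \<longlongrightarrow> real N * exp (- (0 * freq N)) * \<kappa>) (at_right 0)"
      by (intro tendsto_intros)
    moreover have "\<forall>\<^sub>F \<sigma> in at_right 0. real N * exp (- (\<sigma> * freq N)) * \<kappa> \<le> W"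
      using eventually_at_right_real[OF e] 
      by eventually_elim (use bound[of _ N] \<open>chi N = 1\<close> in \<open>simp add: W_def\<close>)
    ultimately have "real N * exp (- (0 * freq N)) * \<kappa> \<le> W"
      by (rule tendsto_upperbound) simp
    thus ?thesis by (simp add: N_def)
  qed
  moreover obtain j :: nat where "W / \<kappa> < real j" using reals_Archimedean2 by blast
  ultimately have "real (12 * j + 1) * \<kappa> < real j * \<kappa>" using \<kappa> by (metis le_less_trans pos_divide_less_eq)
  thus False using \<kappa> by simp
qed

text \<open>
  A holomorphic extension would be bounded near a boundary point different from \<open>0\<close>; in the variable
  \<open>1/x\<close> the boundary stays the imaginary axis, and a neighbourhood contains an arc.
\<close>

lemma natural_boundary_KZ_F: "imaginary_axis_natural_boundary (median_sum KZ_F)"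
  unfolding imaginary_axis_natural_boundary_def
proof (intro conjI median_sum_KZ_F_holomorphic allI impI notI)
  fix x0 r h
  assume asm: "Re x0 = 0 \<and> r > 0 \<and> h holomorphic_on ball x0 r"
    and ext: "\<forall>x\<in>ball x0 r. Re x > 0 \<longrightarrow> h x = median_sum KZ_F x"
  \<comment> \<open>move away from \<open>0\<close>, where inversion is not defined\<close>
  define b where "b = (if Im x0 = 0 then r / 2 else Im x0)"
  define x1 where "x1 = \<i> * of_real b"
  have b: "b \<noteq> 0" using asm by (simp add: b_def)
  have x0: "x0 = \<i> * of_real (Im x0)" using asm by (simp add: complex_eq_iff)
  have x1: "x1 \<in> ball x0 r"
  proof -
    have "x0 - x1 = \<i> * of_real (Im x0 - b)" by (subst x0) (simp add: x1_def algebra_simps)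
    hence "norm (x0 - x1) = \<bar>Im x0 - b\<bar>" by (simp add: norm_mult del: of_real_diff)
    thus ?thesis using asm by (simp add: dist_norm b_def)
  qed
  define \<tau> where "\<tau> = 1 / x1"
  have \<tau>0: "\<tau> \<noteq> 0" "Re \<tau> = 0" "1 / \<tau> = x1" using b by (simp_all add: \<tau>_def x1_def Re_divide)
  have inv: "((\<lambda>t. 1 / t) \<longlongrightarrow> x1) (nhds \<tau>)"
  proof -
    have "isCont (\<lambda>t. 1 / t) \<tau>" using \<tau>0 by (intro continuous_intros)
    hence "((\<lambda>t. 1 / t) \<longlongrightarrow> 1 / \<tau>) (nhds \<tau>)" by (simp only: isCont_def tendsto_at_iff_tendsto_nhds)
    thus ?thesis by (simp only: \<tau>0(3))
  qed
  have "isCont h x1"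
    using asm x1 holomorphic_on_imp_continuous_on continuous_on_eq_continuous_at open_ball by blast
  hence "(h \<longlongrightarrow> h x1) (nhds x1)" by (simp add: isCont_def tendsto_at_iff_tendsto_nhds)
  hence "((\<lambda>t. h (1 / t)) \<longlongrightarrow> h x1) (nhds \<tau>)" by (rule filterlim_compose[OF _ inv])
  hence "((\<lambda>t. norm (h (1 / t))) \<longlongrightarrow> norm (h x1)) (nhds \<tau>)" by (rule tendsto_norm)
  hence "\<forall>\<^sub>F t in nhds \<tau>. norm (h (1 / t)) < norm (h x1) + 1" by (rule order_tendstoD) simp
  moreover have "\<forall>\<^sub>F t in nhds \<tau>. 1 / t \<in> ball x0 r"
    by (rule topological_tendstoD[OF inv open_ball x1])
  ultimately have "\<forall>\<^sub>F t in nhds \<tau>. norm (h (1 / t)) < norm (h x1) + 1 \<and> 1 / t \<in> ball x0 r"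
    by (rule eventually_conj)
  then obtain e where e: "e > 0" "\<And>t. dist t \<tau> < e \<Longrightarrow> norm (h (1 / t)) < norm (h x1) + 1 \<and> 1 / t \<in> ball x0 r"
    unfolding eventually_nhds_metric by blast
  show False
  proof (rule theta_unbounded_near_arc[OF \<tau>0(2), of "e / 2" "e / 2" "2 * (norm (h x1) + 1)"])
    fix \<sigma> y :: real assume \<sigma>: "0 < \<sigma>" "\<sigma> < e / 2" "\<bar>y\<bar> \<le> e / 2"
    define t where "t = \<tau> + of_real \<sigma> + \<i> * of_real y"
    have "norm (t - \<tau>) \<le> norm (complex_of_real \<sigma>) + norm (\<i> * complex_of_real y)"
      unfolding t_def using norm_triangle_ineq[of "of_real \<sigma>" "\<i> * of_real y"] by (simp add: add.assoc)
    also have "\<dots> < e" using \<sigma> by (simp add: norm_mult)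
    finally have t: "norm (h (1 / t)) < norm (h x1) + 1" "1 / t \<in> ball x0 r" using e(2)[of t] by (auto simp: dist_norm)
    have "Re t > 0" using \<sigma> \<tau>0 by (simp add: t_def)
    hence R: "Re (1 / t) > 0" by (rule Re_inverse_pos)
    hence "h (1 / t) = - 1 / 2 * (\<Sum>n. theta_term (1 / t) n)" using ext t(2) median_sum_KZ_F by simp
    hence "(\<Sum>n. theta_term (1 / t) n) = - 2 * h (1 / t)" by simp
    thus "norm (\<Sum>n. theta_term (1 / (\<tau> + of_real \<sigma> + \<i> * of_real y)) n) \<le> 2 * (norm (h x1) + 1)"
      using t(1) unfolding t_def[symmetric] by (simp add: norm_mult)
  qed (use e in auto)
qed

theorem theorem2:
  shows "has_resurgent_borel_transform KZ_F \<and>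
    (\<exists>N. N \<subseteq> complex_of_real ` {0<..} \<and> resurgent_outside N KZ_F) \<and>
    (\<forall>x. Re x > 0 \<longrightarrow> (\<exists>s. has_median_sum KZ_F x s)) \<and>
    imaginary_axis_natural_boundary (median_sum KZ_F) \<and>
    (\<forall>\<beta> :: rat. \<exists>l. has_radial_limit (median_sum KZ_F)
       (1 / (2 * complex_of_real pi * \<i>) * of_rat \<beta>) l) \<and>
    (\<forall>\<alpha> :: rat. \<alpha> \<noteq> 0 \<longrightarrow>
       has_radial_limit (median_sum KZ_F)
         (- 1 / (2 * complex_of_real pi * \<i> * of_rat \<alpha>))
         (exp (complex_of_real pi * \<i> * of_rat \<alpha> / 12) *
          KZ (exp (2 * complex_of_real pi * \<i> * of_rat \<alpha>))))"
proof (intro conjI allI impI)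
  show "has_resurgent_borel_transform KZ_F"
    using resurgent_outside_sings_KZ_F by (auto simp: has_resurgent_borel_transform_def)
  have "sings \<subseteq> complex_of_real ` {0<..}" using sing_pos by (auto simp: sings_def)
  thus "\<exists>N. N \<subseteq> complex_of_real ` {0<..} \<and> resurgent_outside N KZ_F"
    using resurgent_outside_sings_KZ_F by blast
  show "\<exists>s. has_median_sum KZ_F x s" if "Re x > 0" for x
    using has_median_sum_KZ_F[OF that] by blast
  show "imaginary_axis_natural_boundary (median_sum KZ_F)" by (rule natural_boundary_KZ_F)
  show "\<exists>l. has_radial_limit (median_sum KZ_F) (1 / (2 * complex_of_real pi * \<i>) * of_rat \<beta>) l" for \<beta>
  proof (cases "\<beta> = 0")
    case True
    thus ?thesis using median_sum_KZ_F_tendsto_0 by auto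
  next
    case False
    \<comment> \<open>the point is the one that belongs to \<open>\<alpha> = -1/\<beta>\<close>\<close>
    have "- 1 / (2 * complex_of_real pi * \<i> * of_rat (- 1 / \<beta>)) = 1 / (2 * complex_of_real pi * \<i>) * of_rat \<beta>"
      using False by (simp add: of_rat_divide of_rat_minus)
    thus ?thesis using radial_limit_at_rational[of "- 1 / \<beta>"] False by auto
  qed
qed (rule radial_limit_at_rational)

end
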